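(* For every $n\ge 1$ there is a constant $c_n>0$ depending only on $n$ such that the following holds. Let $0<\delta<1$ and $\beta>0$, let $1\le p<\frac n\delta\min\{1,\beta\}$, and let $\mu$ be any non-negative Borel measure on $\mathbb{R}^n$ such that $M_{n-\frac{p\delta}{\beta}}(\mu)$ is finite almost everywhere. Then $$\left(\int_{\mathbb{R}^n}|u(x)|^p\,\big(M_{n-\frac{p\delta}{\beta}}\mu(x)\big)^{\beta}\,dx\right)^{\frac1p}\le c_n^{\beta+1}\,(1-\delta)^{\frac1p}\,\frac{p}{(n-\delta p)^{1+\frac1p}}\,\mu(\mathbb{R}^n)^{\frac\beta p}\left(\int_{\mathbb{R}^n}\int_{\mathbb{R}^n}\frac{|u(x)-u(y)|^p}{|x-y|^{n+\delta p}}\,dy\,dx\right)^{\frac1p}$$ whenever $u\in\mathcal{F}_w$ with $w=(M_{n-\frac{p\delta}{\beta}}\mu)^\beta$. Hence, if $\beta=1$ and $\mu$ is the Dirac mass at the origin (so $1\le p<\frac n\delta$), $$\left(\int_{\mathbb{R}^n}|u(x)|^p\,\frac{1}{|x|^{\delta p}}\,dx\right)^{\frac1p}\le c_n\,(1-\delta)^{\frac1p}\,\frac{p}{(n-\delta p)^{1+\frac1p}}\left(\int_{\mathbb{R}^n}\int_{\mathbb{R}^n}\frac{|u(x)-u(y)|^p}{|x-y|^{n+\delta p}}\,dy\,dx\right)^{\frac1p}$$ whenever $u\in\mathcal{F}_w$ with $w(x)=\frac{1}{|x|^{\delta p}}$ (with a possibly different constant $c_n$ depending only on $n$).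
   Context: A cube in $\mathbb{R}^n$ is a cartesian product of $n$ intervals of the same side length $\ell(Q)$. For $\alpha\ge0$ and a non-negative Borel measure $\mu$, the fractional maximal function is $M_\alpha\mu(x)=\sup_{R\ni x}\ell(R)^\alpha\frac{\mu(R)}{|R|}$, the supremum over all cubes $R$ in $\mathbb{R}^n$ containing $x$. A weight is a function $w\in L^1_{\mathrm{loc}}(\mathbb{R}^n)$ with $w(x)>0$ for a.e. $x$; $w(Q)=\int_Q w\,dx$. For a weight $w$, $\mathcal{F}_w$ is the class of functions $u\in L^1_{\mathrm{loc}}(\mathbb{R}^n)\cap L^1_{\mathrm{loc}}(\mathbb{R}^n;w\,dx)$ for which there exists an increasing sequence of cubes $\{Q_j\}_{j\in\mathbb{N}}$ with $\mathbb{R}^n=\bigcup_j Q_j$ and $\lim_{j\to\infty}\frac1{w(Q_j)}\int_{Q_j}u\,w\,dx=0$. *)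

theory Defs
  imports "HOL-Analysis.Analysis"
begin

text \<open>
  \<open>is_cube l Q\<close>: the set \<open>Q\<close> is a cartesian product of nondegenerate bounded intervals of common
  length \<open>l\<close>.  The sandwich condition says that \<open>I i\<close> is an interval (open, closed or half-open)
  with end points \<open>a i\<close> and \<open>a i + l\<close>.
\<close>
definition is_cube :: "real \<Rightarrow> (real ^ 'n) set \<Rightarrow> bool" where
  "is_cube l Q \<longleftrightarrow> 0 < l \<and>
     (\<exists>I a. Q = {x. \<forall>i. x $ i \<in> I i} \<and>
            (\<forall>i. {a i <..< a i + l} \<subseteq> I i \<and> I i \<subseteq> {a i .. a i + l}))"

definition frac_maximal :: "real \<Rightarrow> (real ^ 'n) measure \<Rightarrow> real ^ 'n \<Rightarrow> ennreal" where
  "frac_maximal \<alpha> \<mu> x =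
     (SUP (l, R) \<in> {(l, R). is_cube l R \<and> x \<in> R}.
        ennreal (l powr \<alpha>) * (emeasure \<mu> R / emeasure lebesgue R))"

text \<open>Real powers on \<open>[0, \<infinity>]\<close>, meant for exponents \<open>r > 0\<close> only.\<close>
definition ennpowr :: "ennreal \<Rightarrow> real \<Rightarrow> ennreal" where
  "ennpowr a r = (if a = \<infinity> then \<infinity> else ennreal (enn2real a powr r))"

definition locally_integrable :: "'a::euclidean_space measure \<Rightarrow> ('a \<Rightarrow> real) \<Rightarrow> bool" where
  "locally_integrable M u \<longleftrightarrow> (\<forall>K. compact K \<longrightarrow> set_integrable M K u)"

text \<open>
  The class $\mathcal{F}_w$.  The measure \<open>density lebesgue w\<close> is $w\,dx$; a weight may take the value
  \<open>\<infinity>\<close> on a null set.  That \<open>w\<close> is a weight (locally integrable and positive a.e.) is not part of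
  the definition.
\<close>
definition vanishing_mean_class :: "(real ^ 'n \<Rightarrow> ennreal) \<Rightarrow> (real ^ 'n \<Rightarrow> real) set" where
  "vanishing_mean_class w = {u.
     locally_integrable lebesgue u \<and>
     locally_integrable (density lebesgue w) u \<and>
     (\<exists>Q. incseq Q \<and> (\<forall>j. \<exists>l. is_cube l (Q j)) \<and> (\<Union>j::nat. Q j) = UNIV \<and>
        (\<lambda>j. (1 / measure (density lebesgue w) (Q j)) * (LINT x:Q j|density lebesgue w. u x))
          \<longlonglongrightarrow> 0)}"

definition gagliardo_energy :: "real \<Rightarrow> real \<Rightarrow> (real ^ 'n \<Rightarrow> real) \<Rightarrow> ennreal" where
  "gagliardo_energy \<delta> p u =
     (\<integral>\<^sup>+ x. (\<integral>\<^sup>+ y. ennreal (\<bar>u x - u y\<bar> powr p / norm (x - y) powr (real CARD('n) + \<delta> * p))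
        \<partial>lebesgue) \<partial>lebesgue)"

end

theory Submission
  imports Defs
begin

text \<open>
  Put \<open>\<theta> = \<delta> p / n < 1\<close> and let \<open>D\<close> be the Gagliardo energy of \<open>u\<close>.  The weights enter only
  through their distribution: both \<open>(M \<mu>)^\<beta>\<close>, by the Vitali covering lemma
  (\<open>frac_maximal_weak_type\<close>), and \<open>norm x powr (- \<delta> p)\<close> satisfy \<open>|{w > t}| \<le> C (B / t)^(1/\<theta>)\<close>,
  where \<open>B\<close> is \<open>\<mu>(UNIV)^\<beta>\<close> respectively \<open>1\<close>.  Hence \<open>w(F) \<le> 3 C B |F|^(1-\<theta>) / (1-\<theta>)\<close> for every
  set \<open>F\<close> (\<open>weak_type_integral_on_set\<close>), and integrating over the level sets of \<open>u\<close> reduces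
  everything to a bound for \<open>\<Sum>k. \<lambda>_k^p |{|u| > \<lambda>_k}|^(1-\<theta>)\<close> along a geometric sequence of levels:
  a Sobolev inequality in a Lorentz norm.

  The factor \<open>1 - \<delta>\<close>.  Write \<open>D\<close> as the integral over \<open>h\<close> of \<open>E(h) / norm h powr (n + \<delta> p)\<close>, where
  \<open>E(h)\<close> is the integral of \<open>|u(x + h) - u(x)|^p\<close>.  The triangle inequality gives
  \<open>E(2h) \<le> 2^p E(h)\<close>, so the energies in successive dyadic shells of \<open>h\<close> decay at most like
  \<open>2^(-(1-\<delta>)p)\<close> towards \<open>0\<close>, and no single shell carries more than the fraction \<open>(1 - \<delta>) p\<close> of \<open>D\<close>
  (\<open>shell_energy_le\<close>).  For two levels \<open>a < b\<close> one shell is enough to see the jump from \<open>{u > b}\<close>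
  to the complement of \<open>{u > a}\<close>, namely a shell whose volume is comparable to
  \<open>|{u > a}|\<close>; this is \<open>energy_ge_level_sets\<close>.

  The sum over the levels.  Passing to \<open>|u|\<close> does not increase the energy, so let \<open>u \<ge> 0\<close>.  The
  truncations of \<open>u\<close> between consecutive levels have total energy at most \<open>D\<close>, because \<open>p \<ge> 1\<close>.  The resulting bound for
  \<open>\<Sum>k. \<lambda>_k^p |{u > \<lambda>_(k+1)}| |{u > \<lambda>_k}|^(-\<theta>)\<close> is turned into one for
  \<open>\<Sum>k. \<lambda>_k^p |{u > \<lambda>_k}|^(1-\<theta>)\<close> by Young's inequality and absorption (\<open>level_chain\<close>).  The ratio
  of the levels is \<open>1 + \<eta>\<close> with \<open>\<eta> = (1-\<theta>)/p\<close>: this keeps the constant lost in the absorption below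
  \<open>e\<close>, makes the jumps \<open>\<eta> \<lambda>_k\<close> responsible for the factor \<open>(p / (1-\<theta>))^p\<close>, and makes the increments
  of \<open>\<lambda>_k^p\<close> so small that they cancel the denominator in \<open>w(F) \<le> 3 C B |F|^(1-\<theta>) / (1-\<theta>)\<close>.  Since
  \<open>1 - \<theta> = (n - \<delta> p) / n\<close>, the bound for the \<open>p\<close>-th powers is a multiple of
  \<open>(1 - \<delta>) p^(p+1) / (n - \<delta> p)^p\<close> up to factors \<open>c_n^p\<close>; the additional \<open>p\<close> is at most \<open>e^p\<close>, and
  \<open>n - \<delta> p \<le> n\<close> leads to the power \<open>p + 1\<close> of the denominator (\<open>constant_le\<close>).

  The absorption needs level sets of finite measure.  A function of finite energy has them after
  subtraction of a constant \<open>c\<close>, the limit of its means over large balls (\<open>finite_energy_limit\<close>).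
  Then \<open>|u - c|^p\<close> is integrable against \<open>w\<close>, whose total mass is infinite, so all \<open>w\<close>-means of \<open>u\<close>
  over growing cubes tend to \<open>c\<close>; membership in the vanishing mean class forces \<open>c = 0\<close>
  (\<open>vanishing_mean_constant_eq_0\<close>).
\<close>

section \<open>Two inequalities for real powers\<close>

lemma powr_add_le_two_powr:
  fixes a b p :: real
  assumes "0 \<le> a" "0 \<le> b" "1 \<le> p"
  shows "(a + b) powr p \<le> 2 powr (p - 1) * (a powr p + b powr p)"
proof (cases "a = 0 \<or> b = 0")
  case True
  have "1 \<le> 2 powr (p - 1)"
    using assms by (simp add: ge_one_powr_ge_zero)
  then show ?thesis
    using True mult_right_mono[of 1 "2 powr (p - 1)" "a powr p"]
      mult_right_mono[of 1 "2 powr (p - 1)" "b powr p"] by auto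
next
  case False
  then have pos: "0 < a" "0 < b" using assms by auto
  have "((1 - 1/2) *\<^sub>R a + (1/2) *\<^sub>R b) powr p \<le> (1 - 1/2) * a powr p + (1/2) * b powr p"
    using powr_convex[OF assms(3)] pos by (intro convex_onD) auto
  moreover have "(1 - 1/2) *\<^sub>R a + (1/2) *\<^sub>R b = (a + b) / 2" by (simp add: field_simps)
  moreover have "((a + b) / 2) powr p = (a + b) powr p / 2 powr p"
    using pos by (simp add: powr_divide)
  ultimately have "(a + b) powr p / 2 powr p \<le> (a powr p + b powr p) / 2"
    by (simp add: field_simps)
  then show ?thesis
    by (simp add: powr_diff field_simps)
qed

lemma sum_powr_le_powr_sum:
  fixes f :: "'i \<Rightarrow> real"
  assumes "finite A" "1 \<le> p" "\<And>i. i \<in> A \<Longrightarrow> 0 \<le> f i"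
  shows "(\<Sum>i\<in>A. f i powr p) \<le> (\<Sum>i\<in>A. f i) powr p"
  using assms(1,3)
proof (induction A rule: finite_induct)
  case (insert i A)
  have two: "a powr p + b powr p \<le> (a + b) powr p" if "0 \<le> a" "0 \<le> b" for a b :: real
  proof -
    have le: "c powr p \<le> c * (a + b) powr (p - 1)" if "0 \<le> c" "c \<le> a + b" for c
    proof (cases "c = 0")
      case False
      then have "c powr p = c * c powr (p - 1)" using that by (simp add: powr_diff)
      then show ?thesis
        using that assms(2) by (auto intro!: mult_left_mono powr_mono2)
    qed simp
    have "a powr p + b powr p \<le> (a + b) * (a + b) powr (p - 1)"
      using le[of a] le[of b] that by (simp add: distrib_right)
    also have "\<dots> = (a + b) powr p"
      using that by (cases "a + b = 0") (auto simp: powr_diff)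
    finally show ?thesis .
  qed
  have "0 \<le> (\<Sum>i\<in>A. f i)" using insert by (intro sum_nonneg) auto
  moreover have "(\<Sum>i\<in>A. f i powr p) \<le> (\<Sum>i\<in>A. f i) powr p" using insert by auto
  ultimately show ?case
    using two[of "f i" "\<Sum>i\<in>A. f i"] insert by (simp add: insert(1,2))
qed simp

section \<open>Energy by increments and the factor 1 - \<delta>\<close>

lemma nn_integral_lborel_affine:
  fixes f :: "'a::euclidean_space \<Rightarrow> ennreal"
  assumes [measurable]: "f \<in> borel_measurable borel" and "c \<noteq> 0"
  shows "(\<integral>\<^sup>+x. f x \<partial>lborel) = ennreal (\<bar>c\<bar> ^ DIM('a)) * (\<integral>\<^sup>+x. f (t + c *\<^sub>R x) \<partial>lborel)"
  by (subst lborel_affine[OF assms(2), of t])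
     (simp add: nn_integral_density nn_integral_distr nn_integral_cmult)

text \<open>
  The Gagliardo energy over \<open>lborel\<close>, on any Euclidean space; Borel functions make Tonelli's theorem
  applicable.
\<close>
definition energy :: "real \<Rightarrow> real \<Rightarrow> ('a::euclidean_space \<Rightarrow> real) \<Rightarrow> ennreal" where
  "energy \<delta> p v = (\<integral>\<^sup>+x. (\<integral>\<^sup>+y. ennreal (\<bar>v x - v y\<bar> powr p /
      norm (x - y) powr (real DIM('a) + \<delta> * p)) \<partial>lborel) \<partial>lborel)"

definition increment :: "real \<Rightarrow> ('a::euclidean_space \<Rightarrow> real) \<Rightarrow> 'a \<Rightarrow> ennreal" where
  "increment p v h = (\<integral>\<^sup>+x. ennreal (\<bar>v (x + h) - v x\<bar> powr p) \<partial>lborel)"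

lemma increment_measurable [measurable]:
  assumes [measurable]: "v \<in> borel_measurable borel"
  shows "increment p v \<in> borel_measurable borel"
  unfolding increment_def by measurable

lemma energy_eq_increment:
  fixes v :: "'a::euclidean_space \<Rightarrow> real"
  assumes [measurable]: "v \<in> borel_measurable borel"
  shows "energy \<delta> p v =
    (\<integral>\<^sup>+h. increment p v h * ennreal (1 / norm h powr (real DIM('a) + \<delta> * p)) \<partial>lborel)"
proof -
  let ?k = "\<lambda>h::'a. 1 / norm h powr (real DIM('a) + \<delta> * p)"
  have "(\<integral>\<^sup>+y. ennreal (\<bar>v x - v y\<bar> powr p * ?k (x - y)) \<partial>lborel)
      = (\<integral>\<^sup>+h. ennreal (\<bar>v (x + h) - v x\<bar> powr p) * ennreal (?k h) \<partial>lborel)" for x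
    by (subst nn_integral_lborel_affine[of _ 1 x])
       (auto simp: abs_minus_commute simp flip: ennreal_mult' intro!: nn_integral_cong)
  then have "energy \<delta> p v = (\<integral>\<^sup>+x. (\<integral>\<^sup>+h. ennreal (\<bar>v (x + h) - v x\<bar> powr p) * ennreal (?k h) \<partial>lborel) \<partial>lborel)"
    by (simp add: energy_def)
  also have "\<dots> = (\<integral>\<^sup>+h. (\<integral>\<^sup>+x. ennreal (\<bar>v (x + h) - v x\<bar> powr p) * ennreal (?k h) \<partial>lborel) \<partial>lborel)"
    by (rule lborel_pair.Fubini') measurable
  also have "\<dots> = (\<integral>\<^sup>+h. increment p v h * ennreal (?k h) \<partial>lborel)"
    unfolding increment_def by (subst nn_integral_multc) auto
  finally show ?thesis .
qed

text \<open>
  A step of length \<open>2 h\<close> is two steps of length \<open>h\<close>, and both contribute equally by translation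
  invariance.
\<close>
lemma increment_double:
  fixes v :: "'a::euclidean_space \<Rightarrow> real"
  assumes [measurable]: "v \<in> borel_measurable borel" and "1 \<le> p"
  shows "increment p v (2 *\<^sub>R h) \<le> ennreal (2 powr p) * increment p v h"
proof -
  have shift: "(\<integral>\<^sup>+x. ennreal (\<bar>v (x + 2 *\<^sub>R h) - v (x + h)\<bar> powr p) \<partial>lborel) = increment p v h"
    unfolding increment_def
    by (subst (2) nn_integral_lborel_affine[of _ 1 h]) (auto simp: algebra_simps scaleR_2)
  have "increment p v (2 *\<^sub>R h) \<le> (\<integral>\<^sup>+x. ennreal (2 powr (p - 1)) *
      (ennreal (\<bar>v (x + 2 *\<^sub>R h) - v (x + h)\<bar> powr p) + ennreal (\<bar>v (x + h) - v x\<bar> powr p)) \<partial>lborel)"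
    unfolding increment_def
  proof (intro nn_integral_mono)
    fix x
    have "\<bar>v (x + 2 *\<^sub>R h) - v x\<bar> powr p \<le> (\<bar>v (x + 2 *\<^sub>R h) - v (x + h)\<bar> + \<bar>v (x + h) - v x\<bar>) powr p"
      using assms by (intro powr_mono2) auto
    also have "\<dots> \<le> 2 powr (p - 1) * (\<bar>v (x + 2 *\<^sub>R h) - v (x + h)\<bar> powr p + \<bar>v (x + h) - v x\<bar> powr p)"
      using assms by (intro powr_add_le_two_powr) auto
    finally show "ennreal (\<bar>v (x + 2 *\<^sub>R h) - v x\<bar> powr p) \<le> ennreal (2 powr (p - 1)) *
      (ennreal (\<bar>v (x + 2 *\<^sub>R h) - v (x + h)\<bar> powr p) + ennreal (\<bar>v (x + h) - v x\<bar> powr p))"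
      by (simp flip: ennreal_plus ennreal_mult')
  qed
  also have "\<dots> = ennreal (2 powr (p - 1)) * (increment p v h + increment p v h)"
    by (subst nn_integral_cmult, simp, subst nn_integral_add) (simp_all add: shift increment_def[symmetric])
  also have "\<dots> = ennreal (2 powr p) * increment p v h"
    by (simp add: powr_diff ennreal_mult'[symmetric] flip: mult_2 mult.assoc ennreal_numeral)
  finally show ?thesis .
qed

definition shell_energy :: "real \<Rightarrow> real \<Rightarrow> ('a::euclidean_space \<Rightarrow> real) \<Rightarrow> real \<Rightarrow> ennreal" where
  "shell_energy \<delta> p v R = (\<integral>\<^sup>+h. increment p v h * ennreal (1 / norm h powr (real DIM('a) + \<delta> * p))
      * indicator {h. R / 2 \<le> norm h \<and> norm h < R} h \<partial>lborel)"

text \<open>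
  Rescaling \<open>h\<close> by \<open>1/2\<close> maps one shell to the next smaller one; the kernel and the volume element
  together gain \<open>2 powr (\<delta> p)\<close>, while the increment loses at most \<open>2 powr p\<close> by doubling.
\<close>
lemma shell_energy_half:
  fixes v :: "'a::euclidean_space \<Rightarrow> real"
  assumes [measurable]: "v \<in> borel_measurable borel" and "1 \<le> p"
  shows "ennreal (2 powr (- (1 - \<delta>) * p)) * shell_energy \<delta> p v R \<le> shell_energy \<delta> p v (R / 2)"
proof -
  let ?s = "real DIM('a) + \<delta> * p"
  let ?k = "\<lambda>h::'a. ennreal (1 / norm h powr ?s)"
  have "shell_energy \<delta> p v (R / 2) = ennreal ((1/2) ^ DIM('a)) *
     (\<integral>\<^sup>+h. increment p v ((1/2) *\<^sub>R h) * ?k ((1/2) *\<^sub>R h) * indicator {h. R / 2 \<le> norm h \<and> norm h < R} h \<partial>lborel)"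
    unfolding shell_energy_def
    by (subst nn_integral_lborel_affine[of _ "1/2" 0]) (auto simp: indicator_def mult.commute)
  moreover have "shell_energy \<delta> p v R \<le> (\<integral>\<^sup>+h. ennreal (2 powr (p - ?s)) * (increment p v ((1/2) *\<^sub>R h) * ?k ((1/2) *\<^sub>R h)
      * indicator {h. R / 2 \<le> norm h \<and> norm h < R} h) \<partial>lborel)"
    unfolding shell_energy_def
  proof (intro nn_integral_mono)
    fix h :: 'a
    have "?k h = ennreal (2 powr (- ?s)) * ?k ((1/2) *\<^sub>R h)"
      by (simp add: powr_divide powr_minus flip: ennreal_mult') (simp add: field_simps flip: powr_add)
    moreover have "increment p v h \<le> ennreal (2 powr p) * increment p v ((1/2) *\<^sub>R h)"
      using increment_double[OF assms, of "(1/2) *\<^sub>R h"] by simp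
    ultimately have "increment p v h * ?k h \<le> (ennreal (2 powr p) * increment p v ((1/2) *\<^sub>R h)) *
        (ennreal (2 powr (- ?s)) * ?k ((1/2) *\<^sub>R h))"
      by (simp add: mult_right_mono)
    also have "\<dots> = (ennreal (2 powr p) * ennreal (2 powr (- ?s))) * (increment p v ((1/2) *\<^sub>R h) * ?k ((1/2) *\<^sub>R h))"
      by (simp only: ac_simps)
    also have "ennreal (2 powr p) * ennreal (2 powr (- ?s)) = ennreal (2 powr (p - ?s))"
      by (subst ennreal_mult'[symmetric]) (auto simp: algebra_simps simp flip: powr_add)
    finally show "increment p v h * ?k h * indicator {h. R / 2 \<le> norm h \<and> norm h < R} h \<le>
      ennreal (2 powr (p - ?s)) * (increment p v ((1/2) *\<^sub>R h) * ?k ((1/2) *\<^sub>R h) * indicator {h. R / 2 \<le> norm h \<and> norm h < R} h)"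
      by (auto simp: indicator_def)
  qed
  moreover have "(1/2) ^ DIM('a) = 2 powr (- (1 - \<delta>) * p) * 2 powr (p - ?s)"
    by (simp flip: powr_add add: algebra_simps powr_minus powr_realpow power_divide field_simps)
  ultimately show ?thesis
    by (simp add: nn_integral_cmult ennreal_mult' mult.assoc mult_left_mono)
qed

text \<open>
  The disjoint shells of outer radii \<open>R / 2^k\<close> carry at least \<open>q^k\<close> times the energy of the first,
  where \<open>q = 2 powr (- (1 - \<delta>) p)\<close>.  Summing the geometric series leaves \<open>1 - q\<close>, which is at
  most \<open>(1 - \<delta>) p\<close>.  This is the only source of the factor \<open>1 - \<delta>\<close>.
\<close>
lemma shell_energy_le:
  fixes v :: "'a::euclidean_space \<Rightarrow> real"
  assumes [measurable]: "v \<in> borel_measurable borel" and p: "1 \<le> p" and \<delta>: "\<delta> < 1" and R: "0 < R"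
  shows "shell_energy \<delta> p v R \<le> ennreal ((1 - \<delta>) * p) * energy \<delta> p v"
proof -
  define q :: real where "q = 2 powr (- (1 - \<delta>) * p)"
  have q: "0 < q" "q < 1"
    using p \<delta> powr_less_mono[of "- (1 - \<delta>) * p" 0 "2::real"] by (auto simp: q_def mult_neg_pos)
  let ?S = "\<lambda>k::nat. {h::'a. R / 2 ^ k / 2 \<le> norm h \<and> norm h < R / 2 ^ k}"
  let ?f = "\<lambda>h::'a. increment p v h * ennreal (1 / norm h powr (real DIM('a) + \<delta> * p))"
  have iter: "ennreal (q ^ k) * shell_energy \<delta> p v R \<le> shell_energy \<delta> p v (R / 2 ^ k)" for k
  proof (induction k)
    case (Suc k)
    have "ennreal (q ^ Suc k) * shell_energy \<delta> p v R = ennreal q * (ennreal (q ^ k) * shell_energy \<delta> p v R)"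
      using q by (simp add: ennreal_mult' mult.assoc)
    also have "\<dots> \<le> ennreal q * shell_energy \<delta> p v (R / 2 ^ k)"
      by (intro mult_left_mono Suc) auto
    also have "\<dots> \<le> shell_energy \<delta> p v (R / 2 ^ k / 2)"
      unfolding q_def by (rule shell_energy_half) fact+
    finally show ?case by (simp add: mult.commute)
  qed simp
  have disj: "?S i \<inter> ?S j = {}" if "i < j" for i j
  proof -
    have "2 ^ Suc i \<le> (2::real) ^ j" using that by (intro power_increasing) auto
    then have "R / 2 ^ j \<le> R / 2 ^ i / 2" using R by (simp add: field_simps)
    then show ?thesis by fastforce
  qed
  then have dis: "disjoint_family ?S"
    unfolding disjoint_family_on_def by (metis (no_types, lifting) Int_commute nat_neq_iff)
  have "(\<Sum>k. ennreal (q ^ k)) * shell_energy \<delta> p v R = (\<Sum>k. ennreal (q ^ k) * shell_energy \<delta> p v R)"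
    by simp
  also have "\<dots> \<le> (\<Sum>k. shell_energy \<delta> p v (R / 2 ^ k))"
    by (intro suminf_le iter) auto
  also have "\<dots> = (\<integral>\<^sup>+h. (\<Sum>k. ?f h * indicator (?S k) h) \<partial>lborel)"
    unfolding shell_energy_def by (subst nn_integral_suminf) auto
  also have "\<dots> = (\<integral>\<^sup>+h. ?f h * indicator (\<Union>k. ?S k) h \<partial>lborel)"
    using dis by (intro nn_integral_cong) (simp add: suminf_indicator)
  also have "\<dots> \<le> (\<integral>\<^sup>+h. ?f h \<partial>lborel)"
    by (intro nn_integral_mono) (auto simp: indicator_def)
  also have "\<dots> = energy \<delta> p v" by (simp add: energy_eq_increment)
  finally have sum: "(\<Sum>k. ennreal (q ^ k)) * shell_energy \<delta> p v R \<le> energy \<delta> p v" .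
  have "(\<Sum>k. ennreal (q ^ k)) = ennreal (1 / (1 - q))"
    using q by (intro suminf_ennreal_eq geometric_sums) auto
  then have "shell_energy \<delta> p v R = ennreal (1 - q) * ((\<Sum>k. ennreal (q ^ k)) * shell_energy \<delta> p v R)"
    using q by (simp flip: mult.assoc ennreal_mult')
  also have "\<dots> \<le> ennreal (1 - q) * energy \<delta> p v" by (intro mult_left_mono sum) auto
  also have "\<dots> \<le> ennreal ((1 - \<delta>) * p) * energy \<delta> p v"
  proof (intro mult_right_mono ennreal_leI)
    have ln2: "ln (2::real) \<le> 1" using ln_le_minus_one[of "2::real"] by simp
    have "1 + (- (1 - \<delta>) * p) * ln 2 \<le> exp ((- (1 - \<delta>) * p) * ln 2)" by (rule exp_ge_add_one_self)
    also have "\<dots> = q" by (simp add: q_def powr_def)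
    finally have "1 - q \<le> ((1 - \<delta>) * p) * ln 2" by (simp add: algebra_simps)
    also have "\<dots> \<le> ((1 - \<delta>) * p) * 1" using p \<delta> ln2 by (intro mult_left_mono) auto
    finally show "1 - q \<le> (1 - \<delta>) * p" by simp
  qed auto
  finally show ?thesis .
qed

section \<open>Energy and level sets\<close>

lemma emeasure_lborel_translate:
  fixes A :: "'a::euclidean_space set"
  assumes [measurable]: "A \<in> sets borel"
  shows "emeasure lborel {h. x + h \<in> A} = emeasure lborel A"
proof -
  have "emeasure lborel A = (\<integral>\<^sup>+y. indicator A y \<partial>lborel)" by simp
  also have "\<dots> = (\<integral>\<^sup>+h. indicator A (x + 1 *\<^sub>R h) \<partial>lborel)"
    by (subst nn_integral_lborel_affine[of _ 1 x]) auto
  also have "\<dots> = (\<integral>\<^sup>+h. indicator {h. x + h \<in> A} h \<partial>lborel)"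
    by (intro nn_integral_cong) (auto simp: indicator_def)
  also have "\<dots> = emeasure lborel {h. x + h \<in> A}" by (rule nn_integral_indicator) measurable
  finally show ?thesis by simp
qed

lemma emeasure_shell_ge:
  fixes R :: real
  assumes "0 < R"
  shows "ennreal (unit_ball_vol DIM('a) * R ^ DIM('a) / 2) \<le>
    emeasure lborel {h::'a::euclidean_space. R / 2 \<le> norm h \<and> norm h < R}"
proof -
  let ?V = "unit_ball_vol DIM('a)"
  have V: "0 \<le> ?V" by simp
  have eq: "{h::'a. R / 2 \<le> norm h \<and> norm h < R} = ball 0 R - ball 0 (R / 2)"
    by (auto simp: dist_norm)
  have "(R / 2) ^ DIM('a) \<le> R ^ DIM('a) / 2"
  proof -
    have "(2::real) ^ 1 \<le> 2 ^ DIM('a)" by (intro power_increasing) (auto simp: Suc_le_eq)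
    then show ?thesis using assms by (simp add: power_divide field_simps)
  qed
  then have "?V * (R / 2) ^ DIM('a) \<le> ?V * (R ^ DIM('a) / 2)"
    using V by (rule mult_left_mono)
  then show ?thesis
    unfolding eq using assms V
    by (subst emeasure_Diff) (auto simp: emeasure_ball ennreal_minus intro!: ennreal_leI)
qed

definition clamp_between :: "real \<Rightarrow> real \<Rightarrow> real \<Rightarrow> real" where
  "clamp_between a b t = min (max t a) b"

lemma clamp_between_measurable [measurable]: "clamp_between a b \<in> borel_measurable borel"
  unfolding clamp_between_def[abs_def] by measurable

text \<open>
  A point of \<open>{v > b}\<close> sees, in a shell of volume at least \<open>2 g\<close>, a set of measure at least \<open>g\<close> outside
  \<open>{v > a}\<close>, because \<open>{v > a}\<close> has measure \<open>g\<close> only.  Across each of these pairs the truncation jumps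
  by \<open>b - a\<close>.  A single shell being used, \<open>shell_energy_le\<close> provides the factor \<open>1 - \<delta>\<close>.
\<close>
lemma energy_ge_level_sets:
  fixes v :: "'a::euclidean_space \<Rightarrow> real"
  defines "V \<equiv> unit_ball_vol (real DIM('a))"
  assumes [measurable]: "v \<in> borel_measurable borel" and p: "1 \<le> p" and \<delta>: "0 < \<delta>" "\<delta> < 1"
    and ab: "a < b" and \<theta>: "\<theta> = \<delta> * p / real DIM('a)"
    and g: "emeasure lborel {x. a < v x} = ennreal g" "0 < g"
  shows "ennreal ((b - a) powr p * g powr (- \<theta>)) * emeasure lborel {x. b < v x}
    \<le> ennreal ((4 / V) powr (1 + \<theta>) * ((1 - \<delta>) * p)) * energy \<delta> p (\<lambda>x. clamp_between a b (v x))"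
proof -
  let ?n = "real DIM('a)"
  let ?F = "{x. b < v x}" and ?G = "{x. a < v x}"
  let ?c = "\<lambda>x. clamp_between a b (v x)"
  have V: "0 < V" unfolding V_def by simp
  have n: "0 < ?n" by simp
  \<comment> \<open>The radius is chosen so that at least half of the shell around any point avoids \<open>?G\<close>.\<close>
  define R where "R = (4 * g / V) powr (1 / ?n)"
  have R: "0 < R" using g V by (simp add: R_def)
  have Rn: "R ^ DIM('a) = 4 * g / V"
    using g V n by (simp add: R_def powr_powr flip: powr_realpow)
  let ?S = "{h::'a. R / 2 \<le> norm h \<and> norm h < R}"
  have S: "ennreal (2 * g) \<le> emeasure lborel ?S"
    using emeasure_shell_ge[OF R, where ?'a = 'a] V by (simp add: Rn flip: V_def)
  let ?s = "?n + \<delta> * p"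
  have s: "0 < ?s" using n p \<delta> by (simp add: add_pos_pos)
  have Rs: "1 / R powr ?s = (4 * g / V) powr (- (1 + \<theta>))"
  proof -
    have "1 / R powr ?s = R powr (- ?s)" by (rule powr_minus_divide[symmetric])
    also have "\<dots> = (4 * g / V) powr (1 / ?n * (- ?s))" by (simp only: R_def powr_powr)
    also have "1 / ?n * (- ?s) = - (1 + \<theta>)" using n by (simp add: \<theta> field_simps)
    finally show ?thesis .
  qed
  define K where "K = ennreal ((b - a) powr p * (1 / R powr ?s))"
  have avoid: "ennreal g \<le> emeasure lborel {h \<in> ?S. x + h \<notin> ?G}" for x
  proof -
    have "ennreal (2 * g) \<le> emeasure lborel ({h \<in> ?S. x + h \<notin> ?G} \<union> {h. x + h \<in> ?G})"
      using S by (rule order_trans) (intro emeasure_mono, auto)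
    also have "\<dots> \<le> emeasure lborel {h \<in> ?S. x + h \<notin> ?G} + emeasure lborel {h. x + h \<in> ?G}"
      by (intro emeasure_subadditive) measurable
    also have "emeasure lborel {h. x + h \<in> ?G} = ennreal g"
      by (subst emeasure_lborel_translate) (use g in auto)
    finally have "ennreal g + ennreal g \<le> ennreal g + emeasure lborel {h \<in> ?S. x + h \<notin> ?G}"
      using g by (simp add: add.commute flip: ennreal_plus)
    then show ?thesis by (simp only: ennreal_add_left_cancel_le) simp
  qed
  have Fm: "?F \<in> sets lborel" and Am: "{h \<in> ?S. x + h \<notin> ?G} \<in> sets lborel" for x by measurable
  have "K * (ennreal g * emeasure lborel ?F) = (\<integral>\<^sup>+x. K * ennreal g * indicator ?F x \<partial>lborel)"
    using nn_integral_cmult_indicator[OF Fm, of "K * ennreal g"] by (simp only: mult.assoc)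
  also have "\<dots> \<le> (\<integral>\<^sup>+x. (\<integral>\<^sup>+h. K * indicator ?F x * indicator {h \<in> ?S. x + h \<notin> ?G} h \<partial>lborel) \<partial>lborel)"
  proof (intro nn_integral_mono)
    fix x :: 'a
    have "K * ennreal g * indicator ?F x = K * indicator ?F x * ennreal g"
      by (simp only: ac_simps)
    also have "\<dots> \<le> K * indicator ?F x * emeasure lborel {h \<in> ?S. x + h \<notin> ?G}"
      by (intro mult_left_mono avoid) simp
    also have "\<dots> = (\<integral>\<^sup>+h. K * indicator ?F x * indicator {h \<in> ?S. x + h \<notin> ?G} h \<partial>lborel)"
      by (rule nn_integral_cmult_indicator[OF Am, symmetric])
    finally show "K * ennreal g * indicator ?F x \<le>
      (\<integral>\<^sup>+h. K * indicator ?F x * indicator {h \<in> ?S. x + h \<notin> ?G} h \<partial>lborel)" .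
  qed
  also have "\<dots> \<le> (\<integral>\<^sup>+x. (\<integral>\<^sup>+h. ennreal (\<bar>?c (x + h) - ?c x\<bar> powr p) *
      ennreal (1 / norm h powr ?s) * indicator ?S h \<partial>lborel) \<partial>lborel)"
  proof (intro nn_integral_mono)
    fix x h :: 'a
    show "K * indicator ?F x * indicator {h \<in> ?S. x + h \<notin> ?G} h \<le>
      ennreal (\<bar>?c (x + h) - ?c x\<bar> powr p) * ennreal (1 / norm h powr ?s) * indicator ?S h"
    proof (cases "h \<in> ?S \<and> x + h \<notin> ?G \<and> x \<in> ?F")
      case True
      then have "?c (x + h) = a" "?c x = b" using ab by (auto simp: clamp_between_def)
      moreover have "0 < norm h" using True R by auto
      then have "norm h powr ?s \<le> R powr ?s" using True s by (intro powr_mono2) auto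
      then have "1 / R powr ?s \<le> 1 / norm h powr ?s"
        using \<open>0 < norm h\<close> R by (intro divide_left_mono mult_pos_pos) auto
      then have "(b - a) powr p * (1 / R powr ?s) \<le> (b - a) powr p * (1 / norm h powr ?s)"
        by (rule mult_left_mono) simp
      ultimately show ?thesis
        using True ab by (auto simp: K_def simp flip: ennreal_mult' intro!: ennreal_leI)
    qed (auto simp: indicator_def)
  qed
  also have "\<dots> = (\<integral>\<^sup>+h. (\<integral>\<^sup>+x. ennreal (\<bar>?c (x + h) - ?c x\<bar> powr p) *
      ennreal (1 / norm h powr ?s) * indicator ?S h \<partial>lborel) \<partial>lborel)"
    by (rule lborel_pair.Fubini') measurable
  also have "\<dots> = shell_energy \<delta> p ?c R"
    unfolding shell_energy_def increment_def by (simp add: nn_integral_multc)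
  also have "\<dots> \<le> ennreal ((1 - \<delta>) * p) * energy \<delta> p ?c"
    using p \<delta> R by (intro shell_energy_le) auto
  finally have main: "K * (ennreal g * emeasure lborel ?F) \<le> ennreal ((1 - \<delta>) * p) * energy \<delta> p ?c" .
  have "(b - a) powr p * g powr (- \<theta>) =
     (4 / V) powr (1 + \<theta>) * (((b - a) powr p * (4 * g / V) powr (- (1 + \<theta>))) * g)"
  proof -
    have "(4 * g / V) powr (- (1 + \<theta>)) = (4 / V) powr (- (1 + \<theta>)) * g powr (- (1 + \<theta>))"
      using g V by (simp flip: powr_mult)
    moreover have "g powr (- (1 + \<theta>)) * g = g powr (- \<theta>)"
      using g powr_add[of g "- (1 + \<theta>)" 1] by simp
    moreover have "(4 / V) powr (1 + \<theta>) * (4 / V) powr (- (1 + \<theta>)) = 1"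
      using V by (simp flip: powr_add)
    ultimately show ?thesis by (simp add: algebra_simps)
  qed
  then have "ennreal ((b - a) powr p * g powr (- \<theta>)) = ennreal ((4 / V) powr (1 + \<theta>)) * (K * ennreal g)"
    unfolding K_def Rs using g by (simp only: ennreal_mult' powr_ge_zero mult_nonneg_nonneg less_imp_le)
  then have "ennreal ((b - a) powr p * g powr (- \<theta>)) * emeasure lborel ?F =
      ennreal ((4 / V) powr (1 + \<theta>)) * (K * (ennreal g * emeasure lborel ?F))"
    by (simp only: mult.assoc)
  also have "\<dots> \<le> ennreal ((4 / V) powr (1 + \<theta>)) * (ennreal ((1 - \<delta>) * p) * energy \<delta> p ?c)"
    by (intro mult_left_mono main) auto
  also have "\<dots> = ennreal ((4 / V) powr (1 + \<theta>) * ((1 - \<delta>) * p)) * energy \<delta> p ?c"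
    using p \<delta> by (simp add: ennreal_mult' mult.assoc)
  finally show ?thesis .
qed

lemma energy_mono:
  assumes "\<And>x y. \<bar>v x - v y\<bar> \<le> \<bar>u x - u y\<bar>" "1 \<le> p"
  shows "energy \<delta> p v \<le> energy \<delta> p u"
  unfolding energy_def
  by (intro nn_integral_mono ennreal_leI divide_right_mono powr_mono2) (use assms in auto)

text \<open>
  The truncations are monotone in \<open>v\<close> and their increments add up to at most the increment of \<open>v\<close>;
  for \<open>p \<ge> 1\<close> the \<open>p\<close>-th powers then add up as well.
\<close>
lemma sum_energy_clamp_le:
  fixes v :: "'a::euclidean_space \<Rightarrow> real" and l :: "nat \<Rightarrow> real"
  assumes [measurable]: "v \<in> borel_measurable borel" and p: "1 \<le> p" and l: "mono l"
  shows "(\<Sum>k<N. energy \<delta> p (\<lambda>x. clamp_between (l k) (l (Suc k)) (v x))) \<le> energy \<delta> p v"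
proof -
  let ?c = "\<lambda>k. clamp_between (l k) (l (Suc k))"
  have lS: "l k \<le> l (Suc k)" "l 0 \<le> l k" for k using l by (auto intro: monoD)
  have tele: "(\<Sum>k<N. ?c k t - l k) = clamp_between (l 0) (l N) t - l 0" for t
  proof (induction N)
    case (Suc N)
    then show ?case using lS[of N] by (auto simp: clamp_between_def min_def max_def)
  qed (simp add: clamp_between_def)
  have pw: "(\<Sum>k<N. \<bar>?c k s - ?c k t\<bar> powr p) \<le> \<bar>s - t\<bar> powr p" if "t \<le> s" for s t
  proof -
    have m: "?c k t \<le> ?c k s" for k using that by (auto simp: clamp_between_def)
    have "(\<Sum>k<N. \<bar>?c k s - ?c k t\<bar> powr p) \<le> (\<Sum>k<N. \<bar>?c k s - ?c k t\<bar>) powr p"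
      using p by (intro sum_powr_le_powr_sum) auto
    also have "(\<Sum>k<N. \<bar>?c k s - ?c k t\<bar>) = (\<Sum>k<N. ?c k s - l k) - (\<Sum>k<N. ?c k t - l k)"
      using m by (simp add: sum_subtractf[symmetric])
    also have "\<dots> = clamp_between (l 0) (l N) s - clamp_between (l 0) (l N) t"
      by (simp add: tele)
    also have "\<dots> powr p \<le> \<bar>s - t\<bar> powr p"
      using p that lS(2)[of N] by (intro powr_mono2) (auto simp: clamp_between_def)
    finally show ?thesis .
  qed
  have pw: "(\<Sum>k<N. \<bar>?c k s - ?c k t\<bar> powr p) \<le> \<bar>s - t\<bar> powr p" for s t
    using pw[of s t] pw[of t s] by (cases "t \<le> s") (auto simp: abs_minus_commute)
  have "(\<Sum>k<N. energy \<delta> p (\<lambda>x. ?c k (v x))) = (\<integral>\<^sup>+x. (\<integral>\<^sup>+y. (\<Sum>k<N. ennreal (\<bar>?c k (v x) - ?c k (v y)\<bar> powr p /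
      norm (x - y) powr (real DIM('a) + \<delta> * p))) \<partial>lborel) \<partial>lborel)"
    unfolding energy_def by (subst nn_integral_sum, simp)+ simp
  also have "\<dots> \<le> energy \<delta> p v"
    unfolding energy_def
  proof (intro nn_integral_mono)
    fix x y
    show "(\<Sum>k<N. ennreal (\<bar>?c k (v x) - ?c k (v y)\<bar> powr p / norm (x - y) powr (real DIM('a) + \<delta> * p)))
       \<le> ennreal (\<bar>v x - v y\<bar> powr p / norm (x - y) powr (real DIM('a) + \<delta> * p))"
      using pw[of "v x" "v y"]
      by (simp add: sum_ennreal sum_divide_distrib[symmetric] divide_right_mono)
  qed
  finally show ?thesis .
qed

text \<open>
  Here \<open>a k\<close> is the measure of the \<open>k\<close>-th level set.  Since \<open>a (Suc k) powr (1 - \<theta>)\<close> is the geometric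
  mean, with weights \<open>1 - \<theta>\<close> and \<open>\<theta>\<close>, of \<open>a (Suc k) * a k powr (- \<theta>)\<close> and \<open>a k powr (1 - \<theta>)\<close>, Young's
  inequality bounds the wanted sum by the available one plus \<open>\<theta>\<close> times its own shift, which is
  absorbed up to a boundary term.  The sums are finite, so the absorption is legitimate.
\<close>
lemma level_chain:
  fixes a :: "nat \<Rightarrow> real"
  assumes a: "\<And>k. 0 \<le> a (Suc k)" "\<And>k. a (Suc k) \<le> a k" and \<theta>: "0 < \<theta>" "\<theta> < 1" and T: "0 < T"
  shows "(\<Sum>k<N. T ^ k * a (Suc k) powr (1 - \<theta>)) \<le>
     T powr (\<theta> / (1 - \<theta>)) * (\<Sum>k<N. T ^ k * (a (Suc k) * a k powr (- \<theta>)))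
      + \<theta> / (1 - \<theta>) / T * a 0 powr (1 - \<theta>)"
proof -
  let ?L = "T powr (\<theta> / (1 - \<theta>))" and ?b = "\<lambda>k. a (Suc k) * a k powr (- \<theta>)"
  let ?S = "\<lambda>N. \<Sum>k<N. T ^ k * a (Suc k) powr (1 - \<theta>)"
  \<comment> \<open>The factor \<open>?L\<close> is chosen such that the second term receives \<open>1 / T\<close>, which undoes the shift of \<open>T ^ k\<close>.\<close>
  have step: "a (Suc k) powr (1 - \<theta>) \<le> (1 - \<theta>) * (?L * ?b k) + \<theta> * (a k powr (1 - \<theta>) / T)" for k
  proof (cases "a (Suc k) = 0")
    case True
    then show ?thesis using \<theta> T by auto
  next
    case False
    then have pos: "0 < a (Suc k)" "0 < a k" using a(1,2)[of k] by linarith+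
    have "(?L * ?b k) powr (1 - \<theta>) * (a k powr (1 - \<theta>) / T) powr \<theta>
       \<le> (1 - \<theta>) * (?L * ?b k) + \<theta> * (a k powr (1 - \<theta>) / T)"
      using pos \<theta> T by (intro Youngs_inequality_0) auto
    moreover have "(?L * ?b k) powr (1 - \<theta>) * (a k powr (1 - \<theta>) / T) powr \<theta> = a (Suc k) powr (1 - \<theta>)"
    proof -
      have "?L powr (1 - \<theta>) = T powr \<theta>" using \<theta> by (simp add: powr_powr)
      moreover have "(a k powr (- \<theta>)) powr (1 - \<theta>) * (a k powr (1 - \<theta>)) powr \<theta> = 1"
        using pos by (simp add: powr_powr algebra_simps flip: powr_add)
      ultimately show ?thesis
        using pos T by (simp add: powr_mult powr_divide)
    qed
    ultimately show ?thesis by simp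
  qed
  have "?S N \<le> (\<Sum>k<N. T ^ k * ((1 - \<theta>) * (?L * ?b k) + \<theta> * (a k powr (1 - \<theta>) / T)))"
    using step T by (intro sum_mono mult_left_mono) auto
  also have "\<dots> = (1 - \<theta>) * (?L * (\<Sum>k<N. T ^ k * ?b k)) + \<theta> / T * (\<Sum>k<N. T ^ k * a k powr (1 - \<theta>))"
    unfolding sum_distrib_left sum.distrib[symmetric] by (intro sum.cong) (auto simp: algebra_simps)
  finally have S: "?S N \<le> (1 - \<theta>) * (?L * (\<Sum>k<N. T ^ k * ?b k)) + \<theta> / T * (\<Sum>k<N. T ^ k * a k powr (1 - \<theta>))" .
  have "(\<Sum>k<N. T ^ k * a k powr (1 - \<theta>)) \<le> (\<Sum>k<Suc N. T ^ k * a k powr (1 - \<theta>))"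
    using T by (intro sum_mono2) auto
  also have "\<dots> = a 0 powr (1 - \<theta>) + T * ?S N"
    by (subst sum.lessThan_Suc_shift) (simp add: sum_distrib_left mult.assoc)
  finally have "\<theta> / T * (\<Sum>k<N. T ^ k * a k powr (1 - \<theta>)) \<le> \<theta> / T * (a 0 powr (1 - \<theta>) + T * ?S N)"
    using \<theta> T by (intro mult_left_mono) auto
  also have "\<dots> = \<theta> / T * a 0 powr (1 - \<theta>) + \<theta> * ?S N"
    using T by (simp add: distrib_left)
  finally have "(1 - \<theta>) * ?S N \<le> (1 - \<theta>) * (?L * (\<Sum>k<N. T ^ k * ?b k)) + \<theta> / T * a 0 powr (1 - \<theta>)"
    using S by (simp add: left_diff_distrib)
  also have "\<dots> = (1 - \<theta>) * (?L * (\<Sum>k<N. T ^ k * ?b k) + \<theta> / (1 - \<theta>) / T * a 0 powr (1 - \<theta>))"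
    using \<theta> by (simp add: distrib_left)
  finally show ?thesis using \<theta> by simp
qed

section \<open>Weights of weak type\<close>

text \<open>
  The layer cake formula along a sequence of levels.  It also covers \<open>y = \<infinity>\<close>, where the series
  diverges.
\<close>
lemma ennreal_le_suminf_levels:
  fixes L :: "nat \<Rightarrow> real" and y :: ennreal
  assumes L: "mono L" "0 \<le> L 0" and lim: "filterlim L at_top sequentially"
  shows "y \<le> ennreal (L 0) + (\<Sum>k. if ennreal (L k) < y then ennreal (L (Suc k) - L k) else 0)"
proof (rule ccontr)
  let ?t = "\<lambda>k. if ennreal (L k) < y then ennreal (L (Suc k) - L k) else 0"
  have L0: "0 \<le> L k" "L k \<le> L (Suc k)" for k
    using L monoD[OF L(1), of 0 k] monoD[OF L(1), of k "Suc k"] by auto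
  have part: "min y (ennreal (L N)) \<le> ennreal (L 0) + (\<Sum>k<N. ?t k)" for N
  proof (induction N)
    case (Suc N)
    show ?case
    proof (cases "ennreal (L N) < y")
      case True
      have "min y (ennreal (L (Suc N))) \<le> ennreal (L N) + ennreal (L (Suc N) - L N)"
        using L0[of N] by (simp flip: ennreal_plus)
      also have "ennreal (L N) \<le> ennreal (L 0) + (\<Sum>k<N. ?t k)"
        using Suc unfolding min_absorb2[OF less_imp_le[OF True]] .
      finally show ?thesis using True by (simp add: add.assoc add_right_mono)
    next
      case False
      then have "y \<le> ennreal (L N)" by simp
      then have "y \<le> ennreal (L (Suc N))" "min y (ennreal (L N)) = y"
        using ennreal_leI[OF L0(2)[of N]] by (auto simp: min_absorb1)
      then show ?thesis using Suc False by (simp add: min_absorb1)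
    qed
  qed simp
  assume "\<not> y \<le> ennreal (L 0) + suminf ?t"
  then have less: "ennreal (L 0) + suminf ?t < y" by simp
  then obtain r where r: "ennreal (L 0) + suminf ?t = ennreal r" "0 \<le> r"
    by (cases "ennreal (L 0) + suminf ?t") auto
  obtain N where N: "r < L N"
    using lim[unfolded filterlim_at_top_dense] by (auto simp: eventually_sequentially)
  have "min y (ennreal (L N)) \<le> ennreal (L 0) + suminf ?t"
    by (rule order_trans[OF part add_left_mono[OF sum_le_suminf]]) auto
  then show False
    using less N r by (auto simp: min_def ennreal_less_iff not_le[symmetric] split: if_splits)
qed

lemma filterlim_geometric_at_top:
  fixes c x :: real
  assumes "0 < c" "1 < x"
  shows "filterlim (\<lambda>k. c * x ^ k) at_top sequentially"
proof -
  have "filterlim (\<lambda>k. x ^ k) at_top sequentially"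
    using assms by (intro filterlim_at_infinity_imp_filterlim_at_top filterlim_realpow_sequentially_gt1) auto
  then show ?thesis
    by (rule filterlim_tendsto_pos_mult_at_top[OF tendsto_const assms(1)])
qed

text \<open>
  Concavity of \<open>1 - 2 powr (- y)\<close> on \<open>[0, 1]\<close>, in the form of weighted arithmetic and geometric means.
\<close>
lemma one_minus_half_powr_ge:
  fixes x y :: real
  assumes "0 < y" "y \<le> 1" "y \<le> x"
  shows "y / 2 \<le> 1 - 2 powr (- x)"
proof -
  have "(1 / 2) powr y \<le> (1 - y) * 1 + y * (1 / 2 :: real)"
    using assms Youngs_inequality_0[of "1 - y" y 1 "1 / 2"] by simp
  moreover have "2 powr (- x) \<le> 2 powr (- y)" using assms by (intro powr_mono) auto
  moreover have "(1 / 2) powr y = 2 powr (- y :: real)" by (simp add: powr_divide powr_minus_divide)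
  ultimately have "2 powr (- x) \<le> (1 - y) * 1 + y * (1 / 2)" by (metis order_trans)
  then show ?thesis by simp
qed

text \<open>
  Below the height \<open>t\<close> the weight contributes at most \<open>t a\<close>; above it, the weak type bound makes the
  dyadic layers decay like \<open>2 powr (- k (1/\<theta> - 1))\<close>, with a sum of the order of \<open>1 / (1 - \<theta>)\<close>.
\<close>
lemma weak_type_integral_on_set:
  fixes w :: "'a \<Rightarrow> ennreal"
  assumes [measurable]: "w \<in> borel_measurable M" and \<theta>: "0 < \<theta>" "\<theta> < 1" and C: "1 \<le> C" and B: "0 < B"
    and weak: "\<And>t. 0 < t \<Longrightarrow> emeasure M {x \<in> space M. ennreal t < w x} \<le> ennreal (C * (B / t) powr (1 / \<theta>))"
    and F: "F \<in> sets M" "emeasure M F = ennreal a" "0 \<le> a"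
  shows "(\<integral>\<^sup>+x. w x * indicator F x \<partial>M) \<le> ennreal (3 * C * B / (1 - \<theta>) * a powr (1 - \<theta>))"
proof (cases "a = 0")
  case True
  then have "F \<in> null_sets M" using F by auto
  then have "(\<integral>\<^sup>+x. w x * indicator F x \<partial>M) = 0" by (rule nn_integral_null_set)
  then show ?thesis by simp
next
  case False
  then have a: "0 < a" using F by simp
  note F(1)[measurable]
  \<comment> \<open>At height \<open>t\<close> the weak type bound equals the measure of \<open>F\<close>.\<close>
  define t where "t = B * (C / a) powr \<theta>"
  have t: "0 < t" using B C a by (simp add: t_def)
  define r where "r = 2 powr (- (1 / \<theta> - 1))"
  have ex: "1 - \<theta> \<le> 1 / \<theta> - 1"
  proof -
    have "0 \<le> (1 - \<theta>)\<^sup>2 / \<theta>" using \<theta> by simp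
    also have "\<dots> = 1 / \<theta> - 1 - (1 - \<theta>)" using \<theta> by (simp add: field_simps power2_eq_square)
    finally show ?thesis by simp
  qed
  have r: "0 < r" "(1 - \<theta>) / 2 \<le> 1 - r" using one_minus_half_powr_ge[OF _ _ ex] \<theta> by (auto simp: r_def)
  then have r1: "r < 1" using \<theta> by simp
  let ?L = "\<lambda>k::nat. 2 ^ k * t"
  have lim: "filterlim ?L at_top sequentially"
    using filterlim_geometric_at_top[of t 2] t by (simp add: mult.commute)
  have pw: "w x * indicator F x \<le> ennreal t * indicator F x +
      (\<Sum>k. ennreal (2 ^ k * t) * indicator {x \<in> space M. ennreal (2 ^ k * t) < w x} x)" if "x \<in> space M" for x
  proof (cases "x \<in> F")
    case True
    have "w x \<le> ennreal (?L 0) + (\<Sum>k. if ennreal (?L k) < w x then ennreal (?L (Suc k) - ?L k) else 0)"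
      using t lim by (intro ennreal_le_suminf_levels) (auto intro!: incseq_SucI)
    also have "(\<Sum>k. if ennreal (?L k) < w x then ennreal (?L (Suc k) - ?L k) else 0)
       = (\<Sum>k. ennreal (2 ^ k * t) * indicator {x \<in> space M. ennreal (2 ^ k * t) < w x} x)"
      using that by (intro suminf_cong) (simp add: indicator_def mult.commute[of t])
    finally show ?thesis using True by simp
  qed simp
  have one: "ennreal (2 ^ k * t) * emeasure M {x \<in> space M. ennreal (2 ^ k * t) < w x} \<le> ennreal (t * a * r ^ k)" for k
  proof -
    have "ennreal (2 ^ k * t) * emeasure M {x \<in> space M. ennreal (2 ^ k * t) < w x}
      \<le> ennreal (2 ^ k * t) * ennreal (C * (B / (2 ^ k * t)) powr (1 / \<theta>))"
      using t by (intro mult_left_mono weak) auto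
    also have "\<dots> = ennreal (2 ^ k * t * (C * (B / (2 ^ k * t)) powr (1 / \<theta>)))"
      using t by (simp add: ennreal_mult')
    also have "2 ^ k * t * (C * (B / (2 ^ k * t)) powr (1 / \<theta>)) = t * a * r ^ k"
    proof -
      have "(B / t) powr (1 / \<theta>) = (1 / (C / a) powr \<theta>) powr (1 / \<theta>)"
        using B by (simp add: t_def)
      also have "\<dots> = a / C" using a C \<theta> by (simp add: powr_divide powr_powr)
      finally have 1: "C * (B / t) powr (1 / \<theta>) = a" using C by simp
      have 2: "2 ^ k * (1 / 2 ^ k) powr (1 / \<theta>) = r ^ k"
      proof -
        have "(1 / 2 ^ k) powr (1 / \<theta>) = (2 powr (- real k)) powr (1 / \<theta>)"
          by (simp add: powr_minus_divide powr_realpow)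
        then have "2 ^ k * (1 / 2 ^ k) powr (1 / \<theta>) = 2 powr (real k) * 2 powr (- real k * (1 / \<theta>))"
          by (simp add: powr_realpow powr_powr)
        also have "\<dots> = 2 powr (- (1 / \<theta> - 1) * real k)"
          by (simp add: algebra_simps flip: powr_add)
        also have "\<dots> = r ^ k" by (simp add: r_def powr_powr flip: powr_realpow)
        finally show ?thesis .
      qed
      have "B / (2 ^ k * t) = (B / t) * (1 / 2 ^ k)" by simp
      then have "(B / (2 ^ k * t)) powr (1 / \<theta>) = (B / t) powr (1 / \<theta>) * (1 / 2 ^ k) powr (1 / \<theta>)"
        using B t by (simp only: powr_mult)
      then have "2 ^ k * t * (C * (B / (2 ^ k * t)) powr (1 / \<theta>)) =
          t * (C * (B / t) powr (1 / \<theta>)) * (2 ^ k * (1 / 2 ^ k) powr (1 / \<theta>))" by (simp only: ac_simps)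
      then show ?thesis unfolding 1 2 .
    qed
    finally show ?thesis .
  qed
  have "(\<integral>\<^sup>+x. w x * indicator F x \<partial>M) \<le> (\<integral>\<^sup>+x. ennreal t * indicator F x +
      (\<Sum>k. ennreal (2 ^ k * t) * indicator {x \<in> space M. ennreal (2 ^ k * t) < w x} x) \<partial>M)"
    by (intro nn_integral_mono pw)
  also have "\<dots> = ennreal t * emeasure M F +
      (\<Sum>k. ennreal (2 ^ k * t) * emeasure M {x \<in> space M. ennreal (2 ^ k * t) < w x})"
    by (subst nn_integral_add) (auto simp: nn_integral_suminf nn_integral_cmult_indicator)
  also have "\<dots> \<le> ennreal t * emeasure M F + (\<Sum>k. ennreal (t * a * r ^ k))"
    by (intro add_left_mono suminf_le one) auto
  also have "(\<Sum>k. ennreal (t * a * r ^ k)) = ennreal (t * a * (1 / (1 - r)))"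
    using t a r r1 by (intro suminf_ennreal_eq sums_mult geometric_sums) auto
  also have "ennreal t * emeasure M F + \<dots> = ennreal (t * a * (1 + 1 / (1 - r)))"
    using F t a r1 by (simp add: ennreal_mult'[symmetric] distrib_left flip: ennreal_plus)
  also have "\<dots> \<le> ennreal (3 * C * B / (1 - \<theta>) * a powr (1 - \<theta>))"
  proof (intro ennreal_leI)
    have "1 / (1 - r) \<le> 1 / ((1 - \<theta>) / 2)" using r \<theta> by (intro divide_left_mono) auto
    moreover have "1 \<le> 1 / (1 - \<theta>)" using \<theta> by simp
    ultimately have 1: "1 + 1 / (1 - r) \<le> 3 / (1 - \<theta>)" by simp
    have "C powr \<theta> \<le> C powr 1" using \<theta> C by (intro powr_mono) auto
    then have 2: "C powr \<theta> \<le> C" using C by simp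
    have "t * a = B * C powr \<theta> * a powr (1 - \<theta>)"
      using a C by (simp add: t_def powr_divide powr_diff)
    also have "\<dots> \<le> B * C * a powr (1 - \<theta>)" using B 2 by (intro mult_right_mono mult_left_mono) auto
    finally have 3: "t * a \<le> B * C * a powr (1 - \<theta>)" .
    have "t * a * (1 + 1 / (1 - r)) \<le> (B * C * a powr (1 - \<theta>)) * (3 / (1 - \<theta>))"
      using t a B C r1 by (intro mult_mono[OF 3 1]) auto
    then show "t * a * (1 + 1 / (1 - r)) \<le> 3 * C * B / (1 - \<theta>) * a powr (1 - \<theta>)"
      by (simp add: ac_simps)
  qed
  finally show ?thesis .
qed

section \<open>The weighted inequality for functions with finite level sets\<close>

lemma ennreal_le_if_small_perturbation:
  fixes Y :: ennreal
  assumes le: "\<And>\<tau>. 0 < \<tau> \<Longrightarrow> Y \<le> ennreal (\<tau> powr p * m + Z)" and p: "0 < p" and mZ: "0 \<le> m" "0 \<le> Z"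
  shows "Y \<le> ennreal Z"
proof (rule ennreal_le_epsilon)
  fix e :: real assume e: "0 < e"
  define \<tau> where "\<tau> = (e / (m + 1)) powr (1 / p)"
  have "0 < \<tau>" using e mZ by (simp add: \<tau>_def)
  moreover have "\<tau> powr p = e / (m + 1)" using e mZ p by (simp add: \<tau>_def powr_powr)
  moreover have "e / (m + 1) * m \<le> e" using e mZ by (simp add: field_simps)
  ultimately have "\<tau> powr p * m + Z \<le> Z + e" by simp
  then have "ennreal (\<tau> powr p * m + Z) \<le> ennreal Z + ennreal e"
    using e mZ by (simp flip: ennreal_plus)
  then show "Y \<le> ennreal Z + ennreal e" using le[OF \<open>0 < \<tau>\<close>] by (rule order_trans[rotated])
qed

text \<open>
  The form in which the weak type condition is used: testing \<open>w\<close> against sets is, up to constants,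
  membership in the Lorentz space dual to the one measured by the level sets.
\<close>
definition weak_type_weight :: "real \<Rightarrow> real \<Rightarrow> ('a::euclidean_space \<Rightarrow> ennreal) \<Rightarrow> bool" where
  "weak_type_weight \<theta> A w \<longleftrightarrow> w \<in> borel_measurable borel \<and>
     (\<forall>F a. F \<in> sets borel \<longrightarrow> 0 \<le> a \<longrightarrow> emeasure lborel F = ennreal a \<longrightarrow>
        (\<integral>\<^sup>+x. w x * indicator F x \<partial>lborel) \<le> ennreal (A / (1 - \<theta>) * a powr (1 - \<theta>)))"

lemma weak_type_weightI:
  fixes w :: "'a::euclidean_space \<Rightarrow> ennreal"
  assumes w: "w \<in> borel_measurable borel" and "0 < \<theta>" "\<theta> < 1" "1 \<le> C" "0 < B"
    and weak: "\<And>t. 0 < t \<Longrightarrow> emeasure lborel {x. ennreal t < w x} \<le> ennreal (C * (B / t) powr (1 / \<theta>))"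
  shows "weak_type_weight \<theta> (3 * C * B) w"
  using weak_type_integral_on_set[of w lborel \<theta> C B] assms
  by (auto simp: weak_type_weight_def)

text \<open>
  The levels are \<open>\<tau> (1 + \<eta>)^k\<close> with \<open>\<eta> = (1 - \<theta>) / p\<close>, so that \<open>T = (1 + \<eta>) powr p\<close> is the ratio of their
  \<open>p\<close>-th powers.  Then \<open>T\<close> and \<open>T powr (\<theta> / (1 - \<theta>))\<close> are at most \<open>e\<close>, and \<open>T - 1\<close> is at most
  \<open>e (1 - \<theta>)\<close>; these three estimates make up \<open>exp 3\<close>.  The part of \<open>v\<close> below the lowest level costs
  \<open>\<tau> powr p\<close> times a constant, finite because \<open>v\<close> lives on a set of finite measure, and disappears
  as \<open>\<tau>\<close> tends to \<open>0\<close>.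
\<close>
lemma weighted_bound_finite_support:
  fixes v :: "'a::euclidean_space \<Rightarrow> real" and w :: "'a \<Rightarrow> ennreal"
  defines "V \<equiv> unit_ball_vol (real DIM('a))"
  assumes v[measurable]: "v \<in> borel_measurable borel" and v0: "\<And>x. 0 \<le> v x"
    and p: "1 \<le> p" and \<delta>: "0 < \<delta>" "\<delta> < 1" and \<theta>eq: "\<theta> = \<delta> * p / real DIM('a)" and \<theta>: "\<theta> < 1"
    and w: "weak_type_weight \<theta> A w" and A: "0 \<le> A"
    and fin: "emeasure lborel {x. 0 < v x} < \<infinity>"
    and D: "energy \<delta> p v = ennreal D" "0 \<le> D"
  shows "(\<integral>\<^sup>+x. ennreal (v x powr p) * w x \<partial>lborel) \<le>
    ennreal (exp 3 * A * ((4 / V) powr (1 + \<theta>) * ((1 - \<delta>) * p) * D) * (p / (1 - \<theta>)) powr p)"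
proof -
  note wm[measurable] = w[unfolded weak_type_weight_def, THEN conjunct1]
  have V: "0 < V" unfolding V_def by simp
  have \<theta>0: "0 < \<theta>" using \<theta>eq \<delta> p by simp
  define \<eta> where "\<eta> = (1 - \<theta>) / p"
  have \<eta>: "0 < \<eta>" "\<eta> * p = 1 - \<theta>" using \<theta> p by (auto simp: \<eta>_def)
  define T where "T = (1 + \<eta>) powr p"
  have T: "1 < T" using \<eta> p by (simp add: T_def)
  have ln: "ln (1 + \<eta>) \<le> \<eta>" using \<eta> by (simp add: ln_add_one_self_le_self)
  have T': "T \<le> exp (1 - \<theta>)"
  proof -
    have "T = exp (p * ln (1 + \<eta>))" using \<eta> by (simp add: T_def powr_def)
    also have "\<dots> \<le> exp (p * \<eta>)" using ln p by simp
    finally show ?thesis using \<eta> by (simp add: mult.commute)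
  qed
  also have "exp (1 - \<theta>) \<le> exp 1" using \<theta>0 by simp
  finally have Te: "T \<le> exp 1" .
  have T1: "T - 1 \<le> exp 1 * (1 - \<theta>)"
  proof -
    have "1 - (1 - \<theta>) \<le> exp (- (1 - \<theta>))" using exp_ge_add_one_self[of "- (1 - \<theta>)"] by simp
    then have "exp (1 - \<theta>) * (1 - (1 - \<theta>)) \<le> exp (1 - \<theta>) * exp (- (1 - \<theta>))" by (intro mult_left_mono) auto
    then have "exp (1 - \<theta>) - 1 \<le> exp (1 - \<theta>) * (1 - \<theta>)" by (simp add: algebra_simps flip: exp_add)
    also have "\<dots> \<le> exp 1 * (1 - \<theta>)" using \<theta> \<theta>0 by (intro mult_right_mono) auto
    finally show ?thesis using T' by simp
  qed
  define \<Lambda> where "\<Lambda> = T powr (\<theta> / (1 - \<theta>))"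
  have \<Lambda>: "0 \<le> \<Lambda>" "\<Lambda> \<le> exp 1"
  proof -
    have "\<Lambda> \<le> exp (1 - \<theta>) powr (\<theta> / (1 - \<theta>))"
      unfolding \<Lambda>_def using T T' \<theta> \<theta>0 by (intro powr_mono2) auto
    also have "\<dots> = exp \<theta>" using \<theta> by (simp add: powr_def)
    also have "\<dots> \<le> exp 1" using \<theta> by simp
    finally show "\<Lambda> \<le> exp 1" .
  qed (simp add: \<Lambda>_def)
  define X where "X = (4 / V) powr (1 + \<theta>) * ((1 - \<delta>) * p) * D"
  have X: "0 \<le> X" using p \<delta> D by (simp add: X_def)
  define W where "W = A / (1 - \<theta>)"
  have W: "0 \<le> W" using A \<theta> by (simp add: W_def)
  obtain g where g: "emeasure lborel {x. 0 < v x} = ennreal g" "0 \<le> g"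
    using fin by (cases "emeasure lborel {x. 0 < v x}") auto
  define G where "G = g powr (1 - \<theta>)"
  have G: "0 \<le> G" by (simp add: G_def)
  define m where "m = W * G + (T - 1) * W * (G + T * (\<theta> / (1 - \<theta>) / T * G))"
  have m: "0 \<le> m" using W G T \<theta> \<theta>0 by (simp add: m_def)
  have bound: "(\<integral>\<^sup>+x. ennreal (v x powr p) * w x \<partial>lborel) \<le>
      ennreal (\<tau> powr p * m + (T - 1) * W * T * \<Lambda> * X * \<eta> powr (- p))" if \<tau>: "0 < \<tau>" for \<tau>
  proof -
    define l where "l k = \<tau> * (1 + \<eta>) ^ k" for k
    have l: "0 < l k" "l k < l (Suc k)" "l (Suc k) - l k = \<eta> * l k" for k
      using \<tau> \<eta> by (auto simp: l_def algebra_simps)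
    have lmono: "mono l" using l(2) by (intro incseq_SucI less_imp_le)
    have lp: "l k powr p = \<tau> powr p * T ^ k" for k
    proof -
      have "((1 + \<eta>) ^ k) powr p = T ^ k"
        using \<eta> by (simp add: T_def powr_powr mult.commute flip: powr_realpow)
      then show ?thesis using \<tau> \<eta> by (simp add: l_def powr_mult)
    qed
    define a where "a k = measure lborel {x. l k < v x}" for k
    have sub: "{x. l k < v x} \<subseteq> {x. 0 < v x}" for k using l(1)[of k] by auto
    have a: "emeasure lborel {x. l k < v x} = ennreal (a k)" for k
    proof -
      have "emeasure lborel {x. l k < v x} \<le> emeasure lborel {x. 0 < v x}"
        using sub by (intro emeasure_mono) auto
      then show ?thesis
        unfolding a_def using fin by (intro emeasure_eq_ennreal_measure) auto
    qed
    have a0: "0 \<le> a k" for k by (simp add: a_def)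
    have adec: "a (Suc k) \<le> a k" for k
    proof -
      have "emeasure lborel {x. l (Suc k) < v x} \<le> emeasure lborel {x. l k < v x}"
        using l(2)[of k] by (intro emeasure_mono) auto
      then show ?thesis using a0 by (simp add: a)
    qed
    have ag: "a 0 \<le> g"
    proof -
      have "emeasure lborel {x. l 0 < v x} \<le> emeasure lborel {x. 0 < v x}"
        using sub by (intro emeasure_mono) auto
      then show ?thesis using a0 g by (simp add: a)
    qed
    have aG: "a 0 powr (1 - \<theta>) \<le> G" unfolding G_def using ag a0 \<theta> by (intro powr_mono2) auto
    have step: "ennreal ((\<eta> * \<tau>) powr p * (T ^ k * (a (Suc k) * a k powr (- \<theta>)))) \<le>
      ennreal ((4 / V) powr (1 + \<theta>) * ((1 - \<delta>) * p)) * energy \<delta> p (\<lambda>x. clamp_between (l k) (l (Suc k)) (v x))" for k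
    proof (cases "a k = 0")
      case True
      then show ?thesis by simp
    next
      case False
      then have "0 < a k" using a0[of k] by simp
      then have "ennreal ((l (Suc k) - l k) powr p * a k powr (- \<theta>)) * emeasure lborel {x. l (Suc k) < v x}
        \<le> ennreal ((4 / V) powr (1 + \<theta>) * ((1 - \<delta>) * p)) * energy \<delta> p (\<lambda>x. clamp_between (l k) (l (Suc k)) (v x))"
        unfolding V_def using l a \<theta>eq p \<delta> v by (intro energy_ge_level_sets) auto
      moreover have "(l (Suc k) - l k) powr p * a k powr (- \<theta>) * a (Suc k) =
          (\<eta> * \<tau>) powr p * (T ^ k * (a (Suc k) * a k powr (- \<theta>)))"
        using l(1)[of k] \<eta> \<tau> by (simp add: l(3) powr_mult lp)
      ultimately show ?thesis using a0 by (simp add: a flip: ennreal_mult')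
    qed
    have Xle: "(\<eta> * \<tau>) powr p * (\<Sum>k<N. T ^ k * (a (Suc k) * a k powr (- \<theta>))) \<le> X" for N
    proof -
      have "ennreal ((\<eta> * \<tau>) powr p * (\<Sum>k<N. T ^ k * (a (Suc k) * a k powr (- \<theta>)))) =
        (\<Sum>k<N. ennreal ((\<eta> * \<tau>) powr p * (T ^ k * (a (Suc k) * a k powr (- \<theta>)))))"
        using T a0 by (subst sum_ennreal) (auto simp: sum_distrib_left)
      also have "\<dots> \<le> (\<Sum>k<N. ennreal ((4 / V) powr (1 + \<theta>) * ((1 - \<delta>) * p)) *
          energy \<delta> p (\<lambda>x. clamp_between (l k) (l (Suc k)) (v x)))"
        by (intro sum_mono step)
      also have "\<dots> = ennreal ((4 / V) powr (1 + \<theta>) * ((1 - \<delta>) * p)) *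
          (\<Sum>k<N. energy \<delta> p (\<lambda>x. clamp_between (l k) (l (Suc k)) (v x)))"
        by (simp add: sum_distrib_left)
      also have "\<dots> \<le> ennreal ((4 / V) powr (1 + \<theta>) * ((1 - \<delta>) * p)) * ennreal D"
        using sum_energy_clamp_le[OF v p lmono, of \<delta> N] D by (intro mult_left_mono) auto
      also have "\<dots> = ennreal X" using p \<delta> D by (simp add: X_def ennreal_mult')
      finally show ?thesis using X by simp
    qed
    have chain: "(\<Sum>k<N. T ^ k * a k powr (1 - \<theta>)) \<le>
       G + T * (\<theta> / (1 - \<theta>) / T * G) + T * \<Lambda> * (X / (\<eta> * \<tau>) powr p)" for N
    proof -
      have "(\<Sum>k<N. T ^ k * a k powr (1 - \<theta>)) \<le> (\<Sum>k<Suc N. T ^ k * a k powr (1 - \<theta>))"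
        using T by (intro sum_mono2) auto
      also have "\<dots> = a 0 powr (1 - \<theta>) + T * (\<Sum>k<N. T ^ k * a (Suc k) powr (1 - \<theta>))"
        by (subst sum.lessThan_Suc_shift) (simp add: sum_distrib_left mult.assoc)
      also have "\<dots> \<le> G + T * (\<Lambda> * (X / (\<eta> * \<tau>) powr p) + \<theta> / (1 - \<theta>) / T * G)"
      proof (intro add_mono aG mult_left_mono)
        have "(\<Sum>k<N. T ^ k * a (Suc k) powr (1 - \<theta>)) \<le>
          \<Lambda> * (\<Sum>k<N. T ^ k * (a (Suc k) * a k powr (- \<theta>))) + \<theta> / (1 - \<theta>) / T * a 0 powr (1 - \<theta>)"
          unfolding \<Lambda>_def using a0 adec \<theta> \<theta>0 T by (intro level_chain) auto
        also have "\<dots> \<le> \<Lambda> * (X / (\<eta> * \<tau>) powr p) + \<theta> / (1 - \<theta>) / T * G"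
          using Xle[of N] \<eta> \<tau> \<Lambda> \<theta> \<theta>0 T aG
          by (intro add_mono mult_left_mono) (auto simp: pos_le_divide_eq mult.commute)
        finally show "(\<Sum>k<N. T ^ k * a (Suc k) powr (1 - \<theta>)) \<le>
          \<Lambda> * (X / (\<eta> * \<tau>) powr p) + \<theta> / (1 - \<theta>) / T * G" .
      qed (use T in auto)
      finally show ?thesis by (simp add: algebra_simps)
    qed
    have wF: "(\<integral>\<^sup>+x. w x * indicator {x. l k < v x} x \<partial>lborel) \<le> ennreal (W * a k powr (1 - \<theta>))" for k
      using w a[of k] a0[of k] unfolding weak_type_weight_def W_def by auto
    have wG: "(\<integral>\<^sup>+x. w x * indicator {x. 0 < v x} x \<partial>lborel) \<le> ennreal (W * G)"
      using w g unfolding weak_type_weight_def W_def G_def by auto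
    let ?L = "\<lambda>k. \<tau> powr p * T ^ k"
    have pw: "ennreal (v x powr p) * w x \<le> ennreal (\<tau> powr p) * (w x * indicator {x. 0 < v x} x) +
        (\<Sum>k. ennreal ((T - 1) * ?L k) * (w x * indicator {x. l k < v x} x))" for x
    proof (cases "v x = 0")
      case False
      then have vx: "0 < v x" using v0[of x] by simp
      have "ennreal (v x powr p) \<le> ennreal (?L 0) +
          (\<Sum>k. if ennreal (?L k) < ennreal (v x powr p) then ennreal (?L (Suc k) - ?L k) else 0)"
        using T \<tau> filterlim_geometric_at_top[of "\<tau> powr p" T]
        by (intro ennreal_le_suminf_levels) (auto intro!: incseq_SucI)
      also have "(\<Sum>k. if ennreal (?L k) < ennreal (v x powr p) then ennreal (?L (Suc k) - ?L k) else 0)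
          = (\<Sum>k. ennreal ((T - 1) * ?L k) * indicator {x. l k < v x} x)"
      proof (intro suminf_cong)
        fix k
        have "ennreal (?L k) < ennreal (v x powr p) \<longleftrightarrow> l k powr p < v x powr p"
          using T \<tau> by (simp add: lp ennreal_less_iff)
        also have "\<dots> \<longleftrightarrow> l k < v x"
          using vx l(1)[of k] p powr_less_mono2[of p "l k" "v x"] powr_mono2[of p "v x" "l k"]
          by (cases "l k < v x") auto
        finally show "(if ennreal (?L k) < ennreal (v x powr p) then ennreal (?L (Suc k) - ?L k) else 0) =
            ennreal ((T - 1) * ?L k) * indicator {x. l k < v x} x"
          by (auto simp: algebra_simps indicator_def)
      qed
      finally have "ennreal (v x powr p) * w x \<le> (ennreal (?L 0) +
          (\<Sum>k. ennreal ((T - 1) * ?L k) * indicator {x. l k < v x} x)) * w x"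
        by (rule mult_right_mono) simp
      also have "\<dots> = ennreal (\<tau> powr p) * (w x * indicator {x. 0 < v x} x) +
          (\<Sum>k. ennreal ((T - 1) * ?L k) * (w x * indicator {x. l k < v x} x))"
        using vx unfolding distrib_right ennreal_suminf_multc[symmetric] by (simp add: mult_ac)
      finally show ?thesis .
    qed simp
    have "(\<integral>\<^sup>+x. ennreal (v x powr p) * w x \<partial>lborel) \<le>
       (\<integral>\<^sup>+x. ennreal (\<tau> powr p) * (w x * indicator {x. 0 < v x} x) +
        (\<Sum>k. ennreal ((T - 1) * ?L k) * (w x * indicator {x. l k < v x} x)) \<partial>lborel)"
      by (intro nn_integral_mono pw)
    also have "\<dots> = ennreal (\<tau> powr p) * (\<integral>\<^sup>+x. w x * indicator {x. 0 < v x} x \<partial>lborel) +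
        (\<Sum>k. ennreal ((T - 1) * ?L k) * (\<integral>\<^sup>+x. w x * indicator {x. l k < v x} x \<partial>lborel))"
      by (subst nn_integral_add, measurable) (simp add: nn_integral_cmult nn_integral_suminf)
    also have "\<dots> \<le> ennreal (\<tau> powr p) * ennreal (W * G) +
        (\<Sum>k. ennreal ((T - 1) * ?L k) * ennreal (W * a k powr (1 - \<theta>)))"
      by (intro add_mono mult_left_mono suminf_le wF wG) auto
    also have "(\<Sum>k. ennreal ((T - 1) * ?L k) * ennreal (W * a k powr (1 - \<theta>))) \<le>
        ennreal ((T - 1) * W * \<tau> powr p * (G + T * (\<theta> / (1 - \<theta>) / T * G) + T * \<Lambda> * (X / (\<eta> * \<tau>) powr p)))"
    proof (rule suminf_le_const)
      fix N
      have "(\<Sum>k<N. ennreal ((T - 1) * ?L k) * ennreal (W * a k powr (1 - \<theta>))) =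
          (\<Sum>k<N. ennreal ((T - 1) * W * \<tau> powr p * (T ^ k * a k powr (1 - \<theta>))))"
        using T W by (intro sum.cong) (auto simp: ac_simps simp flip: ennreal_mult')
      also have "\<dots> = ennreal ((T - 1) * W * \<tau> powr p * (\<Sum>k<N. T ^ k * a k powr (1 - \<theta>)))"
        using T W by (subst sum_ennreal) (auto simp: sum_distrib_left)
      also have "\<dots> \<le> ennreal ((T - 1) * W * \<tau> powr p * (G + T * (\<theta> / (1 - \<theta>) / T * G) + T * \<Lambda> * (X / (\<eta> * \<tau>) powr p)))"
        using T W by (intro ennreal_leI mult_left_mono chain) auto
      finally show "(\<Sum>k<N. ennreal ((T - 1) * ?L k) * ennreal (W * a k powr (1 - \<theta>))) \<le>
        ennreal ((T - 1) * W * \<tau> powr p * (G + T * (\<theta> / (1 - \<theta>) / T * G) + T * \<Lambda> * (X / (\<eta> * \<tau>) powr p)))" .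
    qed simp
    also have "ennreal (\<tau> powr p) * ennreal (W * G) + ennreal ((T - 1) * W * \<tau> powr p * (G + T * (\<theta> / (1 - \<theta>) / T * G) + T * \<Lambda> * (X / (\<eta> * \<tau>) powr p)))
       = ennreal (\<tau> powr p * m + (T - 1) * W * T * \<Lambda> * X * \<eta> powr (- p))"
    proof -
      have Y: "\<tau> powr p * (X / (\<eta> * \<tau>) powr p) = X * \<eta> powr (- p)"
        using \<eta> \<tau> by (simp add: powr_mult powr_minus divide_inverse)
      have alg: "(T - 1) * W * t * (H + T * \<Lambda> * Y) = t * ((T - 1) * W * H) + (T - 1) * W * T * \<Lambda> * (t * Y)"
        for t H Y :: real by (simp add: algebra_simps)
      have "(T - 1) * W * \<tau> powr p * (G + T * (\<theta> / (1 - \<theta>) / T * G) + T * \<Lambda> * (X / (\<eta> * \<tau>) powr p)) =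
          \<tau> powr p * ((T - 1) * W * (G + T * (\<theta> / (1 - \<theta>) / T * G))) + (T - 1) * W * T * \<Lambda> * (X * \<eta> powr (- p))"
        unfolding alg Y ..
      moreover have "0 \<le> (T - 1) * W * (G + T * (\<theta> / (1 - \<theta>) / T * G))"
        "0 \<le> (T - 1) * W * T * \<Lambda> * (X * \<eta> powr (- p))" "0 \<le> W * G"
        using T W G \<theta> \<theta>0 \<Lambda> X by auto
      moreover have "ennreal t * ennreal b + ennreal (t * c + d) = ennreal (t * (b + c) + d)"
        if "0 \<le> t" "0 \<le> b" "0 \<le> c" "0 \<le> d" for t b c d :: real
        using that by (simp add: distrib_left add.assoc flip: ennreal_mult' ennreal_plus)
      ultimately show ?thesis
        by (simp add: m_def mult.assoc)
    qed
    finally show ?thesis by simp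
  qed
  have "(\<integral>\<^sup>+x. ennreal (v x powr p) * w x \<partial>lborel) \<le> ennreal ((T - 1) * W * T * \<Lambda> * X * \<eta> powr (- p))"
    using T W X \<Lambda> m p by (intro ennreal_le_if_small_perturbation[OF bound]) auto
  also have "\<dots> \<le> ennreal (exp 3 * A * X * (p / (1 - \<theta>)) powr p)"
  proof (intro ennreal_leI)
    have 1: "(T - 1) * W \<le> exp 1 * A"
      using mult_right_mono[OF T1 W] \<theta> by (simp add: W_def)
    have 2: "\<eta> powr (- p) = (p / (1 - \<theta>)) powr p"
      using p \<theta> by (simp add: \<eta>_def powr_minus powr_divide)
    have "(T - 1) * W * T * \<Lambda> \<le> (exp 1 * A) * exp 1 * exp 1"
      using \<Lambda> T W A by (intro mult_mono[OF mult_mono[OF 1 Te]]) auto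
    also have "\<dots> = exp 3 * A" by (simp add: exp_add[symmetric] ac_simps)
    finally show "(T - 1) * W * T * \<Lambda> * X * \<eta> powr (- p) \<le> exp 3 * A * X * (p / (1 - \<theta>)) powr p"
      unfolding 2 using X by (intro mult_right_mono) auto
  qed
  finally show ?thesis unfolding X_def .
qed

text \<open>
  The functions \<open>max (\<bar>u\<bar> - 1/m) 0\<close> live on sets of finite measure, have no more energy than \<open>u\<close>, and
  increase to \<open>\<bar>u\<bar>\<close>.
\<close>
lemma weighted_bound_finite_levels:
  fixes u :: "'a::euclidean_space \<Rightarrow> real" and w :: "'a \<Rightarrow> ennreal"
  defines "V \<equiv> unit_ball_vol (real DIM('a))"
  assumes u[measurable]: "u \<in> borel_measurable borel"
    and p: "1 \<le> p" and \<delta>: "0 < \<delta>" "\<delta> < 1" and \<theta>eq: "\<theta> = \<delta> * p / real DIM('a)" and \<theta>: "\<theta> < 1"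
    and w: "weak_type_weight \<theta> A w" and A: "0 \<le> A"
    and fin: "\<And>e. 0 < e \<Longrightarrow> emeasure lborel {x. e < \<bar>u x\<bar>} < \<infinity>"
    and D: "energy \<delta> p u = ennreal D" "0 \<le> D"
  shows "(\<integral>\<^sup>+x. ennreal (\<bar>u x\<bar> powr p) * w x \<partial>lborel) \<le>
    ennreal (exp 3 * A * ((4 / V) powr (1 + \<theta>) * ((1 - \<delta>) * p) * D) * (p / (1 - \<theta>)) powr p)"
proof -
  note wm[measurable] = w[unfolded weak_type_weight_def, THEN conjunct1]
  define v where "v m x = max (\<bar>u x\<bar> - 1 / real (Suc m)) 0" for m :: nat and x
  have v[measurable]: "v m \<in> borel_measurable borel" for m unfolding v_def[abs_def] by measurable
  have bound: "(\<integral>\<^sup>+x. ennreal (v m x powr p) * w x \<partial>lborel) \<le>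
    ennreal (exp 3 * A * ((4 / V) powr (1 + \<theta>) * ((1 - \<delta>) * p) * D) * (p / (1 - \<theta>)) powr p)" for m
  proof -
    have "energy \<delta> p (v m) \<le> ennreal D"
      unfolding D(1)[symmetric] by (intro energy_mono p) (auto simp: v_def max_def)
    then obtain D' where D': "energy \<delta> p (v m) = ennreal D'" "0 \<le> D'" "D' \<le> D"
      using D(2) by (cases "energy \<delta> p (v m)") (auto simp: top_unique)
    have "{x. 0 < v m x} = {x. 1 / real (Suc m) < \<bar>u x\<bar>}" by (auto simp: v_def max_def)
    then have "emeasure lborel {x. 0 < v m x} < \<infinity>" using fin[of "1 / real (Suc m)"] by simp
    then have "(\<integral>\<^sup>+x. ennreal (v m x powr p) * w x \<partial>lborel) \<le>
      ennreal (exp 3 * A * ((4 / V) powr (1 + \<theta>) * ((1 - \<delta>) * p) * D') * (p / (1 - \<theta>)) powr p)"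
      unfolding V_def
      by (intro weighted_bound_finite_support v p \<delta> \<theta>eq \<theta> w A D') (auto simp: v_def)
    also have "\<dots> \<le> ennreal (exp 3 * A * ((4 / V) powr (1 + \<theta>) * ((1 - \<delta>) * p) * D) * (p / (1 - \<theta>)) powr p)"
      using D' p \<delta> A by (intro ennreal_leI mult_right_mono mult_left_mono) auto
    finally show ?thesis .
  qed
  have vmono: "v m x \<le> v (Suc m) x" and v0: "0 \<le> v m x" for m x
  proof -
    have "1 / real (Suc (Suc m)) \<le> 1 / real (Suc m)" by (intro divide_left_mono) auto
    then show "v m x \<le> v (Suc m) x" by (auto simp: v_def max_def)
  qed (simp add: v_def)
  have inc: "incseq (\<lambda>m. ennreal (v m x powr p))" for x
    using vmono v0 p by (intro incseq_SucI ennreal_leI powr_mono2) auto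
  have lim: "(\<lambda>m. ennreal (v m x powr p)) \<longlonglongrightarrow> ennreal (\<bar>u x\<bar> powr p)" for x
  proof -
    have "(\<lambda>m. max (\<bar>u x\<bar> - 1 / real (Suc m)) 0) \<longlonglongrightarrow> max (\<bar>u x\<bar> - 0) 0"
      by (intro tendsto_intros LIMSEQ_Suc lim_1_over_n)
    then have "(\<lambda>m. v m x) \<longlonglongrightarrow> \<bar>u x\<bar>" by (simp add: v_def)
    then have "(\<lambda>m. v m x powr p) \<longlonglongrightarrow> \<bar>u x\<bar> powr p"
      using p v0 by (intro tendsto_powr2 tendsto_const) auto
    then show ?thesis by (rule tendsto_ennrealI)
  qed
  have SUP: "(SUP m. ennreal (v m x powr p) * w x) = ennreal (\<bar>u x\<bar> powr p) * w x" for x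
    using LIMSEQ_unique[OF LIMSEQ_SUP[OF inc] lim, of x] by (simp flip: SUP_mult_right_ennreal)
  have "(\<integral>\<^sup>+x. ennreal (\<bar>u x\<bar> powr p) * w x \<partial>lborel) = (\<integral>\<^sup>+x. (SUP m. ennreal (v m x powr p) * w x) \<partial>lborel)"
    by (simp add: SUP)
  also have "\<dots> = (SUP m. (\<integral>\<^sup>+x. ennreal (v m x powr p) * w x \<partial>lborel))"
    using inc by (intro nn_integral_monotone_convergence_SUP)
      (auto simp: incseq_def le_fun_def intro!: mult_right_mono)
  also have "\<dots> \<le> ennreal (exp 3 * A * ((4 / V) powr (1 + \<theta>) * ((1 - \<delta>) * p) * D) * (p / (1 - \<theta>)) powr p)"
    by (intro SUP_least bound)
  finally show ?thesis .
qed

section \<open>Means and the limit of a function of finite energy\<close>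

text \<open>
  A substitute for Jensen's inequality: it passes from first to \<open>p\<close>-th powers under an integral at the
  price of a free parameter \<open>e\<close>.
\<close>
lemma le_add_powr_mult:
  fixes t e p :: real
  assumes "0 < e" "0 \<le> t" "1 \<le> p"
  shows "t \<le> e + e powr (1 - p) * t powr p"
proof (cases "t \<le> e")
  case False
  then have "1 * t \<le> (t / e) powr (p - 1) * t"
    using assms by (intro mult_right_mono ge_one_powr_ge_zero) auto
  also have "\<dots> = e powr (1 - p) * t powr p"
    using assms False by (simp add: powr_divide powr_diff field_simps)
  finally show ?thesis using assms by simp
next
  case True
  then show ?thesis by (simp add: add_increasing2)
qed

lemma mean_deviation_le:
  fixes u :: "'b \<Rightarrow> real"
  assumes int: "set_integrable M S u" and S[measurable]: "S \<in> sets M" and m: "emeasure M S = ennreal m" "0 < m"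
  shows "ennreal (m * \<bar>(LINT x:S|M. u x) / m - t\<bar>) \<le> (\<integral>\<^sup>+x. ennreal \<bar>u x - t\<bar> * indicator S x \<partial>M)"
proof -
  have intt: "set_integrable M S (\<lambda>x. t)"
    unfolding set_integrable_def using m by (intro integrable_scaleR_left) auto
  have intd: "set_integrable M S (\<lambda>x. u x - t)" using int intt by (rule set_integral_diff)
  have "measure M S = m" using m by (simp add: measure_def)
  then have "(LINT x:S|M. u x - t) = (LINT x:S|M. u x) - m * t"
    using set_integral_diff(2)[OF int intt] by (simp add: set_lebesgue_integral_def mult.commute)
  also have "\<dots> = m * ((LINT x:S|M. u x) / m - t)" using m by (simp add: right_diff_distrib)
  finally have "m * \<bar>(LINT x:S|M. u x) / m - t\<bar> = \<bar>LINT x:S|M. u x - t\<bar>"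
    using m by (simp add: abs_mult)
  also have "ennreal \<dots> \<le> (\<integral>\<^sup>+x. ennreal (norm (indicator S x *\<^sub>R (u x - t))) \<partial>M)"
    using integral_norm_bound_ennreal[OF intd[unfolded set_integrable_def]]
    by (simp add: set_lebesgue_integral_def)
  also have "\<dots> = (\<integral>\<^sup>+x. ennreal \<bar>u x - t\<bar> * indicator S x \<partial>M)"
    by (intro nn_integral_cong) (auto simp: indicator_def)
  finally show ?thesis .
qed

lemma nn_integral_le_young:
  fixes f :: "'b \<Rightarrow> real"
  assumes [measurable]: "f \<in> borel_measurable M" "S \<in> sets M" and m: "emeasure M S = ennreal m" "0 \<le> m"
    and e: "0 < e" and p: "1 \<le> p"
  shows "(\<integral>\<^sup>+x. ennreal \<bar>f x\<bar> * indicator S x \<partial>M) \<le>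
    ennreal (e * m) + ennreal (e powr (1 - p)) * (\<integral>\<^sup>+x. ennreal (\<bar>f x\<bar> powr p) * indicator S x \<partial>M)"
proof -
  have "(\<integral>\<^sup>+x. ennreal \<bar>f x\<bar> * indicator S x \<partial>M) \<le> (\<integral>\<^sup>+x. ennreal e * indicator S x +
      ennreal (e powr (1 - p)) * (ennreal (\<bar>f x\<bar> powr p) * indicator S x) \<partial>M)"
    using le_add_powr_mult[OF e _ p] e
    by (intro nn_integral_mono) (auto simp: indicator_def simp flip: ennreal_mult' ennreal_plus)
  also have "\<dots> = ennreal (e * m) + ennreal (e powr (1 - p)) * (\<integral>\<^sup>+x. ennreal (\<bar>f x\<bar> powr p) * indicator S x \<partial>M)"
    using m e by (subst nn_integral_add) (auto simp: nn_integral_cmult nn_integral_cmult_indicator ennreal_mult')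
  finally show ?thesis .
qed

definition ball_mean :: "('a::euclidean_space \<Rightarrow> real) \<Rightarrow> 'a \<Rightarrow> real \<Rightarrow> real" where
  "ball_mean u x r = (LINT y:ball x r|lborel. u y) / (unit_ball_vol (real DIM('a)) * r ^ DIM('a))"

lemma ball_mean_deviation:
  fixes u :: "'a::euclidean_space \<Rightarrow> real"
  defines "m \<equiv> \<lambda>r. unit_ball_vol (real DIM('a)) * r ^ DIM('a)"
  assumes [measurable]: "u \<in> borel_measurable borel" and int: "set_integrable lborel (ball x r) u"
    and r: "0 < r" and e: "0 < e" and p: "1 \<le> p"
  shows "ennreal (m r * \<bar>ball_mean u x r - t\<bar>) \<le> ennreal (e * m r) +
    ennreal (e powr (1 - p)) * (\<integral>\<^sup>+y. ennreal (\<bar>u y - t\<bar> powr p) * indicator (ball x r) y \<partial>lborel)"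
proof -
  have m: "0 < m r" "emeasure lborel (ball x r) = ennreal (m r)"
    using r by (auto simp: m_def emeasure_ball)
  have "ennreal (m r * \<bar>ball_mean u x r - t\<bar>) \<le> (\<integral>\<^sup>+y. ennreal \<bar>u y - t\<bar> * indicator (ball x r) y \<partial>lborel)"
    unfolding ball_mean_def using mean_deviation_le[OF int _ m(2,1), of t] by (simp add: m_def)
  also have "\<dots> \<le> ennreal (e * m r) +
    ennreal (e powr (1 - p)) * (\<integral>\<^sup>+y. ennreal (\<bar>u y - t\<bar> powr p) * indicator (ball x r) y \<partial>lborel)"
    using m e p by (intro nn_integral_le_young) auto
  finally show ?thesis .
qed

text \<open>
  The difference of the two means is at most the mean of \<open>\<bar>u z - u y\<bar>\<close> over the pairs, which have
  distance at most \<open>4 r\<close>; this is a Poincare inequality without derivative.  The exponent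
  \<open>\<delta> - n / p\<close> is negative when \<open>\<delta> p < n\<close>, so that means over dyadic balls form a Cauchy sequence.
\<close>
lemma ball_means_close:
  fixes u :: "'a::euclidean_space \<Rightarrow> real"
  assumes [measurable]: "u \<in> borel_measurable borel"
    and int: "\<And>x r. set_integrable lborel (ball x r) u"
    and p: "1 \<le> p" and \<delta>: "0 < \<delta>" and D: "energy \<delta> p u = ennreal D" "0 \<le> D"
  obtains M where "0 < M"
    "\<And>x x' r r'. \<lbrakk>0 < r; r \<le> r'; r' \<le> 2 * r; dist x x' \<le> r\<rbrakk> \<Longrightarrow>
      \<bar>ball_mean u x r - ball_mean u x' r'\<bar> \<le> M * r powr (\<delta> - real DIM('a) / p)"
proof -
  let ?V = "unit_ball_vol (real DIM('a))" and ?n = "real DIM('a)"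
  let ?s = "?n + \<delta> * p"
  have [measurable]: "ball z t \<in> sets borel" for z :: 'a and t by simp
  define m where "m r = ?V * r ^ DIM('a)" for r
  have V: "0 < ?V" by simp
  have s: "0 < ?s" using \<delta> p by (simp add: add_pos_pos)
  define M where "M = (4 powr ?s * (D + 1) / ?V\<^sup>2) powr (1 / p)"
  have M: "0 < M" using less_imp_neq[OF V] D by (simp add: M_def)
  have "\<bar>ball_mean u x r - ball_mean u x' r'\<bar> \<le> 2 * M * r powr (\<delta> - ?n / p)"
    if r: "0 < r" "r \<le> r'" "r' \<le> 2 * r" "dist x x' \<le> r" for x x' r r'
  proof -
    let ?A = "ball_mean u x r" and ?A' = "ball_mean u x' r'"
    have m: "0 < m r" "m r \<le> m r'" using r V by (auto simp: m_def intro!: power_mono)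
    then have m': "0 < m r'" by linarith
    define e where "e = M * r powr (\<delta> - ?n / p)"
    have e: "0 < e" using M r by (simp add: e_def)
    let ?I = "\<lambda>y. \<integral>\<^sup>+z. ennreal (\<bar>u z - u y\<bar> powr p) * indicator (ball x r) z \<partial>lborel"
    have inner: "ennreal (m r) * ennreal \<bar>u y - ?A\<bar> \<le> ennreal (e * m r) + ennreal (e powr (1 - p)) * ?I y" for y
      using ball_mean_deviation[OF assms(1) int r(1) e p, of x "u y"] m
      by (simp add: m_def abs_minus_commute ennreal_mult')
    have em: "emeasure lborel (ball x' r') = ennreal (m r')" using r by (simp add: m_def emeasure_ball)
    have "ennreal (m r * (m r' * \<bar>?A' - ?A\<bar>)) = ennreal (m r) * ennreal (m r' * \<bar>?A' - ?A\<bar>)"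
      using m by (simp add: ennreal_mult')
    also have "\<dots> \<le> ennreal (m r) * (\<integral>\<^sup>+y. ennreal \<bar>u y - ?A\<bar> * indicator (ball x' r') y \<partial>lborel)"
      using mean_deviation_le[OF int _ em m', of ?A]
      by (intro mult_left_mono) (auto simp: ball_mean_def[of u x' r'] m_def)
    also have "\<dots> = (\<integral>\<^sup>+y. ennreal (m r) * ennreal \<bar>u y - ?A\<bar> * indicator (ball x' r') y \<partial>lborel)"
      by (subst nn_integral_cmult[symmetric], measurable) (simp only: mult.assoc)
    also have "\<dots> \<le> (\<integral>\<^sup>+y. (ennreal (e * m r) + ennreal (e powr (1 - p)) * ?I y) * indicator (ball x' r') y \<partial>lborel)"
      by (intro nn_integral_mono mult_right_mono inner) auto
    also have "\<dots> = (\<integral>\<^sup>+y. ennreal (e * m r) * indicator (ball x' r') y + ennreal (e powr (1 - p)) * (?I y * indicator (ball x' r') y) \<partial>lborel)"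
      by (intro nn_integral_cong) (simp add: distrib_right mult.assoc)
    also have "\<dots> = ennreal (e * m r) * ennreal (m r') + ennreal (e powr (1 - p)) * (\<integral>\<^sup>+y. ?I y * indicator (ball x' r') y \<partial>lborel)"
      by (subst nn_integral_add) (auto simp: nn_integral_cmult nn_integral_cmult_indicator em)
    also have "(\<integral>\<^sup>+y. ?I y * indicator (ball x' r') y \<partial>lborel) \<le> ennreal ((4 * r) powr ?s) * energy \<delta> p u"
    proof -
      have pw: "ennreal (\<bar>u z - u y\<bar> powr p) * indicator (ball x r) z * indicator (ball x' r') y \<le>
        ennreal ((4 * r) powr ?s) * ennreal (\<bar>u y - u z\<bar> powr p / norm (y - z) powr ?s)" for y z
      proof (cases "z \<in> ball x r \<and> y \<in> ball x' r' \<and> y \<noteq> z")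
        case True
        have "dist y z \<le> dist y x' + dist x' x + dist x z"
          using dist_triangle[of y z x'] dist_triangle[of x' z x] by linarith
        also have "\<dots> \<le> r' + r + r" using True r by (auto simp: dist_commute)
        finally have "norm (y - z) \<le> 4 * r" using r by (simp add: dist_norm)
        then have "norm (y - z) powr ?s \<le> (4 * r) powr ?s" using s by (intro powr_mono2) auto
        then have "\<bar>u y - u z\<bar> powr p * norm (y - z) powr ?s \<le> (4 * r) powr ?s * \<bar>u y - u z\<bar> powr p"
          by (simp add: mult.commute mult_left_mono)
        then have "\<bar>u y - u z\<bar> powr p \<le> (4 * r) powr ?s * (\<bar>u y - u z\<bar> powr p / norm (y - z) powr ?s)"
          using True by (simp add: pos_le_divide_eq)
        then show ?thesis using True
          by (simp add: abs_minus_commute ennreal_leI flip: ennreal_mult')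
      qed (auto simp: indicator_def)
      have "(\<integral>\<^sup>+y. ?I y * indicator (ball x' r') y \<partial>lborel) =
         (\<integral>\<^sup>+y. (\<integral>\<^sup>+z. ennreal (\<bar>u z - u y\<bar> powr p) * indicator (ball x r) z * indicator (ball x' r') y \<partial>lborel) \<partial>lborel)"
        by (simp add: nn_integral_multc)
      also have "\<dots> \<le> (\<integral>\<^sup>+y. (\<integral>\<^sup>+z. ennreal ((4 * r) powr ?s) *
          ennreal (\<bar>u y - u z\<bar> powr p / norm (y - z) powr ?s) \<partial>lborel) \<partial>lborel)"
        by (intro nn_integral_mono pw)
      also have "\<dots> = ennreal ((4 * r) powr ?s) * energy \<delta> p u"
        unfolding energy_def by (simp add: nn_integral_cmult)
      finally show ?thesis .
    qed
    finally have "ennreal (m r * (m r' * \<bar>?A' - ?A\<bar>)) \<le>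
        ennreal (e * m r) * ennreal (m r') + ennreal (e powr (1 - p)) * (ennreal ((4 * r) powr ?s) * energy \<delta> p u)"
      by (auto simp: add_left_mono mult_left_mono)
    also have "\<dots> = ennreal (e * (m r * m r') + e powr (1 - p) * ((4 * r) powr ?s * D))"
      using m e D by (simp add: mult.assoc flip: ennreal_mult' ennreal_plus)
    finally have le: "m r * m r' * \<bar>?A' - ?A\<bar> \<le> e * (m r * m r') + e powr (1 - p) * ((4 * r) powr ?s * D)"
      using m m' e D by (subst (asm) ennreal_le_iff) (auto simp: mult.assoc)
    have "(4 * r) powr ?s * D \<le> (4 * r) powr ?s * (D + 1)" by (intro mult_left_mono) auto
    also have "\<dots> = e powr p * (m r)\<^sup>2"
    proof -
      have "e powr p = (4 powr ?s * (D + 1) / ?V\<^sup>2) * r powr (\<delta> * p - ?n)"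
        using M D p r V by (simp add: e_def M_def powr_mult powr_powr left_diff_distrib)
      moreover have "(m r)\<^sup>2 = ?V\<^sup>2 * r powr (2 * ?n)"
        unfolding m_def power2_eq_square mult_2 powr_add powr_realpow[OF r(1)] by (simp only: ac_simps)
      moreover have "r powr (\<delta> * p - ?n) * r powr (2 * ?n) = r powr ?s"
        by (simp flip: powr_add)
      ultimately show ?thesis using less_imp_neq[OF V] r by (simp add: powr_mult)
    qed
    also have "\<dots> \<le> e powr p * (m r * m r')"
      using m by (intro mult_left_mono) (auto simp: power2_eq_square)
    finally have "e powr (1 - p) * ((4 * r) powr ?s * D) \<le> e powr (1 - p) * (e powr p * (m r * m r'))"
      by (intro mult_left_mono) auto
    also have "\<dots> = e * (m r * m r')"
      using e by (simp add: mult.assoc[symmetric] flip: powr_add)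
    finally have "m r * m r' * \<bar>?A' - ?A\<bar> \<le> 2 * (e * (m r * m r'))" using le by linarith
    then have "(m r * m r') * \<bar>?A' - ?A\<bar> \<le> (m r * m r') * (2 * e)" by (simp only: ac_simps)
    then have "\<bar>?A' - ?A\<bar> \<le> 2 * e" using m m' by (subst (asm) mult_le_cancel_left_pos) auto
    then show ?thesis by (simp add: e_def abs_minus_commute)
  qed
  then show thesis using that[of "2 * M"] M by auto
qed

text \<open>
  The means over balls of radius \<open>2 ^ k\<close> converge to one constant \<open>c\<close>, at a rate that is uniform in the
  centre.  Once the radius \<open>R\<close> is so large that they are within \<open>e / 2\<close> of \<open>c\<close>, a point with
  \<open>\<bar>u x - c\<bar> > e\<close> has \<open>u x\<close> far from its own mean over \<open>ball x R\<close>, so the inner integral of the energy is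
  bounded below at \<open>x\<close>; Markov's inequality bounds the measure of these points.
\<close>
lemma finite_energy_limit:
  fixes u :: "'a::euclidean_space \<Rightarrow> real"
  assumes u[measurable]: "u \<in> borel_measurable borel"
    and int: "\<And>x r. set_integrable lborel (ball x r) u"
    and p: "1 \<le> p" and \<delta>: "0 < \<delta>" "\<delta> * p < real DIM('a)" and D: "energy \<delta> p u < \<infinity>"
  obtains c where "\<And>e. 0 < e \<Longrightarrow> emeasure lborel {x. e < \<bar>u x - c\<bar>} < \<infinity>"
proof -
  let ?V = "unit_ball_vol (real DIM('a))" and ?n = "real DIM('a)"
  let ?s = "?n + \<delta> * p"
  have V: "0 < ?V" by simp
  have s: "0 < ?s" using \<delta> p by (simp add: add_pos_pos)
  obtain D' where D': "energy \<delta> p u = ennreal D'" "0 \<le> D'" using D by (cases "energy \<delta> p u") auto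
  obtain M where M: "0 < M" and close: "\<And>x x' r r'. \<lbrakk>0 < r; r \<le> r'; r' \<le> 2 * r; dist x x' \<le> r\<rbrakk> \<Longrightarrow>
      \<bar>ball_mean u x r - ball_mean u x' r'\<bar> \<le> M * r powr (\<delta> - ?n / p)"
    using ball_means_close[OF u int p \<delta>(1) D'] by metis
  define q where "q = 2 powr (\<delta> - ?n / p)"
  have "\<delta> - ?n / p < 0" using \<delta> p by (simp add: field_simps)
  then have q: "0 < q" "q < 1" using powr_less_mono[of "\<delta> - ?n / p" 0 "2::real"] by (auto simp: q_def)
  have qk: "(2 ^ k) powr (\<delta> - ?n / p) = q ^ k" for k :: nat
    by (simp add: q_def powr_powr mult.commute flip: powr_realpow)
  define a where "a x k = ball_mean u x (2 ^ k)" for x :: 'a and k :: nat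
  have stp: "\<bar>a x k - a x (Suc k)\<bar> \<le> M * q ^ k" for x k
    using close[of "2 ^ k" "2 ^ Suc k" x x] by (simp add: a_def qk)
  have tail: "\<bar>a x J - a x (J + k)\<bar> \<le> M * q ^ J / (1 - q)" for x J k
  proof -
    have "\<bar>a x J - a x (J + k)\<bar> \<le> (\<Sum>i<k. M * q ^ (J + i))"
    proof (induction k)
      case (Suc k)
      then show ?case using stp[of x "J + k"] by simp
    qed simp
    also have "\<dots> = M * q ^ J * (\<Sum>i<k. q ^ i)" by (simp add: sum_distrib_left power_add mult.assoc)
    also have "\<dots> \<le> M * q ^ J * (1 / (1 - q))"
      using M q by (intro mult_left_mono) (auto simp: sum_gp_strict divide_right_mono)
    finally show ?thesis by simp
  qed
  have q0: "(\<lambda>k. K * q ^ k) \<longlonglongrightarrow> 0" for K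
    using q by (intro tendsto_mult_right_zero LIMSEQ_realpow_zero) auto
  have "Cauchy (a 0)"
  proof (rule metric_CauchyI)
    fix e :: real assume e: "0 < e"
    have "eventually (\<lambda>k. 2 * M / (1 - q) * q ^ k < e) sequentially"
      using order_tendstoD(2)[OF q0 e] .
    then obtain J where "2 * M / (1 - q) * q ^ J < e" by (auto simp: eventually_sequentially)
    then have J: "M * q ^ J / (1 - q) < e / 2" by (simp add: field_simps)
    have "dist (a 0 m) (a 0 k) < e" if "J \<le> m" "J \<le> k" for m k
    proof -
      have "\<bar>a 0 J - a 0 m\<bar> \<le> M * q ^ J / (1 - q)" "\<bar>a 0 J - a 0 k\<bar> \<le> M * q ^ J / (1 - q)"
        using tail[of 0 J "m - J"] tail[of 0 J "k - J"] that by simp_all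
      then show ?thesis using J unfolding dist_real_def by linarith
    qed
    then show "\<exists>J. \<forall>m\<ge>J. \<forall>k\<ge>J. dist (a 0 m) (a 0 k) < e" by blast
  qed
  then obtain c where c: "a 0 \<longlonglongrightarrow> c" by (auto simp: Cauchy_convergent_iff convergent_def)
  have ac: "\<bar>a x J - c\<bar> \<le> M * q ^ J / (1 - q)" for x J
  proof -
    have "eventually (\<lambda>k. \<bar>a x J - a 0 k\<bar> \<le> M * q ^ J / (1 - q) + M * q ^ k) sequentially"
    proof -
      obtain K :: nat where K: "dist x 0 < 2 ^ K" using real_arch_pow[of 2 "dist x 0"] by auto
      have "\<bar>a x J - a 0 k\<bar> \<le> M * q ^ J / (1 - q) + M * q ^ k" if k: "max J K \<le> k" for k
      proof -
        have "(2::real) ^ K \<le> 2 ^ k" using k by (intro power_increasing) auto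
        then have "dist x 0 \<le> 2 ^ k" using K by linarith
        then have "\<bar>a x k - a 0 k\<bar> \<le> M * q ^ k"
          using close[of "2 ^ k" "2 ^ k" x 0] by (simp add: a_def qk)
        moreover have "\<bar>a x J - a x k\<bar> \<le> M * q ^ J / (1 - q)" using tail[of x J "k - J"] k by simp
        ultimately show ?thesis by linarith
      qed
      then show ?thesis by (rule eventually_sequentiallyI)
    qed
    moreover have "(\<lambda>k. M * q ^ J / (1 - q) + M * q ^ k) \<longlonglongrightarrow> M * q ^ J / (1 - q) + 0"
      by (intro tendsto_add tendsto_const q0)
    moreover have "(\<lambda>k. \<bar>a x J - a 0 k\<bar>) \<longlonglongrightarrow> \<bar>a x J - c\<bar>"
      by (intro tendsto_intros c)
    ultimately have "\<bar>a x J - c\<bar> \<le> M * q ^ J / (1 - q) + 0"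
      by (intro tendsto_le[OF sequentially_bot]) auto
    then show ?thesis by simp
  qed
  let ?f = "\<lambda>x. \<integral>\<^sup>+y. ennreal (\<bar>u x - u y\<bar> powr p / norm (x - y) powr ?s) \<partial>lborel"
  have "emeasure lborel {x. e < \<bar>u x - c\<bar>} < \<infinity>" if e: "0 < e" for e
  proof -
    have "eventually (\<lambda>k. M / (1 - q) * q ^ k < e / 2) sequentially"
      by (rule order_tendstoD(2)[OF q0]) (use e in simp)
    then obtain J where "M / (1 - q) * q ^ J < e / 2" by (auto simp: eventually_sequentially)
    then have J: "M * q ^ J / (1 - q) < e / 2" by simp
    define R :: real where "R = 2 ^ J"
    have R: "0 < R" by (simp add: R_def)
    let ?m = "?V * R ^ DIM('a)"
    have m: "0 < ?m" using V R by simp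
    define \<kappa> where "\<kappa> = (e / 4) * ?m / ((e / 4) powr (1 - p) * R powr ?s)"
    have \<kappa>: "0 < \<kappa>" using e R m by (simp add: \<kappa>_def)
    have sub: "{x. e < \<bar>u x - c\<bar>} \<subseteq> {x \<in> UNIV. 1 \<le> ennreal (1 / \<kappa>) * ?f x}"
    proof safe
      fix x assume x: "e < \<bar>u x - c\<bar>"
      show "1 \<le> ennreal (1 / \<kappa>) * ?f x"
      proof (cases "?f x")
        case (real f)
        have "e / 2 \<le> \<bar>ball_mean u x R - u x\<bar>"
          using ac[of x J] J x unfolding a_def R_def by linarith
        then have "ennreal (?m * (e / 2)) \<le> ennreal (?m * \<bar>ball_mean u x R - u x\<bar>)"
          using m by (intro ennreal_leI mult_left_mono) auto
        also have "\<dots> \<le> ennreal (e / 4 * ?m) + ennreal ((e / 4) powr (1 - p)) *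
            (\<integral>\<^sup>+y. ennreal (\<bar>u y - u x\<bar> powr p) * indicator (ball x R) y \<partial>lborel)"
          using e by (intro ball_mean_deviation u int R p) auto
        also have "(\<integral>\<^sup>+y. ennreal (\<bar>u y - u x\<bar> powr p) * indicator (ball x R) y \<partial>lborel) \<le>
            (\<integral>\<^sup>+y. ennreal (R powr ?s) * ennreal (\<bar>u x - u y\<bar> powr p / norm (x - y) powr ?s) \<partial>lborel)"
        proof (intro nn_integral_mono)
          fix y
          show "ennreal (\<bar>u y - u x\<bar> powr p) * indicator (ball x R) y \<le>
            ennreal (R powr ?s) * ennreal (\<bar>u x - u y\<bar> powr p / norm (x - y) powr ?s)"
          proof (cases "y \<in> ball x R \<and> x \<noteq> y")
            case True
            then have "norm (x - y) powr ?s \<le> R powr ?s"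
              using s by (intro powr_mono2) (auto simp: dist_norm)
            then have "\<bar>u x - u y\<bar> powr p * norm (x - y) powr ?s \<le> R powr ?s * \<bar>u x - u y\<bar> powr p"
              by (simp add: mult.commute mult_left_mono)
            then have "\<bar>u x - u y\<bar> powr p \<le> R powr ?s * (\<bar>u x - u y\<bar> powr p / norm (x - y) powr ?s)"
              using True by (simp add: pos_le_divide_eq)
            then show ?thesis using True
              by (simp add: abs_minus_commute ennreal_leI flip: ennreal_mult')
          qed (auto simp: indicator_def)
        qed
        also have "\<dots> = ennreal (R powr ?s) * ?f x"
          by (rule nn_integral_cmult) measurable
        finally have "ennreal (?m * (e / 2)) \<le> ennreal (e / 4 * ?m) + ennreal ((e / 4) powr (1 - p)) * (ennreal (R powr ?s) * ?f x)"
          by (auto simp: add_left_mono mult_left_mono)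
        also have "\<dots> = ennreal (e / 4 * ?m + (e / 4) powr (1 - p) * (R powr ?s * f))"
          using real e m by (simp flip: ennreal_mult' ennreal_plus)
        finally have "?m * (e / 2) \<le> e / 4 * ?m + (e / 4) powr (1 - p) * (R powr ?s * f)"
          using real e m by (subst (asm) ennreal_le_iff) auto
        then have "(e / 4) * ?m \<le> ((e / 4) powr (1 - p) * R powr ?s) * f"
          by (simp add: algebra_simps)
        then have "\<kappa> \<le> f" unfolding \<kappa>_def using e R by (subst pos_divide_le_eq) (auto simp: mult.commute)
        then have "1 \<le> 1 / \<kappa> * f" using \<kappa> by simp
        then show ?thesis
          using real \<kappa> by (simp flip: ennreal_mult')
      next
        case top
        then show ?thesis using \<kappa> by (simp add: ennreal_mult_top)
      qed
    qed simp
    have "emeasure lborel {x. e < \<bar>u x - c\<bar>} \<le> emeasure lborel {x \<in> UNIV. 1 \<le> ennreal (1 / \<kappa>) * ?f x}"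
      using sub by (rule emeasure_mono) measurable
    also have "\<dots> \<le> ennreal (1 / \<kappa>) * (\<integral>\<^sup>+x. ?f x * indicator UNIV x \<partial>lborel)"
      by (rule nn_integral_Markov_inequality) auto
    also have "\<dots> = ennreal (1 / \<kappa>) * energy \<delta> p u" by (simp add: energy_def)
    also have "\<dots> < \<infinity>" using D by (simp add: ennreal_mult_less_top)
    finally show ?thesis .
  qed
  then show thesis using that by blast
qed

section \<open>The vanishing mean class\<close>

text \<open>
  An interval between \<open>{b <..< b + l}\<close> and \<open>{b .. b + l}\<close> differs from the open one by at most two
  points, whence the measurability.
\<close>
lemma is_cubeE:
  fixes Q :: "(real ^ 'n) set"
  assumes "is_cube l Q"
  obtains a :: "real ^ 'n" where "0 < l" "box a (a + (\<chi> i. l)) \<subseteq> Q" "Q \<subseteq> cbox a (a + (\<chi> i. l))" "Q \<in> sets borel"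
proof -
  obtain I b where Q: "0 < l" "Q = {x. \<forall>i. x $ i \<in> I i}"
    and I: "\<And>i. {b i <..< b i + l} \<subseteq> I i" "\<And>i. I i \<subseteq> {b i .. b i + l}"
    using assms unfolding is_cube_def by blast
  have Im: "I i \<in> sets borel" for i
  proof -
    have "I i = {b i <..< b i + l} \<union> (I i \<inter> {b i, b i + l})"
      using I[of i] by (auto simp: less_le)
    moreover have "finite (I i \<inter> {b i, b i + l})" by simp
    ultimately show ?thesis
      by (metis borel_open finite_imp_closed borel_closed open_greaterThanLessThan sets.Un)
  qed
  have "Q = (\<Inter>i. (\<lambda>x. x $ i) -` I i \<inter> space borel)" by (auto simp: Q)
  also have "\<dots> \<in> sets borel"
    using Im by (intro sets.finite_INT measurable_sets[of _ borel borel]) auto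
  finally have "Q \<in> sets borel" .
  moreover have "box (\<chi> i. b i) ((\<chi> i. b i) + (\<chi> i. l)) \<subseteq> Q"
    using I(1) by (auto simp: Q mem_box_cart subset_iff)
  moreover have "Q \<subseteq> cbox (\<chi> i. b i) ((\<chi> i. b i) + (\<chi> i. l))"
  proof -
    have "b i \<le> t \<and> t \<le> b i + l" if "t \<in> I i" for t i using I(2)[of i] that by auto
    then show ?thesis by (auto simp: Q mem_box_cart)
  qed
  ultimately show thesis using that Q(1) by blast
qed

lemma locally_integrable_measurable:
  fixes u :: "'a::euclidean_space \<Rightarrow> real"
  assumes "locally_integrable lebesgue u"
  shows "u \<in> borel_measurable lebesgue"
proof -
  have "(\<lambda>x. indicator (cball 0 (real k)) x *\<^sub>R u x) \<in> borel_measurable lebesgue" for k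
  proof -
    have "set_integrable lebesgue (cball 0 (real k)) u"
      using assms unfolding locally_integrable_def by (simp del: set_integrable_def)
    then show ?thesis unfolding set_integrable_def by (rule borel_measurable_integrable)
  qed
  moreover have "(\<lambda>k. indicator (cball 0 (real k)) x *\<^sub>R u x) \<longlonglongrightarrow> u x" for x
  proof -
    obtain K where K: "norm x \<le> real K" using real_arch_simple by blast
    have "eventually (\<lambda>k. indicator (cball 0 (real k)) x *\<^sub>R u x = u x) sequentially"
      using K by (intro eventually_sequentiallyI[of K]) (auto simp: indicator_def)
    then show ?thesis by (rule tendsto_eventually)
  qed
  ultimately show ?thesis
    by (rule borel_measurable_LIMSEQ_metric)
qed

text \<open>
  In absolute value the \<open>w\<close>-mean of \<open>u - c\<close> over \<open>Q j\<close> is at most \<open>e + e powr (1 - p) * P / m j\<close>, where \<open>P\<close> is the integral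
  of \<open>\<bar>u - c\<bar> powr p\<close> against \<open>w\<close> and the mass \<open>m j\<close> of \<open>Q j\<close> tends to infinity.  So the means of \<open>u\<close> tend
  to \<open>c\<close>.  The masses must be finite for this, since the mean over a cube of infinite mass is \<open>0\<close> by
  convention; if \<open>c \<noteq> 0\<close>, finiteness follows from the local integrability of \<open>u\<close>.
\<close>
lemma vanishing_mean_constant_eq_0:
  fixes w :: "real ^ 'n \<Rightarrow> ennreal"
  assumes w[measurable]: "w \<in> borel_measurable borel" and inf: "(\<integral>\<^sup>+x. w x \<partial>lborel) = \<infinity>"
    and p: "1 \<le> p" and u: "u \<in> vanishing_mean_class w"
    and fin: "(\<integral>\<^sup>+x. ennreal (\<bar>u x - c\<bar> powr p) * w x \<partial>lborel) < \<infinity>"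
  shows "c = 0"
proof (rule ccontr)
  assume c: "c \<noteq> 0"
  let ?N = "density lebesgue w"
  obtain Q where Q: "incseq Q" "\<And>j. \<exists>l. is_cube l (Q j)" "(\<Union>j. Q j) = UNIV"
    and lim: "(\<lambda>j. (1 / measure ?N (Q j)) * (LINT x:Q j|?N. u x)) \<longlonglongrightarrow> 0"
    using u unfolding vanishing_mean_class_def by blast
  have um[measurable]: "u \<in> borel_measurable lebesgue"
    using u by (intro locally_integrable_measurable) (auto simp: vanishing_mean_class_def)
  have wm[measurable]: "w \<in> borel_measurable lebesgue"
    using measurable_completion[of w lborel borel] w by simp
  have Qm[measurable]: "Q j \<in> sets lebesgue" for j
    using Q(2)[of j] by (auto elim!: is_cubeE)
  have intu: "set_integrable ?N (Q j) u" for j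
  proof -
    obtain l a where "Q j \<subseteq> cbox a (a + (\<chi> i. l))" using Q(2)[of j] by (auto elim!: is_cubeE)
    moreover have "set_integrable ?N (cbox a (a + (\<chi> i. l))) u"
      using u by (auto simp: vanishing_mean_class_def locally_integrable_def)
    ultimately show ?thesis using set_integrable_subset[of ?N _ u "Q j"] by auto
  qed
  have "(\<integral>\<^sup>+x. ennreal (\<bar>u x - c\<bar> powr p) \<partial>?N) = (\<integral>\<^sup>+x. ennreal (\<bar>u x - c\<bar> powr p) * w x \<partial>lborel)"
    by (simp add: nn_integral_density nn_integral_completion mult.commute)
  then have "(\<integral>\<^sup>+x. ennreal (\<bar>u x - c\<bar> powr p) \<partial>?N) < \<infinity>" using fin by simp
  then obtain P where P: "(\<integral>\<^sup>+x. ennreal (\<bar>u x - c\<bar> powr p) \<partial>?N) = ennreal P" "0 \<le> P"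
    by (cases "\<integral>\<^sup>+x. ennreal (\<bar>u x - c\<bar> powr p) \<partial>?N") auto
  have finQ: "emeasure ?N (Q j) < \<infinity>" for j
  proof -
    \<comment> \<open>At every point one of \<open>\<bar>u\<bar>\<close> and \<open>\<bar>u - c\<bar>\<close> is at least \<open>\<bar>c\<bar> / 2\<close>.\<close>
    have pw: "indicator (Q j) x \<le> ennreal (2 / \<bar>c\<bar>) * ennreal (norm (indicator (Q j) x *\<^sub>R u x)) +
        ennreal ((2 / \<bar>c\<bar>) powr p) * ennreal (\<bar>u x - c\<bar> powr p)" for x
    proof (cases "x \<in> Q j")
      case True
      have "1 \<le> 2 / \<bar>c\<bar> * \<bar>u x\<bar> + (2 / \<bar>c\<bar>) powr p * \<bar>u x - c\<bar> powr p"
      proof (cases "\<bar>c\<bar> / 2 \<le> \<bar>u x\<bar>")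
        case True
        then have "1 \<le> 2 / \<bar>c\<bar> * \<bar>u x\<bar>" using c by (simp add: field_simps)
        then show ?thesis by (simp add: add_increasing2)
      next
        case False
        moreover have "\<bar>c\<bar> \<le> \<bar>u x\<bar> + \<bar>u x - c\<bar>" by linarith
        ultimately have "1 \<le> 2 / \<bar>c\<bar> * \<bar>u x - c\<bar>" using c by (simp add: field_simps)
        then have "1 \<le> (2 / \<bar>c\<bar> * \<bar>u x - c\<bar>) powr p" using p by (intro ge_one_powr_ge_zero) auto
        then have "1 \<le> (2 / \<bar>c\<bar>) powr p * \<bar>u x - c\<bar> powr p" by (subst powr_mult[symmetric]) auto
        then show ?thesis by (simp add: add_increasing)
      qed
      then have "ennreal 1 \<le> ennreal (2 / \<bar>c\<bar> * \<bar>u x\<bar> + (2 / \<bar>c\<bar>) powr p * \<bar>u x - c\<bar> powr p)"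
        by (rule ennreal_leI)
      then show ?thesis using True by (simp flip: ennreal_mult' ennreal_plus)
    qed simp
    have "emeasure ?N (Q j) = (\<integral>\<^sup>+x. indicator (Q j) x \<partial>?N)" by simp
    also have "\<dots> \<le> (\<integral>\<^sup>+x. ennreal (2 / \<bar>c\<bar>) * ennreal (norm (indicator (Q j) x *\<^sub>R u x)) +
        ennreal ((2 / \<bar>c\<bar>) powr p) * ennreal (\<bar>u x - c\<bar> powr p) \<partial>?N)"
      by (intro nn_integral_mono pw)
    also have "\<dots> = ennreal (2 / \<bar>c\<bar>) * (\<integral>\<^sup>+x. ennreal (norm (indicator (Q j) x *\<^sub>R u x)) \<partial>?N) +
        ennreal ((2 / \<bar>c\<bar>) powr p) * ennreal P"
      by (subst nn_integral_add) (auto simp: nn_integral_cmult P)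
    also have "\<dots> < \<infinity>"
      using intu[of j] unfolding set_integrable_def integrable_iff_bounded
      by (simp add: ennreal_mult_less_top)
    finally show ?thesis .
  qed
  define m where "m j = measure ?N (Q j)" for j
  have m: "emeasure ?N (Q j) = ennreal (m j)" for j
    unfolding m_def using finQ[of j] by (intro emeasure_eq_ennreal_measure) auto
  have "emeasure ?N UNIV = \<infinity>"
    using inf by (subst emeasure_density) (auto simp: nn_integral_completion)
  then have "(\<lambda>j. emeasure ?N (Q j)) \<longlonglongrightarrow> \<infinity>"
    using Lim_emeasure_incseq[OF _ Q(1), of ?N] Q(3) Qm by (auto simp: image_subset_iff)
  then have mlim: "eventually (\<lambda>j. K < m j) sequentially" for K
  proof -
    have "eventually (\<lambda>j. ennreal K < emeasure ?N (Q j)) sequentially"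
      by (rule order_tendstoD(1)) (use \<open>(\<lambda>j. emeasure ?N (Q j)) \<longlonglongrightarrow> \<infinity>\<close> in auto)
    then show ?thesis unfolding m by (rule eventually_mono) (metis ennreal_leI not_le)
  qed
  define e where "e = \<bar>c\<bar> / 4"
  have e: "0 < e" using c by (simp add: e_def)
  have "eventually (\<lambda>j. \<bar>(1 / m j) * (LINT x:Q j|?N. u x)\<bar> < e) sequentially"
    using tendstoD[OF lim e] by (simp add: m_def dist_real_def)
  with mlim[of "max 0 (e powr (1 - p) * P / e)"]
  have "eventually (\<lambda>j. False) sequentially"
  proof eventually_elim
    case (elim j)
    then have mj: "0 < m j" "e powr (1 - p) * P < e * m j"
      using e by (auto simp: field_simps)
    let ?a = "(LINT x:Q j|?N. u x) / m j"
    have "ennreal (m j * \<bar>?a - c\<bar>) \<le> (\<integral>\<^sup>+x. ennreal \<bar>u x - c\<bar> * indicator (Q j) x \<partial>?N)"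
      by (intro mean_deviation_le intu m mj) auto
    also have "\<dots> \<le> ennreal (e * m j) + ennreal (e powr (1 - p)) * (\<integral>\<^sup>+x. ennreal (\<bar>u x - c\<bar> powr p) * indicator (Q j) x \<partial>?N)"
      using mj e p m by (intro nn_integral_le_young) auto
    also have "(\<integral>\<^sup>+x. ennreal (\<bar>u x - c\<bar> powr p) * indicator (Q j) x \<partial>?N) \<le> ennreal P"
      unfolding P(1)[symmetric] by (intro nn_integral_mono) (auto simp: indicator_def)
    finally have "ennreal (m j * \<bar>?a - c\<bar>) \<le> ennreal (e * m j) + ennreal (e powr (1 - p)) * ennreal P"
      by (auto simp: add_left_mono mult_left_mono)
    then have "m j * \<bar>?a - c\<bar> \<le> e * m j + e powr (1 - p) * P"
      using e mj P by (simp flip: ennreal_mult' ennreal_plus)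
    then have "m j * \<bar>?a - c\<bar> < 2 * (e * m j)" using mj by linarith
    then have "m j * \<bar>?a - c\<bar> < m j * (2 * e)" by (simp only: ac_simps)
    then have "\<bar>?a - c\<bar> < 2 * e" using mj(1) by (simp only: mult_less_cancel_left_pos)
    moreover have "\<bar>?a\<bar> < e" using elim by simp
    ultimately show False using c unfolding e_def by linarith
  qed
  then show False by simp
qed

lemma borel_representative:
  fixes u :: "real ^ 'n \<Rightarrow> real"
  assumes u: "locally_integrable lebesgue u"
  obtains v where "v \<in> borel_measurable borel" "AE x in lborel. u x = v x"
    "\<And>x r. set_integrable lborel (ball x r) v" "gagliardo_energy \<delta> p u = energy \<delta> p v"
proof -
  note um = locally_integrable_measurable[OF u]
  obtain v where v[measurable]: "v \<in> borel_measurable borel" and uv: "AE x in lborel. u x = v x"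
    using completion_ex_borel_measurable_real[OF um] by auto
  have "set_integrable lborel (ball x r) v" for x r
  proof -
    have bv: "(\<lambda>y. indicator (ball x r) y *\<^sub>R v y) \<in> borel_measurable lborel"
      by (intro borel_measurable_scaleR borel_measurable_indicator) auto
    have "set_integrable lebesgue (cball x r) u" using u by (auto simp: locally_integrable_def)
    then have "set_integrable lebesgue (ball x r) u"
      by (rule set_integrable_subset) auto
    then have "integrable lebesgue (\<lambda>y. indicator (ball x r) y *\<^sub>R v y)"
      unfolding set_integrable_def
    proof (rule integrable_cong_AE_imp)
      show "AE y in lebesgue. indicator (ball x r) y *\<^sub>R u y = indicator (ball x r) y *\<^sub>R v y"
        using AE_completion[OF uv] by eventually_elim simp
      show "(\<lambda>y. indicator (ball x r) y *\<^sub>R v y) \<in> borel_measurable lebesgue"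
        by (intro measurable_completion bv)
    qed
    then show ?thesis
      unfolding set_integrable_def by (subst (asm) integrable_completion[OF bv])
  qed
  moreover have "gagliardo_energy \<delta> p u = energy \<delta> p v"
    unfolding gagliardo_energy_def energy_def nn_integral_completion
  proof (intro nn_integral_cong_AE)
    show "AE x in lborel. (\<integral>\<^sup>+ y. ennreal (\<bar>u x - u y\<bar> powr p / norm (x - y) powr (real CARD('n) + \<delta> * p)) \<partial>lborel) =
      (\<integral>\<^sup>+ y. ennreal (\<bar>v x - v y\<bar> powr p / norm (x - y) powr (real DIM(real ^ 'n) + \<delta> * p)) \<partial>lborel)"
      using uv
    proof eventually_elim
      case (elim x)
      show ?case
        using uv by (intro nn_integral_cong_AE) (auto elim!: eventually_mono simp: elim)
    qed
  qed
  ultimately show thesis using that v uv by blast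
qed

text \<open>
  The inequality holds for \<open>u - c\<close> with the constant \<open>c\<close> of \<open>finite_energy_limit\<close>, and its left side is
  then finite, which forces \<open>c = 0\<close>.
\<close>
theorem weak_type_weighted_inequality:
  fixes u :: "real ^ 'n \<Rightarrow> real" and w :: "real ^ 'n \<Rightarrow> ennreal"
  defines "V \<equiv> unit_ball_vol (real CARD('n))"
  assumes p: "1 \<le> p" and \<delta>: "0 < \<delta>" "\<delta> < 1" and \<theta>eq: "\<theta> = \<delta> * p / real CARD('n)" and \<theta>: "\<theta> < 1"
    and w: "weak_type_weight \<theta> A w" and A: "0 < A" and inf: "(\<integral>\<^sup>+x. w x \<partial>lborel) = \<infinity>"
    and u: "u \<in> vanishing_mean_class w"
  shows "(\<integral>\<^sup>+x. ennreal (\<bar>u x\<bar> powr p) * w x \<partial>lebesgue) \<le>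
    ennreal (exp 3 * A * ((4 / V) powr (1 + \<theta>) * ((1 - \<delta>) * p)) * (p / (1 - \<theta>)) powr p) * gagliardo_energy \<delta> p u"
proof -
  define K where "K = exp 3 * A * ((4 / V) powr (1 + \<theta>) * ((1 - \<delta>) * p)) * (p / (1 - \<theta>)) powr p"
  have V: "0 < V" unfolding V_def by simp
  have K: "0 < K" using A V \<delta> p \<theta> by (simp add: K_def)
  note wm[measurable] = w[unfolded weak_type_weight_def, THEN conjunct1]
  have loc: "locally_integrable lebesgue u" using u by (simp add: vanishing_mean_class_def)
  obtain v where v[measurable]: "v \<in> borel_measurable borel" and uv: "AE x in lborel. u x = v x"
    and int: "\<And>x r. set_integrable lborel (ball x r) v" and en: "gagliardo_energy \<delta> p u = energy \<delta> p v"
    using borel_representative[OF loc, of \<delta> p] by metis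
  have "(\<integral>\<^sup>+x. ennreal (\<bar>u x\<bar> powr p) * w x \<partial>lebesgue) \<le> ennreal K * gagliardo_energy \<delta> p u"
  proof (cases "energy \<delta> p v")
    case top
    then show ?thesis using K by (simp add: en ennreal_mult_top)
  next
    case (real D)
    have "\<delta> * p < real DIM(real ^ 'n)" using \<theta> by (simp add: \<theta>eq)
    then obtain c where c: "\<And>e. 0 < e \<Longrightarrow> emeasure lborel {x. e < \<bar>v x - c\<bar>} < \<infinity>"
      using finite_energy_limit[OF v int p \<delta>(1)] real by auto
    have "energy \<delta> p (\<lambda>x. v x - c) = ennreal D" using real by (simp add: energy_def)
    then have "(\<integral>\<^sup>+x. ennreal (\<bar>v x - c\<bar> powr p) * w x \<partial>lborel) \<le>
        ennreal (exp 3 * A * ((4 / V) powr (1 + \<theta>) * ((1 - \<delta>) * p) * D) * (p / (1 - \<theta>)) powr p)"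
      unfolding V_def using weighted_bound_finite_levels[of "\<lambda>x. v x - c" p \<delta> \<theta> A w D] p \<delta> \<theta>eq \<theta> w A c real by simp
    also have "\<dots> = ennreal K * ennreal D" using real K by (simp add: K_def ac_simps flip: ennreal_mult')
    finally have bound: "(\<integral>\<^sup>+x. ennreal (\<bar>v x - c\<bar> powr p) * w x \<partial>lborel) \<le> ennreal K * ennreal D" .
    have eq: "(\<integral>\<^sup>+x. ennreal (\<bar>u x - c\<bar> powr p) * w x \<partial>lborel) = (\<integral>\<^sup>+x. ennreal (\<bar>v x - c\<bar> powr p) * w x \<partial>lborel)"
      using uv by (intro nn_integral_cong_AE) (auto elim!: eventually_mono)
    have "c = 0"
      by (rule vanishing_mean_constant_eq_0[OF wm inf p u])
         (use bound eq in \<open>auto simp: ennreal_mult_less_top intro: le_less_trans\<close>)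
    then show ?thesis using bound eq by (simp add: nn_integral_completion en real)
  qed
  then show ?thesis unfolding K_def .
qed

lemma lborel_ae_filter_nontrivial: "ae_filter (lborel :: 'a::euclidean_space measure) \<noteq> bot"
proof
  assume bot: "ae_filter (lborel :: 'a measure) = bot"
  have "AE x in (lborel :: 'a measure). False" unfolding bot by (rule eventually_bot)
  then have "emeasure lborel (UNIV :: 'a set) = 0"
    by (subst (asm) AE_iff_measurable[OF _ refl]) auto
  then show False by simp
qed

text \<open>
  This settles measures \<open>\<mu>\<close> of infinite total mass, for which the product on the right of the
  inequality is infinite unless the energy vanishes.
\<close>
lemma zero_energy_imp_AE_zero:
  fixes u :: "real ^ 'n \<Rightarrow> real" and w :: "real ^ 'n \<Rightarrow> ennreal"
  assumes w: "w \<in> borel_measurable borel" and inf: "(\<integral>\<^sup>+x. w x \<partial>lborel) = \<infinity>" and p: "1 \<le> p"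
    and u: "u \<in> vanishing_mean_class w" and D: "gagliardo_energy \<delta> p u = 0"
  shows "AE x in lborel. u x = 0"
proof -
  have loc: "locally_integrable lebesgue u" using u by (simp add: vanishing_mean_class_def)
  obtain v where v[measurable]: "v \<in> borel_measurable borel" and uv: "AE x in lborel. u x = v x"
    and en: "gagliardo_energy \<delta> p u = energy \<delta> p v"
    using borel_representative[OF loc, of \<delta> p] by metis
  have "energy \<delta> p v = 0" using D en by simp
  then have "AE x in lborel. (\<integral>\<^sup>+y. ennreal (\<bar>v x - v y\<bar> powr p / norm (x - y) powr (real DIM(real ^ 'n) + \<delta> * p)) \<partial>lborel) = 0"
    unfolding energy_def by (subst (asm) nn_integral_0_iff_AE) auto
  then have "\<exists>x. (\<integral>\<^sup>+y. ennreal (\<bar>v x - v y\<bar> powr p / norm (x - y) powr (real DIM(real ^ 'n) + \<delta> * p)) \<partial>lborel) = 0"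
    by (rule eventually_happens'[OF lborel_ae_filter_nontrivial])
  then obtain x where "(\<integral>\<^sup>+y. ennreal (\<bar>v x - v y\<bar> powr p / norm (x - y) powr (real DIM(real ^ 'n) + \<delta> * p)) \<partial>lborel) = 0" ..
  then have "AE y in lborel. ennreal (\<bar>v x - v y\<bar> powr p / norm (x - y) powr (real DIM(real ^ 'n) + \<delta> * p)) = 0"
    by (subst (asm) nn_integral_0_iff_AE) auto
  then have c: "AE y in lborel. u y = v x"
    using uv by eventually_elim (auto simp: divide_le_0_iff)
  have "(\<integral>\<^sup>+y. ennreal (\<bar>u y - v x\<bar> powr p) * w y \<partial>lborel) = (\<integral>\<^sup>+y. 0 \<partial>(lborel :: (real ^ 'n) measure))"
    using c by (intro nn_integral_cong_AE) (auto elim!: eventually_mono)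
  then have "v x = 0"
    by (intro vanishing_mean_constant_eq_0[OF w inf p u]) simp
  then show ?thesis using c by simp
qed

section \<open>The fractional maximal function\<close>

definition open_cube :: "real ^ 'n \<Rightarrow> real \<Rightarrow> (real ^ 'n) set" where
  "open_cube c h = box (c - (\<chi> i. h)) (c + (\<chi> i. h))"

lemma mem_open_cube: "x \<in> open_cube c h \<longleftrightarrow> (\<forall>i. \<bar>x $ i - c $ i\<bar> < h)"
  by (auto simp: open_cube_def mem_box_cart abs_less_iff algebra_simps)

lemma open_cube_sets [measurable]: "open_cube c h \<in> sets borel"
  by (simp add: open_cube_def)

lemma is_cube_open_cube:
  assumes "0 < h"
  shows "is_cube (2 * h) (open_cube c h)"
  unfolding is_cube_def
proof (intro conjI exI)
  have "c $ i - h + 2 * h = c $ i + h" for i by simp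
  then show "open_cube c h = {x. \<forall>i. x $ i \<in> {c $ i - h <..< c $ i - h + 2 * h}}"
    unfolding open_cube_def by (auto simp only: mem_box_cart) (auto simp: mem_box_cart)
  show "\<forall>i. {c $ i - h<..<c $ i - h + 2 * h} \<subseteq> {c $ i - h<..<c $ i - h + 2 * h} \<and>
      {c $ i - h<..<c $ i - h + 2 * h} \<subseteq> {c $ i - h..c $ i - h + 2 * h}"
    by auto
qed (use assms in simp)

lemma open_cube_subset_cball: "open_cube c h \<subseteq> cball (c :: real ^ 'n) (real CARD('n) * h)"
proof
  fix x assume x: "x \<in> open_cube c h"
  have "norm (x - c) \<le> (\<Sum>i\<in>UNIV. \<bar>(x - c) $ i\<bar>)" by (rule norm_le_l1_cart)
  also have "\<dots> \<le> (\<Sum>i\<in>(UNIV :: 'n set). h)"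
    using x by (intro sum_mono) (auto simp: mem_open_cube less_imp_le)
  finally show "x \<in> cball c (real CARD('n) * h)" by (simp add: dist_norm norm_minus_commute)
qed

lemma emeasure_is_cube:
  fixes Q :: "(real ^ 'n) set"
  assumes "is_cube l Q"
  shows "emeasure lebesgue Q = ennreal (l ^ CARD('n))"
proof -
  obtain a :: "real ^ 'n" where l: "0 < l" and Q: "box a (a + (\<chi> i. l)) \<subseteq> Q" "Q \<subseteq> cbox a (a + (\<chi> i. l))" "Q \<in> sets borel"
    using is_cubeE[OF assms] by blast
  have comp: "(\<chi> i. l) \<bullet> b = l" if "b \<in> Basis" for b :: "real ^ 'n"
    using that by (auto simp: Basis_vec_def inner_axis)
  have le: "a \<bullet> b \<le> (a + (\<chi> i. l)) \<bullet> b" if "b \<in> Basis" for b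
    using l comp[OF that] by (simp add: inner_add_left)
  have prod: "(\<Prod>b\<in>Basis. ((a + (\<chi> i. l)) - a) \<bullet> b) = l ^ CARD('n)"
    by (simp add: comp)
  have "ennreal (l ^ CARD('n)) \<le> emeasure lborel Q"
    using emeasure_mono[OF Q(1), of lborel] Q(3) by (simp add: emeasure_lborel_box[OF le] prod[simplified])
  moreover have "emeasure lborel Q \<le> ennreal (l ^ CARD('n))"
    using emeasure_mono[OF Q(2), of lborel] by (simp add: emeasure_lborel_cbox[OF le] prod[simplified])
  ultimately show ?thesis using Q(3) by (simp add: antisym)
qed

text \<open>
  A cube of side \<open>l\<close> has volume \<open>l ^ n\<close>, so the power of the side left in front is \<open>- s\<close>.
\<close>
lemma frac_maximal_term:
  fixes R :: "(real ^ 'n) set"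
  assumes "is_cube l R"
  shows "ennreal (l powr (real CARD('n) - s)) * (emeasure \<mu> R / emeasure lebesgue R) =
    ennreal (l powr (- s)) * emeasure \<mu> R"
proof -
  have l: "0 < l" using assms by (simp add: is_cube_def)
  have "emeasure \<mu> R / emeasure lebesgue R = ennreal (1 / l ^ CARD('n)) * emeasure \<mu> R"
    using l by (simp add: emeasure_is_cube[OF assms] divide_ennreal_def inverse_ennreal mult.commute divide_inverse)
  moreover have "l powr (real CARD('n) - s) * (1 / l ^ CARD('n)) = l powr (- s)"
    using l by (simp add: powr_diff powr_realpow powr_minus_divide)
  ultimately show ?thesis using l by (simp add: mult.assoc[symmetric] flip: ennreal_mult')
qed

text \<open>
  Open cubes suffice in the supremum.  The superlevel sets of the maximal function are therefore
  unions of open cubes.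
\<close>
lemma less_frac_maximal_iff:
  fixes \<mu> :: "(real ^ 'n) measure"
  assumes \<mu>: "sets \<mu> = sets borel"
  shows "t < frac_maximal (real CARD('n) - s) \<mu> x \<longleftrightarrow>
    (\<exists>c h. 0 < h \<and> x \<in> open_cube c h \<and> t < ennreal ((2 * h) powr (- s)) * emeasure \<mu> (open_cube c h))"
    (is "?L \<longleftrightarrow> ?R")
proof
  assume ?R
  then obtain c h where "0 < h" "x \<in> open_cube c h" "t < ennreal ((2 * h) powr (- s)) * emeasure \<mu> (open_cube c h)"
    by blast
  moreover from this have "t < ennreal ((2 * h) powr (real CARD('n) - s)) *
      (emeasure \<mu> (open_cube c h) / emeasure lebesgue (open_cube c h))"
    by (simp only: frac_maximal_term[OF is_cube_open_cube])
  ultimately show ?L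
    unfolding frac_maximal_def less_SUP_iff
    by (intro bexI[of _ "(2 * h, open_cube c h)"]) (auto simp: is_cube_open_cube)
next
  assume ?L
  then obtain l R where R: "is_cube l R" "x \<in> R" "t < ennreal (l powr (- s)) * emeasure \<mu> R"
    unfolding frac_maximal_def less_SUP_iff by (auto simp: frac_maximal_term)
  then obtain a where l: "0 < l" "R \<subseteq> cbox a (a + (\<chi> i. l))" by (auto elim: is_cubeE)
  \<comment> \<open>A slightly larger open cube still exceeds \<open>t\<close>, the factor in front being continuous in the side.\<close>
  have "\<exists>e>0. t < ennreal ((l + 2 * e) powr (- s)) * emeasure \<mu> R"
  proof (cases "emeasure \<mu> R")
    case (real r)
    have "(\<lambda>k. (l + 2 * (1 / real (Suc k))) powr (- s) * r) \<longlonglongrightarrow> (l + 2 * 0) powr (- s) * r"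
      using l by (intro tendsto_intros LIMSEQ_Suc lim_1_over_n) auto
    then have "(\<lambda>k. ennreal ((l + 2 * (1 / real (Suc k))) powr (- s) * r)) \<longlonglongrightarrow> ennreal (l powr (- s) * r)"
      by (intro tendsto_ennrealI) simp
    then have "eventually (\<lambda>k. t < ennreal ((l + 2 * (1 / real (Suc k))) powr (- s) * r)) sequentially"
      by (rule order_tendstoD(1)) (use R(3) real in \<open>simp add: ennreal_mult'\<close>)
    then obtain k where "t < ennreal ((l + 2 * (1 / real (Suc k))) powr (- s) * r)"
      by (auto simp: eventually_sequentially)
    then show ?thesis using real
      by (intro exI[of _ "1 / real (Suc k)"]) (simp add: ennreal_mult')
  next
    case top
    have "t < top" using R(3) by (rule less_le_trans) simp
    then show ?thesis using top l by (intro exI[of _ 1]) (simp add: ennreal_mult_top)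
  qed
  then obtain e where e: "0 < e" "t < ennreal ((l + 2 * e) powr (- s)) * emeasure \<mu> R" by blast
  let ?Q = "open_cube (a + (\<chi> i. l / 2)) (l / 2 + e)"
  have sub: "R \<subseteq> ?Q"
  proof
    fix y assume "y \<in> R"
    then have y: "a $ i \<le> y $ i \<and> y $ i \<le> a $ i + l" for i using l(2) by (auto simp: mem_box_cart)
    show "y \<in> ?Q" unfolding mem_open_cube
    proof
      fix i show "\<bar>y $ i - (a + (\<chi> i. l / 2)) $ i\<bar> < l / 2 + e"
        using y[of i] e(1) by (simp add: abs_less_iff)
    qed
  qed
  have "emeasure \<mu> R \<le> emeasure \<mu> ?Q" using sub by (rule emeasure_mono) (simp add: \<mu> open_cube_sets)
  then have "t < ennreal ((2 * (l / 2 + e)) powr (- s)) * emeasure \<mu> ?Q"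
    using e(2) mult_left_mono[of "emeasure \<mu> R" "emeasure \<mu> ?Q" "ennreal ((l + 2 * e) powr (- s))"]
    by (simp add: distrib_left)
  moreover have "0 < l / 2 + e" using l e by simp
  moreover have "x \<in> ?Q" using R(2) sub by blast
  ultimately show ?R by blast
qed

lemma frac_maximal_measurable:
  fixes \<mu> :: "(real ^ 'n) measure"
  assumes \<mu>: "sets \<mu> = sets borel"
  shows "frac_maximal (real CARD('n) - s) \<mu> \<in> borel_measurable borel"
proof (rule borel_measurableI_greater)
  fix t
  have "{x. t < frac_maximal (real CARD('n) - s) \<mu> x} =
    (\<Union>(c, h)\<in>{(c, h). 0 < h \<and> t < ennreal ((2 * h) powr (- s)) * emeasure \<mu> (open_cube c h)}. open_cube c h)"
    unfolding less_frac_maximal_iff[OF \<mu>] by blast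
  also have "open \<dots>" by (auto simp: open_cube_def)
  finally show "{x \<in> space borel. t < frac_maximal (real CARD('n) - s) \<mu> x} \<in> sets borel" by simp
qed

lemma ennpowr_measurable [measurable]:
  assumes [measurable]: "f \<in> borel_measurable M"
  shows "(\<lambda>x. ennpowr (f x) r) \<in> borel_measurable M"
  unfolding ennpowr_def by measurable

lemma ennpowr_mono:
  assumes "a \<le> b" "0 \<le> r"
  shows "ennpowr a r \<le> ennpowr b r"
  using assms by (cases a; cases b) (auto simp: ennpowr_def top_unique intro!: ennreal_leI powr_mono2)

lemma ennpowr_ennreal: "0 \<le> a \<Longrightarrow> ennpowr (ennreal a) r = ennreal (a powr r)"
  by (simp add: ennpowr_def)

lemma less_ennpowr_iff:
  assumes "0 < r" "0 < t"
  shows "ennreal t < ennpowr a r \<longleftrightarrow> ennreal (t powr (1 / r)) < a"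
proof (cases a)
  case (real x)
  have "t < x powr r \<longleftrightarrow> t powr (1 / r) < x"
  proof
    assume "t < x powr r"
    then have "t powr (1 / r) < (x powr r) powr (1 / r)" using assms by (intro powr_less_mono2) auto
    then show "t powr (1 / r) < x" using assms real by (simp add: powr_powr)
  next
    assume "t powr (1 / r) < x"
    then have "(t powr (1 / r)) powr r < x powr r" using assms by (intro powr_less_mono2) auto
    then show "t < x powr r" using assms by (simp add: powr_powr)
  qed
  then show ?thesis using real assms by (simp add: ennpowr_ennreal ennreal_less_iff)
qed (simp add: ennpowr_def)

text \<open>
  Every cube \<open>R\<close> of side \<open>l\<close> that witnesses \<open>t < M \<mu> x\<close> has \<open>l powr s < \<mu>(R) / t\<close>, hence volume at most
  \<open>(\<mu>(R) / t) powr (n / s)\<close>.  The Vitali lemma for the circumscribed balls selects disjoint cubes, and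
  since \<open>n / s \<ge> 1\<close> the sum of these powers is at most the power of the sum; the estimate
  \<open>y powr (n / s) \<le> y * Y powr (n / s - 1)\<close> for \<open>y \<le> Y\<close> does this term by term.
\<close>
lemma frac_maximal_weak_type:
  fixes \<mu> :: "(real ^ 'n) measure"
  defines "n \<equiv> real CARD('n)"
  assumes \<mu>: "sets \<mu> = sets borel" and s: "0 < s" "s < n" and B: "emeasure \<mu> UNIV = ennreal B" "0 < B" and t: "0 < t"
  shows "emeasure lborel {x. ennreal t < frac_maximal (n - s) \<mu> x}
    \<le> ennreal (unit_ball_vol n * (5 * n) ^ CARD('n) * (B / t) powr (n / s))"
proof -
  let ?V = "unit_ball_vol n"
  have n: "0 < n" by (simp add: n_def)
  let ?Y = "B / t"
  define K where "K = {i :: (real ^ 'n) \<times> real. 0 < snd i \<and>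
      ennreal t < ennreal ((2 * snd i) powr (- s)) * emeasure \<mu> (open_cube (fst i) (snd i))}"
  have fin: "emeasure \<mu> (open_cube c h) = ennreal (measure \<mu> (open_cube c h)) \<and> measure \<mu> (open_cube c h) \<le> B" for c h
  proof -
    have "emeasure \<mu> (open_cube c h) \<le> emeasure \<mu> UNIV"
      by (intro emeasure_mono) (auto simp: \<mu> open_cube_sets)
    then have le: "emeasure \<mu> (open_cube c h) \<le> ennreal B" by (simp add: B)
    then have "emeasure \<mu> (open_cube c h) \<noteq> top" by (auto simp: top_unique)
    then show ?thesis using le B by (simp add: emeasure_eq_ennreal_measure)
  qed
  let ?m = "\<lambda>i. measure \<mu> (open_cube (fst i) (snd i))"
  have K: "0 < snd i" "(2 * snd i) powr s < ?m i / t" if "i \<in> K" for i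
  proof -
    show i: "0 < snd i" using that by (simp add: K_def)
    have "ennreal t < ennreal ((2 * snd i) powr (- s) * ?m i)"
      using that fin[of "fst i" "snd i"] by (simp add: K_def ennreal_mult')
    then have "t < (2 * snd i) powr (- s) * ?m i" using t by (simp add: ennreal_less_iff)
    then show "(2 * snd i) powr s < ?m i / t" using i t by (simp add: powr_minus field_simps)
  qed
  have size: "(2 * snd i) ^ CARD('n) \<le> ?m i / t * ?Y powr (n / s - 1)" if "i \<in> K" for i
  proof -
    have y: "0 < ?m i / t" "?m i / t \<le> ?Y"
      using K[OF that] fin[of "fst i" "snd i"] t by (auto intro: le_less_trans[OF powr_ge_zero] divide_right_mono)
    have "(2 * snd i) ^ CARD('n) = ((2 * snd i) powr s) powr (n / s)"
      using K[OF that] s by (simp add: powr_powr n_def powr_realpow)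
    also have "\<dots> \<le> (?m i / t) powr (n / s)"
      using K[OF that] s n by (intro powr_mono2) auto
    also have "\<dots> = ?m i / t * (?m i / t) powr (n / s - 1)"
    proof -
      have "a powr q = a * a powr (q - 1)" if "0 < a" for a q :: real
        using that by (simp add: powr_diff)
      then show ?thesis using y(1) .
    qed
    also have "\<dots> \<le> ?m i / t * ?Y powr (n / s - 1)"
      using y s by (intro mult_left_mono powr_mono2) auto
    finally show ?thesis .
  qed
  have radius: "0 < n * snd i \<and> n * snd i \<le> n * ?Y powr (1 / s)" if "i \<in> K" for i
  proof -
    have "?m i / t \<le> ?Y" using fin[of "fst i" "snd i"] t by (simp add: divide_right_mono)
    then have "(2 * snd i) powr s \<le> ?Y" using K(2)[OF that] by linarith
    then have "((2 * snd i) powr s) powr (1 / s) \<le> ?Y powr (1 / s)" using s by (intro powr_mono2) auto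
    then have "2 * snd i \<le> ?Y powr (1 / s)" using K(1)[OF that] s by (simp add: powr_powr)
    then show ?thesis using K(1)[OF that] n by simp
  qed
  have cov: "{x. ennreal t < frac_maximal (n - s) \<mu> x} \<subseteq> (\<Union>i\<in>K. cball (fst i) (n * snd i))"
  proof
    fix x assume "x \<in> {x. ennreal t < frac_maximal (n - s) \<mu> x}"
    then obtain c h where "0 < h" "x \<in> open_cube c h" "ennreal t < ennreal ((2 * h) powr (- s)) * emeasure \<mu> (open_cube c h)"
      unfolding n_def less_frac_maximal_iff[OF \<mu>] by blast
    then have "(c, h) \<in> K" "x \<in> cball c (n * h)"
      using open_cube_subset_cball[of c h] by (auto simp: K_def n_def)
    then show "x \<in> (\<Union>i\<in>K. cball (fst i) (n * snd i))" by force
  qed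
  obtain C where C: "countable C" "C \<subseteq> K"
    and disj: "pairwise (\<lambda>i j. disjnt (cball (fst i) (n * snd i)) (cball (fst j) (n * snd j))) C"
    and cov: "{x. ennreal t < frac_maximal (n - s) \<mu> x} \<subseteq> (\<Union>i\<in>C. cball (fst i) (5 * (n * snd i)))"
    by (rule Vitali_covering_lemma_cballs[where a = fst and r = "\<lambda>i. n * snd i", OF cov radius])
  define f where "f = to_nat_on C"
  have f: "inj_on f C" using C(1) by (simp add: f_def inj_on_to_nat_on)
  \<comment> \<open>The family is indexed by the natural numbers, with empty sets at unused indices.\<close>
  define A where "A k = (\<Union>i\<in>{i \<in> C. f i = k}. cball (fst i) (5 * (n * snd i)))" for k
  define E where "E k = (\<Union>i\<in>{i \<in> C. f i = k}. open_cube (fst i) (snd i))" for k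
  have single: "(\<exists>i\<in>C. {i \<in> C. f i = k} = {i}) \<or> {i \<in> C. f i = k} = {}" for k
  proof (cases "\<exists>i\<in>C. f i = k")
    case True
    then obtain i where "i \<in> C" "f i = k" by blast
    then have "{i \<in> C. f i = k} = {i}" using f by (auto simp: inj_on_def)
    then show ?thesis using \<open>i \<in> C\<close> by blast
  qed auto
  have AE: "A k \<in> sets borel \<and> E k \<in> sets borel \<and>
     emeasure lborel (A k) \<le> ennreal (?V * (5 * n) ^ CARD('n) * (?Y powr (n / s - 1) / t)) * emeasure \<mu> (E k)" for k
    using single[of k]
  proof (elim disjE bexE)
    fix i assume i: "i \<in> C" "{i \<in> C. f i = k} = {i}"
    then have iK: "i \<in> K" using C by blast
    have "emeasure lborel (A k) = ennreal (?V * (5 * (n * snd i)) ^ CARD('n))"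
      using K(1)[OF iK] n by (simp add: A_def i(2) emeasure_cball n_def)
    also have "\<dots> \<le> ennreal (?V * (5 * n) ^ CARD('n) * (?m i / t * ?Y powr (n / s - 1)))"
    proof (rule ennreal_leI)
      have "snd i ^ CARD('n) \<le> (2 * snd i) ^ CARD('n)" using K(1)[OF iK] by (intro power_mono) auto
      then have "snd i ^ CARD('n) \<le> ?m i / t * ?Y powr (n / s - 1)" using size[OF iK] by linarith
      then have "?V * (5 * n) ^ CARD('n) * snd i ^ CARD('n) \<le> ?V * (5 * n) ^ CARD('n) * (?m i / t * ?Y powr (n / s - 1))"
        using n by (intro mult_left_mono) auto
      then show "?V * (5 * (n * snd i)) ^ CARD('n) \<le> ?V * (5 * n) ^ CARD('n) * (?m i / t * ?Y powr (n / s - 1))"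
        by (simp add: power_mult_distrib mult.assoc)
    qed
    also have "\<dots> = ennreal (?V * (5 * n) ^ CARD('n) * (?Y powr (n / s - 1) / t)) * emeasure \<mu> (E k)"
      using fin[of "fst i" "snd i"] n t by (simp add: E_def i(2) ennreal_mult'[symmetric] field_simps)
    finally show ?thesis by (simp add: A_def E_def i(2) open_cube_sets)
  next
    assume none: "{i \<in> C. f i = k} = {}"
    have "A k = {}" "E k = {}" unfolding A_def E_def none by simp_all
    then show ?thesis by simp
  qed
  have disjE: "disjoint_family E"
    unfolding disjoint_family_on_def
  proof (intro ballI impI equals0I)
    fix k k' x assume kk: "k \<noteq> k'" "x \<in> E k \<inter> E k'"
    then obtain i j where ij: "i \<in> C" "j \<in> C" "f i = k" "f j = k'" "x \<in> open_cube (fst i) (snd i)" "x \<in> open_cube (fst j) (snd j)"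
      by (auto simp: E_def)
    then have "i \<noteq> j" using kk by auto
    then have "disjnt (cball (fst i) (n * snd i)) (cball (fst j) (n * snd j))"
      using disj ij by (auto simp: pairwise_def)
    then show False
      using ij open_cube_subset_cball[of "fst i" "snd i"] open_cube_subset_cball[of "fst j" "snd j"]
      by (auto simp: disjnt_def n_def)
  qed
  have "(\<Union>i\<in>C. cball (fst i) (5 * (n * snd i))) \<subseteq> (\<Union>k. A k)" by (auto simp: A_def)
  then have "emeasure lborel {x. ennreal t < frac_maximal (n - s) \<mu> x} \<le> emeasure lborel (\<Union>k. A k)"
    using cov AE by (intro emeasure_mono) auto
  also have "\<dots> \<le> (\<Sum>k. emeasure lborel (A k))"
    using AE by (intro emeasure_subadditive_countably) auto
  also have "\<dots> \<le> (\<Sum>k. ennreal (?V * (5 * n) ^ CARD('n) * (?Y powr (n / s - 1) / t)) * emeasure \<mu> (E k))"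
    using AE by (intro suminf_le) auto
  also have "\<dots> = ennreal (?V * (5 * n) ^ CARD('n) * (?Y powr (n / s - 1) / t)) * emeasure \<mu> (\<Union>k. E k)"
    using AE disjE by (simp add: suminf_emeasure \<mu> image_subset_iff)
  also have "\<dots> \<le> ennreal (?V * (5 * n) ^ CARD('n) * (?Y powr (n / s - 1) / t)) * ennreal B"
    unfolding B(1)[symmetric] by (intro mult_left_mono emeasure_mono) (auto simp: \<mu>)
  also have "\<dots> = ennreal (?V * (5 * n) ^ CARD('n) * ?Y powr (n / s))"
  proof -
    have "?Y powr (n / s) = ?Y powr (n / s - 1) * ?Y" using B t by (simp add: powr_diff)
    then show ?thesis using B t n by (simp add: ac_simps flip: ennreal_mult')
  qed
  finally show ?thesis .
qed

text \<open>
  A shell of radius \<open>R\<close> alone contributes a multiple of \<open>R powr (n - \<gamma>)\<close>.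
\<close>
lemma nn_integral_power_decay_infinite:
  fixes w :: "'a::euclidean_space \<Rightarrow> ennreal"
  assumes k: "0 < k" and \<gamma>: "0 \<le> \<gamma>" "\<gamma> < real DIM('a)"
    and w: "\<And>x. \<rho> \<le> norm x \<Longrightarrow> 0 < norm x \<Longrightarrow> ennreal (k * norm x powr (- \<gamma>)) \<le> w x"
  shows "(\<integral>\<^sup>+x. w x \<partial>lborel) = \<infinity>"
proof (rule ccontr)
  let ?V = "unit_ball_vol (real DIM('a))"
  have V: "0 < ?V" by simp
  assume "(\<integral>\<^sup>+x. w x \<partial>lborel) \<noteq> \<infinity>"
  then obtain I where I: "(\<integral>\<^sup>+x. w x \<partial>lborel) = ennreal I" "0 \<le> I"
    by (cases "\<integral>\<^sup>+x. w x \<partial>lborel") auto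
  define r where "r = (2 * (I + 1) / (k * ?V)) powr (1 / (real DIM('a) - \<gamma>))"
  define R where "R = max (2 * \<rho>) r"
  have r: "0 < r" using I k V less_imp_neq[OF V] by (simp add: r_def)
  have R: "0 < R" "\<rho> \<le> R / 2" "r \<le> R" using r by (auto simp: R_def)
  let ?S = "{h::'a. R / 2 \<le> norm h \<and> norm h < R}"
  have Sm: "?S \<in> sets lborel" by measurable
  have "ennreal (k * R powr (- \<gamma>) * (?V * R ^ DIM('a) / 2)) =
      ennreal (k * R powr (- \<gamma>)) * ennreal (?V * R ^ DIM('a) / 2)"
    using k by (intro ennreal_mult') simp
  also have "\<dots> \<le> ennreal (k * R powr (- \<gamma>)) * emeasure lborel ?S"
    by (intro mult_left_mono emeasure_shell_ge R) simp
  also have "\<dots> = (\<integral>\<^sup>+x. ennreal (k * R powr (- \<gamma>)) * indicator ?S x \<partial>lborel)"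
    by (rule nn_integral_cmult_indicator[OF Sm, symmetric])
  also have "\<dots> \<le> (\<integral>\<^sup>+x. w x \<partial>lborel)"
  proof (intro nn_integral_mono)
    fix x :: 'a
    show "ennreal (k * R powr (- \<gamma>)) * indicator ?S x \<le> w x"
    proof (cases "x \<in> ?S")
      case True
      then have x: "\<rho> \<le> norm x" "0 < norm x" "norm x \<le> R" using R by auto
      have "R powr (- \<gamma>) \<le> norm x powr (- \<gamma>)" using x \<gamma> by (intro powr_mono2') auto
      then have "ennreal (k * R powr (- \<gamma>)) \<le> ennreal (k * norm x powr (- \<gamma>))"
        using k by (intro ennreal_leI mult_left_mono) auto
      then show ?thesis using True w[OF x(1,2)] by simp
    qed simp
  qed
  finally have le: "k * R powr (- \<gamma>) * (?V * R ^ DIM('a) / 2) \<le> I" using I by simp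
  have e1: "R powr (- \<gamma>) * R ^ DIM('a) = R powr (real DIM('a) - \<gamma>)"
    using powr_add[of R "- \<gamma>" "real DIM('a)"] powr_realpow[OF R(1), of "DIM('a)"] by simp
  have e2: "k * R powr (- \<gamma>) * (?V * R ^ DIM('a) / 2) = k * ?V / 2 * (R powr (- \<gamma>) * R ^ DIM('a))"
    by simp
  have "k * ?V / 2 * R powr (real DIM('a) - \<gamma>) \<le> I" using le unfolding e2 e1 .
  moreover have "2 * (I + 1) / (k * ?V) \<le> R powr (real DIM('a) - \<gamma>)"
  proof -
    have "r powr (real DIM('a) - \<gamma>) \<le> R powr (real DIM('a) - \<gamma>)" using r R \<gamma> by (intro powr_mono2) auto
    moreover have "r powr (real DIM('a) - \<gamma>) = 2 * (I + 1) / (k * ?V)"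
      using \<gamma> I k V by (simp add: r_def powr_powr)
    ultimately show ?thesis by simp
  qed
  then have "k * ?V / 2 * (2 * (I + 1) / (k * ?V)) \<le> k * ?V / 2 * R powr (real DIM('a) - \<gamma>)"
    using k V by (intro mult_left_mono) auto
  moreover have "k * ?V / 2 * (2 * (I + 1) / (k * ?V)) = I + 1" using k less_imp_neq[OF V] by simp
  ultimately show False by linarith
qed

text \<open>
  Some cube around the origin has positive measure, and a cube of side \<open>4 * norm x\<close> around the origin
  contains both that cube and \<open>x\<close>, once \<open>x\<close> is far out.
\<close>
lemma frac_maximal_ge:
  fixes \<mu> :: "(real ^ 'n) measure"
  assumes \<mu>: "sets \<mu> = sets borel" and pos: "emeasure \<mu> UNIV \<noteq> 0"
  obtains k \<rho> where "0 < k" "\<And>x. \<rho> \<le> norm x \<Longrightarrow> 0 < norm x \<Longrightarrow>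
    ennreal (k * norm x powr (- s)) \<le> frac_maximal (real CARD('n) - s) \<mu> x"
proof -
  have "\<exists>m::nat. emeasure \<mu> (open_cube 0 (real m)) \<noteq> 0"
  proof (rule ccontr)
    assume "\<not> (\<exists>m::nat. emeasure \<mu> (open_cube 0 (real m)) \<noteq> 0)"
    then have "open_cube 0 (real m) \<in> null_sets \<mu>" for m by (simp add: null_sets_def \<mu> open_cube_sets)
    then have "(\<Union>m::nat. open_cube 0 (real m)) \<in> null_sets \<mu>" by (rule null_sets_UN)
    moreover have "x \<in> (\<Union>m::nat. open_cube 0 (real m))" for x :: "real ^ 'n"
    proof -
      obtain m :: nat where "norm x < real m" using reals_Archimedean2 by blast
      then show ?thesis using component_le_norm_cart[of x] by (auto simp: mem_open_cube intro: le_less_trans)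
    qed
    ultimately have "UNIV \<in> null_sets \<mu>" by (metis UNIV_eq_I)
    then show False using pos by (simp add: null_sets_def)
  qed
  then obtain \<rho> :: real where \<rho>: "emeasure \<mu> (open_cube 0 \<rho>) \<noteq> 0" by blast
  define k0 where "k0 = (if emeasure \<mu> (open_cube 0 \<rho>) = top then 1 else enn2real (emeasure \<mu> (open_cube 0 \<rho>)))"
  have k0: "0 < k0" "ennreal k0 \<le> emeasure \<mu> (open_cube 0 \<rho>)"
    using \<rho> by (auto simp: k0_def enn2real_positive_iff less_top zero_less_iff_neq_zero)
  show thesis
  proof (rule that)
    show "0 < 4 powr (- s) * k0" using k0 by simp
    fix x :: "real ^ 'n" assume x: "\<rho> \<le> norm x" "0 < norm x"
    have "\<rho> \<le> 2 * norm x" using x by linarith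
    then have "open_cube 0 \<rho> \<subseteq> open_cube 0 (2 * norm x)"
      by (auto simp: mem_open_cube) (meson order_less_le_trans)
    then have "ennreal k0 \<le> emeasure \<mu> (open_cube 0 (2 * norm x))"
      by (rule order_trans[OF k0(2) emeasure_mono]) (simp add: \<mu> open_cube_sets)
    then have "ennreal ((2 * (2 * norm x)) powr (- s)) * ennreal k0 \<le>
      ennreal ((2 * (2 * norm x)) powr (- s)) * emeasure \<mu> (open_cube 0 (2 * norm x))"
      by (rule mult_left_mono) simp
    also have "\<dots> = ennreal ((2 * (2 * norm x)) powr (real CARD('n) - s)) *
        (emeasure \<mu> (open_cube 0 (2 * norm x)) / emeasure lebesgue (open_cube 0 (2 * norm x) :: (real ^ 'n) set))"
      using x by (intro frac_maximal_term[symmetric] is_cube_open_cube) auto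
    also have "\<dots> \<le> frac_maximal (real CARD('n) - s) \<mu> x"
      unfolding frac_maximal_def
    proof (rule SUP_upper2[of "(2 * (2 * norm x), open_cube 0 (2 * norm x))"])
      have "x \<in> open_cube 0 (2 * norm x)"
        using x by (auto simp: mem_open_cube intro!: le_less_trans[OF component_le_norm_cart])
      then show "(2 * (2 * norm x), open_cube 0 (2 * norm x)) \<in> {(l, R). is_cube l R \<and> x \<in> R}"
        using x is_cube_open_cube[of "2 * norm x"] by auto
    qed simp
    finally show "ennreal (4 powr (- s) * k0 * norm x powr (- s)) \<le> frac_maximal (real CARD('n) - s) \<mu> x"
      using k0 by (simp add: powr_mult ac_simps flip: ennreal_mult')
  qed
qed

section \<open>The inequality for weak type weights and its two instances\<close>

text \<open>
  The passage to \<open>p\<close>-th roots; \<open>D = \<infinity>\<close> is included because \<open>L\<close> is positive.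
\<close>
lemma ennpowr_root_le:
  assumes le: "I \<le> ennreal K * D" and K: "0 \<le> K" "K \<le> L powr p" and L: "0 < L" and p: "0 < p"
  shows "ennpowr I (1 / p) \<le> ennreal L * ennpowr D (1 / p)"
proof (cases D)
  case (real d)
  have "I \<le> ennreal (K * d)" using le real K by (simp add: ennreal_mult')
  also have "\<dots> \<le> ennreal (L powr p * d)" using K real by (intro ennreal_leI mult_right_mono) auto
  finally have "ennpowr I (1 / p) \<le> ennpowr (ennreal (L powr p * d)) (1 / p)"
    using p by (intro ennpowr_mono) auto
  also have "\<dots> = ennreal (L * d powr (1 / p))"
    using L p real by (simp add: ennpowr_ennreal powr_mult powr_powr)
  also have "\<dots> = ennreal L * ennpowr D (1 / p)"
    using real L by (simp add: ennpowr_ennreal ennreal_mult')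
  finally show ?thesis .
next
  case top
  then show ?thesis using L by (simp add: ennpowr_def ennreal_mult_top)
qed

text \<open>
  With \<open>1 - \<theta> = (n - \<delta> p) / n\<close> the left side is a multiple of \<open>p powr (p + 1) / (n - \<delta> p) powr p\<close>.  The
  extra factors are dimensional constants, powers \<open>n powr p\<close>, and \<open>p \<le> exp p\<close>, all of which the \<open>p\<close>-th
  power of \<open>E\<close> dominates; one further factor \<open>n - \<delta> p \<le> n\<close> is given away to reach the exponent
  \<open>p + 1\<close> in the denominator.
\<close>
lemma constant_le:
  fixes n \<delta> p V C :: real
  defines "E \<equiv> exp 4 * (3 * C) * (max 1 (4 / V))\<^sup>2 * n\<^sup>2"
  assumes n: "1 \<le> n" and C: "1 \<le> C" and V: "0 < V" and \<delta>: "0 < \<delta>" "\<delta> < 1" and p: "1 \<le> p" and lt: "\<delta> * p < n"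
    and \<theta>: "\<theta> = \<delta> * p / n"
  shows "exp 3 * (3 * C) * ((4 / V) powr (1 + \<theta>) * ((1 - \<delta>) * p)) * (p / (1 - \<theta>)) powr p
    \<le> (E * (1 - \<delta>) powr (1 / p) * (p / (n - \<delta> * p) powr (1 + 1 / p))) powr p"
proof -
  define m where "m = max 1 (4 / V)"
  define G where "G = exp 3 * (3 * C) * m\<^sup>2"
  let ?r = "n - \<delta> * p"
  have r: "0 < ?r" "?r \<le> n" using lt \<delta> p by auto
  have m: "1 \<le> m" "4 / V \<le> m" by (auto simp: m_def)
  have \<theta>01: "0 < \<theta>" "\<theta> < 1" using \<theta> \<delta> p n lt by auto
  have G: "1 \<le> G"
  proof -
    have "1 * 1 * 1 \<le> exp 3 * (3 * C) * m\<^sup>2"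
      using C m by (intro mult_mono) (auto simp: one_le_power)
    then show ?thesis by (simp add: G_def)
  qed
  have "(4 / V) powr (1 + \<theta>) \<le> m powr (1 + \<theta>)" using V m \<theta>01 by (intro powr_mono2) auto
  also have "\<dots> \<le> m powr 2" using m \<theta>01 by (intro powr_mono) auto
  finally have V2: "(4 / V) powr (1 + \<theta>) \<le> m\<^sup>2" using m by (simp add: powr_numeral)
  have pe: "p \<le> exp p" using exp_ge_add_one_self[of p] by linarith
  have GG: "G \<le> G powr p" using powr_mono[of 1 p G] G p by simp
  have nn: "n * n powr p \<le> (n\<^sup>2) powr p"
  proof -
    have "n \<le> n powr p" using powr_mono[of 1 p n] n p by simp
    then have "n * n powr p \<le> n powr p * n powr p" by (intro mult_right_mono) auto
    also have "\<dots> = (n\<^sup>2) powr p" using n by (simp add: power2_eq_square powr_mult)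
    finally show ?thesis .
  qed
  have Ep: "G * p * (n * n powr p) \<le> E powr p"
  proof -
    have "G * p * (n * n powr p) \<le> G powr p * exp p * (n\<^sup>2) powr p"
      using G p n by (intro mult_mono GG pe nn) auto
    also have "\<dots> = (G * exp 1 * n\<^sup>2) powr p"
      using G n by (simp add: powr_mult) (simp add: powr_def)
    also have "G * exp 1 * n\<^sup>2 = E"
    proof -
      have "exp 4 = exp 3 * exp (1::real)" by (simp flip: exp_add)
      then show ?thesis by (simp add: G_def E_def m_def)
    qed
    finally show ?thesis .
  qed
  have eq: "p / (1 - \<theta>) = n * p / ?r" using n r by (simp add: \<theta> field_simps)
  have "exp 3 * (3 * C) * ((4 / V) powr (1 + \<theta>) * ((1 - \<delta>) * p)) * (p / (1 - \<theta>)) powr p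
     \<le> exp 3 * (3 * C) * (m\<^sup>2 * ((1 - \<delta>) * p)) * (p / (1 - \<theta>)) powr p"
    using C V2 \<delta> p by (intro mult_right_mono mult_left_mono) auto
  also have "\<dots> = G * p * n powr p * ((1 - \<delta>) * p powr p / ?r powr p)"
    unfolding eq using n p r by (simp add: G_def powr_mult powr_divide)
  also have "\<dots> = G * p * n powr p * ?r * ((1 - \<delta>) * p powr p / ?r powr (p + 1))"
    using r by (simp add: powr_add)
  also have "\<dots> \<le> G * p * n powr p * n * ((1 - \<delta>) * p powr p / ?r powr (p + 1))"
    using G p \<delta> r n by (intro mult_right_mono mult_left_mono) auto
  also have "\<dots> = G * p * (n * n powr p) * ((1 - \<delta>) * p powr p / ?r powr (p + 1))"
    by (simp only: ac_simps)
  also have "\<dots> \<le> E powr p * ((1 - \<delta>) * p powr p / ?r powr (p + 1))"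
    using \<delta> by (intro mult_right_mono Ep) auto
  also have "\<dots> = (E * (1 - \<delta>) powr (1 / p) * (p / ?r powr (1 + 1 / p))) powr p"
  proof -
    have "(1 + 1 / p) * p = p + 1" using p by (simp add: field_simps)
    moreover have "0 \<le> E" using C by (simp add: E_def)
    ultimately show ?thesis using \<delta> p r
      by (simp add: powr_mult powr_divide powr_powr)
  qed
  finally show ?thesis .
qed

lemma powr_le_base_powr:
  fixes E \<beta> :: real
  assumes "1 \<le> E" "0 < \<beta>"
  shows "E \<le> E powr (\<beta> + 1)"
  using powr_mono[of 1 "\<beta> + 1" E] assms by simp

text \<open>
  The superlevel sets lie in balls around the origin.  At \<open>x = 0\<close> the weight is \<open>0\<close> by the conventions
  for division, which only removes a point.
\<close>
lemma hardy_weight_weak_type: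
  fixes \<gamma> :: real
  assumes \<gamma>: "0 < \<gamma>" and t: "0 < t"
  shows "emeasure lborel {x::'a::euclidean_space. ennreal t < ennreal (1 / norm x powr \<gamma>)}
    \<le> ennreal (unit_ball_vol (real DIM('a)) * (1 / t) powr (real DIM('a) / \<gamma>))"
proof -
  let ?R = "(1 / t) powr (1 / \<gamma>)"
  have R: "0 < ?R" using t by simp
  have "{x::'a. ennreal t < ennreal (1 / norm x powr \<gamma>)} \<subseteq> ball 0 ?R"
  proof
    fix x :: 'a assume "x \<in> {x. ennreal t < ennreal (1 / norm x powr \<gamma>)}"
    then have x: "t < 1 / norm x powr \<gamma>" using t by (simp add: ennreal_less_iff)
    show "x \<in> ball 0 ?R"
    proof (cases "x = 0")
      case False
      then have "norm x powr \<gamma> < 1 / t" using x t by (simp add: field_simps)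
      then have "(norm x powr \<gamma>) powr (1 / \<gamma>) < ?R" using \<gamma> by (intro powr_less_mono2) auto
      then show ?thesis using \<gamma> by (simp add: powr_powr)
    qed (use R in simp)
  qed
  then have "emeasure lborel {x::'a. ennreal t < ennreal (1 / norm x powr \<gamma>)} \<le> emeasure lborel (ball (0::'a) ?R)"
    by (rule emeasure_mono) simp
  also have "\<dots> = ennreal (unit_ball_vol (real DIM('a)) * ?R ^ DIM('a))"
    using R by (intro emeasure_ball) auto
  also have "?R ^ DIM('a) = (1 / t) powr (real DIM('a) / \<gamma>)"
    using R t by (simp add: powr_powr flip: powr_realpow)
  finally show ?thesis .
qed

text \<open>
  The constant depends on the weight only through \<open>C\<close> and \<open>B\<close>, so that one statement serves the maximal
  function and the power weight alike.
\<close>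
proposition weak_type_hardy_inequality:
  fixes u :: "real ^ 'n \<Rightarrow> real" and w :: "real ^ 'n \<Rightarrow> ennreal" and \<delta> p B C :: real
  defines "n \<equiv> real CARD('n)"
  defines "E \<equiv> exp 4 * (3 * C) * (max 1 (4 / unit_ball_vol n))\<^sup>2 * n\<^sup>2"
  assumes p: "1 \<le> p" and \<delta>: "0 < \<delta>" "\<delta> < 1" and lt: "\<delta> * p < n"
    and w: "w \<in> borel_measurable borel" and C: "1 \<le> C" and B: "0 < B"
    and weak: "\<And>t. 0 < t \<Longrightarrow> emeasure lborel {x. ennreal t < w x} \<le> ennreal (C * (B / t) powr (n / (\<delta> * p)))"
    and inf: "(\<integral>\<^sup>+x. w x \<partial>lborel) = \<infinity>" and u: "u \<in> vanishing_mean_class w"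
  shows "ennpowr (\<integral>\<^sup>+x. ennreal (\<bar>u x\<bar> powr p) * w x \<partial>lebesgue) (1 / p) \<le>
    ennreal (E * (1 - \<delta>) powr (1 / p) * (p / (n - \<delta> * p) powr (1 + 1 / p)) * B powr (1 / p))
      * ennpowr (gagliardo_energy \<delta> p u) (1 / p)"
proof -
  let ?V = "unit_ball_vol n"
  have n: "1 \<le> n" using zero_less_card_finite[where 'a = 'n] by (simp add: n_def Suc_le_eq)
  have V: "0 < ?V" using n by (simp add: unit_ball_vol_pos)
  define \<theta> where "\<theta> = \<delta> * p / n"
  have \<theta>: "0 < \<theta>" "\<theta> < 1" "1 / \<theta> = n / (\<delta> * p)" using \<delta> p n lt by (auto simp: \<theta>_def)
  have ww: "weak_type_weight \<theta> (3 * C * B) w"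
    by (intro weak_type_weightI) (use w \<theta> C B weak in auto)
  let ?L = "E * (1 - \<delta>) powr (1 / p) * (p / (n - \<delta> * p) powr (1 + 1 / p))"
  have L: "0 < ?L" using C n \<delta> p lt by (auto simp: E_def intro!: mult_pos_pos divide_pos_pos)
  let ?K = "exp 3 * (3 * C * B) * ((4 / ?V) powr (1 + \<theta>) * ((1 - \<delta>) * p)) * (p / (1 - \<theta>)) powr p"
  have bound: "(\<integral>\<^sup>+x. ennreal (\<bar>u x\<bar> powr p) * w x \<partial>lebesgue) \<le> ennreal ?K * gagliardo_energy \<delta> p u"
    unfolding n_def
    using weak_type_weighted_inequality[OF p \<delta> _ \<theta>(2) ww _ inf u] C B by (simp add: \<theta>_def n_def)
  have "?K = exp 3 * (3 * C) * ((4 / ?V) powr (1 + \<theta>) * ((1 - \<delta>) * p)) * (p / (1 - \<theta>)) powr p * B"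
    by simp
  also have "\<dots> \<le> ?L powr p * B"
    unfolding E_def using B by (intro mult_right_mono constant_le n C V \<delta> p lt \<theta>_def) auto
  also have "\<dots> = (?L * B powr (1 / p)) powr p"
    using L B p by (subst powr_mult) (auto simp: powr_powr)
  finally have K: "?K \<le> (?L * B powr (1 / p)) powr p" .
  show ?thesis
  proof (rule ennpowr_root_le[OF bound _ K])
    show "0 < ?L * B powr (1 / p)" using B by (intro mult_pos_pos L) simp
  qed (use B C \<delta> p in auto)
qed

text \<open>
  For the maximal function, \<open>s = p \<delta> / \<beta>\<close> turns the weak type exponent \<open>n / s\<close> of \<open>M \<mu>\<close> into
  \<open>n / (\<delta> p)\<close> for its power \<open>\<beta>\<close>, with \<open>B = \<mu>(UNIV) powr \<beta>\<close>.  The measures of total mass \<open>0\<close> and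
  \<open>\<infinity>\<close> are treated apart: for the first the weight vanishes, for the second only functions of zero
  energy matter.
\<close>
theorem corollary2p8:
  defines "n \<equiv> real CARD('n::finite)"
  shows "(\<exists>c>0. \<forall>(\<delta>::real) (\<beta>::real) (p::real) (\<mu> :: (real ^ 'n) measure) (u :: real ^ 'n \<Rightarrow> real).
      0 < \<delta> \<longrightarrow> \<delta> < 1 \<longrightarrow> 0 < \<beta> \<longrightarrow> 1 \<le> p \<longrightarrow> p < n / \<delta> * min 1 \<beta> \<longrightarrow>
      sets \<mu> = sets borel \<longrightarrow>
      (AE x in lebesgue. frac_maximal (n - p * \<delta> / \<beta>) \<mu> x < \<infinity>) \<longrightarrow>
      u \<in> vanishing_mean_class (\<lambda>x. ennpowr (frac_maximal (n - p * \<delta> / \<beta>) \<mu> x) \<beta>) \<longrightarrow>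
      ennpowr (\<integral>\<^sup>+ x. ennreal (\<bar>u x\<bar> powr p) *
          ennpowr (frac_maximal (n - p * \<delta> / \<beta>) \<mu> x) \<beta> \<partial>lebesgue) (1 / p)
      \<le> ennreal (c powr (\<beta> + 1) * (1 - \<delta>) powr (1 / p) * (p / (n - \<delta> * p) powr (1 + 1 / p)))
        * ennpowr (emeasure \<mu> UNIV) (\<beta> / p)
        * ennpowr (gagliardo_energy \<delta> p u) (1 / p))
    \<and>
    (\<exists>c>0. \<forall>(\<delta>::real) (p::real) (u :: real ^ 'n \<Rightarrow> real).
      0 < \<delta> \<longrightarrow> \<delta> < 1 \<longrightarrow> 1 \<le> p \<longrightarrow> p < n / \<delta> \<longrightarrow>
      u \<in> vanishing_mean_class (\<lambda>x. ennreal (1 / norm x powr (\<delta> * p))) \<longrightarrow>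
      ennpowr (\<integral>\<^sup>+ x. ennreal (\<bar>u x\<bar> powr p * (1 / norm x powr (\<delta> * p))) \<partial>lebesgue) (1 / p)
      \<le> ennreal (c * (1 - \<delta>) powr (1 / p) * (p / (n - \<delta> * p) powr (1 + 1 / p)))
        * ennpowr (gagliardo_energy \<delta> p u) (1 / p))"
proof (rule conjI)
  let ?V = "unit_ball_vol n"
  have n: "1 \<le> n" using zero_less_card_finite[where 'a = 'n] by (simp add: n_def Suc_le_eq)
  have V: "0 < ?V" using n by (simp add: unit_ball_vol_pos)
  define E where "E C = exp 4 * (3 * C) * (max 1 (4 / ?V))\<^sup>2 * n\<^sup>2" for C
  have E: "1 \<le> E C" if "1 \<le> C" for C
  proof -
    have "1 * 1 * 1 * 1 \<le> exp 4 * (3 * C) * (max 1 (4 / ?V))\<^sup>2 * n\<^sup>2"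
      using that n by (intro mult_mono) (auto simp: one_le_power)
    then show ?thesis by (simp add: E_def)
  qed
  define C1 where "C1 = ?V * (5 * n) ^ CARD('n) + 1"
  have C1: "1 \<le> C1" using V n by (simp add: C1_def)
  show "\<exists>c>0. \<forall>(\<delta>::real) (\<beta>::real) (p::real) (\<mu> :: (real ^ 'n) measure) (u :: real ^ 'n \<Rightarrow> real).
      0 < \<delta> \<longrightarrow> \<delta> < 1 \<longrightarrow> 0 < \<beta> \<longrightarrow> 1 \<le> p \<longrightarrow> p < n / \<delta> * min 1 \<beta> \<longrightarrow>
      sets \<mu> = sets borel \<longrightarrow>
      (AE x in lebesgue. frac_maximal (n - p * \<delta> / \<beta>) \<mu> x < \<infinity>) \<longrightarrow>
      u \<in> vanishing_mean_class (\<lambda>x. ennpowr (frac_maximal (n - p * \<delta> / \<beta>) \<mu> x) \<beta>) \<longrightarrow>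
      ennpowr (\<integral>\<^sup>+ x. ennreal (\<bar>u x\<bar> powr p) *
          ennpowr (frac_maximal (n - p * \<delta> / \<beta>) \<mu> x) \<beta> \<partial>lebesgue) (1 / p)
      \<le> ennreal (c powr (\<beta> + 1) * (1 - \<delta>) powr (1 / p) * (p / (n - \<delta> * p) powr (1 + 1 / p)))
        * ennpowr (emeasure \<mu> UNIV) (\<beta> / p)
        * ennpowr (gagliardo_energy \<delta> p u) (1 / p)"
  proof (intro exI[of _ "E C1"] conjI allI impI)
    show "0 < E C1" using E[OF C1] by simp
    fix \<delta> \<beta> p :: real and \<mu> :: "(real ^ 'n) measure" and u :: "real ^ 'n \<Rightarrow> real"
    assume \<delta>: "0 < \<delta>" "\<delta> < 1" and \<beta>: "0 < \<beta>" and p: "1 \<le> p" and pn: "p < n / \<delta> * min 1 \<beta>"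
      and \<mu>: "sets \<mu> = sets borel"
      and u: "u \<in> vanishing_mean_class (\<lambda>x. ennpowr (frac_maximal (n - p * \<delta> / \<beta>) \<mu> x) \<beta>)"
    define s where "s = p * \<delta> / \<beta>"
    define w where "w x = ennpowr (frac_maximal (n - s) \<mu> x) \<beta>" for x
    have "p * \<delta> < n * min 1 \<beta>" using pn \<delta> by (simp add: field_simps)
    moreover have "n * min 1 \<beta> \<le> n * 1" "n * min 1 \<beta> \<le> n * \<beta>" using n by (intro mult_left_mono; simp)+
    ultimately have lt: "\<delta> * p < n" "p * \<delta> < n * \<beta>" by (simp_all add: mult.commute)
    have s: "0 < s" "s < n" using p \<delta> \<beta> lt by (auto simp: s_def field_simps)
    have u: "u \<in> vanishing_mean_class w" using u by (simp add: w_def[abs_def] s_def)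
    have wm: "w \<in> borel_measurable borel"
      unfolding w_def using frac_maximal_measurable[OF \<mu>, of s] unfolding n_def by measurable
    have inf: "(\<integral>\<^sup>+x. w x \<partial>lborel) = \<infinity>" if pos: "emeasure \<mu> UNIV \<noteq> 0"
    proof -
      obtain k \<rho> where k: "0 < k" "\<And>x. \<rho> \<le> norm x \<Longrightarrow> 0 < norm x \<Longrightarrow> ennreal (k * norm x powr (- s)) \<le> frac_maximal (n - s) \<mu> x"
        using frac_maximal_ge[OF \<mu> pos, of s] unfolding n_def by blast
      show ?thesis
      proof (rule nn_integral_power_decay_infinite[of "k powr \<beta>" "\<delta> * p" \<rho>])
        fix x :: "real ^ 'n" assume x: "\<rho> \<le> norm x" "0 < norm x"
        have "ennreal (k powr \<beta> * norm x powr (- (\<delta> * p))) = ennpowr (ennreal (k * norm x powr (- s))) \<beta>"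
          using k(1) \<beta> by (simp add: ennpowr_ennreal powr_mult powr_powr s_def mult.commute)
        also have "\<dots> \<le> w x" unfolding w_def using k(2)[OF x] \<beta> by (intro ennpowr_mono) auto
        finally show "ennreal (k powr \<beta> * norm x powr (- (\<delta> * p))) \<le> w x" .
      qed (use k \<delta> p lt in \<open>auto simp: n_def\<close>)
    qed
    let ?L = "(1 - \<delta>) powr (1 / p) * (p / (n - \<delta> * p) powr (1 + 1 / p))"
    have L: "0 < ?L" using \<delta> p lt by auto
    have "ennpowr (\<integral>\<^sup>+ x. ennreal (\<bar>u x\<bar> powr p) * w x \<partial>lebesgue) (1 / p)
      \<le> ennreal (E C1 powr (\<beta> + 1) * ?L) * ennpowr (emeasure \<mu> UNIV) (\<beta> / p) * ennpowr (gagliardo_energy \<delta> p u) (1 / p)"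
    proof (cases "emeasure \<mu> UNIV")
      case top
      show ?thesis
      proof (cases "gagliardo_energy \<delta> p u = 0")
        case True
        have "AE x in lborel. u x = 0"
          using zero_energy_imp_AE_zero[OF wm inf p u True] top by simp
        then have "(\<integral>\<^sup>+ x. ennreal (\<bar>u x\<bar> powr p) * w x \<partial>lebesgue) = (\<integral>\<^sup>+ x. 0 \<partial>(lebesgue :: (real ^ 'n) measure))"
          unfolding nn_integral_completion by (intro nn_integral_cong_AE) (auto elim!: eventually_mono)
        then show ?thesis by (simp add: ennpowr_def)
      next
        case False
        then have "ennpowr (gagliardo_energy \<delta> p u) (1 / p) \<noteq> 0"
          by (cases "gagliardo_energy \<delta> p u") (auto simp: ennpowr_def)
        moreover have "0 < E C1 powr (\<beta> + 1)" using E[OF C1] by simp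
        then have "0 < E C1 powr (\<beta> + 1) * ?L" using L by (rule mult_pos_pos)
        then have "ennreal (E C1 powr (\<beta> + 1) * ?L) \<noteq> 0" by (simp only: ennreal_eq_0_iff)
        ultimately show ?thesis using top by (simp add: ennpowr_def[of top] ennreal_mult_top ennreal_top_mult)
      qed
    next
      case (real B)
      show ?thesis
      proof (cases "B = 0")
        case True
        have "frac_maximal (n - s) \<mu> x = 0" for x
        proof -
          have null: "emeasure \<mu> R = 0" for R
            using emeasure_space[of \<mu> R] sets_eq_imp_space_eq[OF \<mu>] real True by simp
          have "frac_maximal (n - s) \<mu> x \<le> 0"
            unfolding frac_maximal_def null by (intro SUP_least) (auto simp: divide_ennreal_def)
          then show ?thesis by simp
        qed
        then show ?thesis by (simp add: w_def ennpowr_def)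
      next
        case False
        then have B: "0 < B" using real by simp
        have weak: "emeasure lborel {x. ennreal t < w x} \<le> ennreal (C1 * (B powr \<beta> / t) powr (n / (\<delta> * p)))"
          if t: "0 < t" for t
        proof -
          have "emeasure lborel {x. ennreal t < w x} = emeasure lborel {x. ennreal (t powr (1 / \<beta>)) < frac_maximal (n - s) \<mu> x}"
            unfolding w_def using \<beta> t by (simp add: less_ennpowr_iff)
          also have "\<dots> \<le> ennreal (?V * (5 * n) ^ CARD('n) * (B / t powr (1 / \<beta>)) powr (n / s))"
            using frac_maximal_weak_type[OF \<mu> s(1) _ real(2) B, of "t powr (1 / \<beta>)"] s t by (simp add: n_def)
          also have "(B / t powr (1 / \<beta>)) powr (n / s) = (B powr \<beta> / t) powr (n / (\<delta> * p))"
          proof -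
            have "B / t powr (1 / \<beta>) = (B powr \<beta> / t) powr (1 / \<beta>)"
              using B t \<beta> by (simp add: powr_divide powr_powr)
            then show ?thesis using \<beta> by (simp add: powr_powr s_def mult.commute)
          qed
          also have "ennreal (?V * (5 * n) ^ CARD('n) * (B powr \<beta> / t) powr (n / (\<delta> * p))) \<le>
              ennreal (C1 * (B powr \<beta> / t) powr (n / (\<delta> * p)))"
            by (intro ennreal_leI mult_right_mono) (auto simp: C1_def)
          finally show ?thesis .
        qed
        have "ennpowr (\<integral>\<^sup>+x. ennreal (\<bar>u x\<bar> powr p) * w x \<partial>lebesgue) (1 / p) \<le>
          ennreal (E C1 * (1 - \<delta>) powr (1 / p) * (p / (n - \<delta> * p) powr (1 + 1 / p)) * (B powr \<beta>) powr (1 / p))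
          * ennpowr (gagliardo_energy \<delta> p u) (1 / p)"
          unfolding E_def n_def
          by (rule weak_type_hardy_inequality) (use p \<delta> lt wm C1 B weak inf real u in \<open>auto simp: n_def\<close>)
        also have "\<dots> \<le> ennreal (E C1 powr (\<beta> + 1) * ?L * B powr (\<beta> / p)) * ennpowr (gagliardo_energy \<delta> p u) (1 / p)"
        proof (intro mult_right_mono ennreal_leI)
          have "E C1 * (?L * B powr (\<beta> / p)) \<le> E C1 powr (\<beta> + 1) * (?L * B powr (\<beta> / p))"
            by (rule mult_right_mono[OF powr_le_base_powr[OF E[OF C1] \<beta>]
                mult_nonneg_nonneg[OF less_imp_le[OF L] powr_ge_zero]])
          then show "E C1 * (1 - \<delta>) powr (1 / p) * (p / (n - \<delta> * p) powr (1 + 1 / p)) * (B powr \<beta>) powr (1 / p) \<le>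
            E C1 powr (\<beta> + 1) * ?L * B powr (\<beta> / p)"
            by (simp only: powr_powr mult.assoc) simp
        qed simp
        also have "ennreal (E C1 powr (\<beta> + 1) * ?L * B powr (\<beta> / p)) =
            ennreal (E C1 powr (\<beta> + 1) * ?L) * ennpowr (emeasure \<mu> UNIV) (\<beta> / p)"
          using real by (subst ennreal_mult'') (auto simp: ennpowr_ennreal)
        finally show ?thesis .
      qed
    qed
    then show "ennpowr (\<integral>\<^sup>+ x. ennreal (\<bar>u x\<bar> powr p) *
          ennpowr (frac_maximal (n - p * \<delta> / \<beta>) \<mu> x) \<beta> \<partial>lebesgue) (1 / p)
      \<le> ennreal (E C1 powr (\<beta> + 1) * (1 - \<delta>) powr (1 / p) * (p / (n - \<delta> * p) powr (1 + 1 / p)))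
        * ennpowr (emeasure \<mu> UNIV) (\<beta> / p)
        * ennpowr (gagliardo_energy \<delta> p u) (1 / p)"
      by (simp add: w_def s_def mult.assoc)
  qed
  define C2 where "C2 = ?V + 1"
  have C2: "1 \<le> C2" using V by (simp add: C2_def)
  show "\<exists>c>0. \<forall>(\<delta>::real) (p::real) (u :: real ^ 'n \<Rightarrow> real).
      0 < \<delta> \<longrightarrow> \<delta> < 1 \<longrightarrow> 1 \<le> p \<longrightarrow> p < n / \<delta> \<longrightarrow>
      u \<in> vanishing_mean_class (\<lambda>x. ennreal (1 / norm x powr (\<delta> * p))) \<longrightarrow>
      ennpowr (\<integral>\<^sup>+ x. ennreal (\<bar>u x\<bar> powr p * (1 / norm x powr (\<delta> * p))) \<partial>lebesgue) (1 / p)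
      \<le> ennreal (c * (1 - \<delta>) powr (1 / p) * (p / (n - \<delta> * p) powr (1 + 1 / p)))
        * ennpowr (gagliardo_energy \<delta> p u) (1 / p)"
  proof (intro exI[of _ "E C2"] conjI allI impI)
    show "0 < E C2" using E[OF C2] by simp
    fix \<delta> p :: real and u :: "real ^ 'n \<Rightarrow> real"
    assume \<delta>: "0 < \<delta>" "\<delta> < 1" and p: "1 \<le> p" and pn: "p < n / \<delta>"
      and u: "u \<in> vanishing_mean_class (\<lambda>x. ennreal (1 / norm x powr (\<delta> * p)))"
    let ?w = "\<lambda>x :: real ^ 'n. ennreal (1 / norm x powr (\<delta> * p))"
    have lt: "\<delta> * p < n" using pn \<delta> by (simp add: field_simps)
    have \<gamma>: "0 < \<delta> * p" using \<delta> p by simp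
    have weak: "emeasure lborel {x. ennreal t < ?w x} \<le> ennreal (C2 * (1 / t) powr (n / (\<delta> * p)))" if t: "0 < t" for t
    proof -
      have "emeasure lborel {x. ennreal t < ?w x} \<le> ennreal (?V * (1 / t) powr (n / (\<delta> * p)))"
        using hardy_weight_weak_type[OF \<gamma> t, where ?'a = "real ^ 'n"] by (simp add: n_def)
      also have "\<dots> \<le> ennreal (C2 * (1 / t) powr (n / (\<delta> * p)))"
        by (intro ennreal_leI mult_right_mono) (auto simp: C2_def)
      finally show ?thesis .
    qed
    have inf: "(\<integral>\<^sup>+x. ?w x \<partial>lborel) = \<infinity>"
      by (rule nn_integral_power_decay_infinite[of 1 "\<delta> * p" 0])
         (use \<delta> p lt in \<open>auto simp: n_def powr_minus_divide\<close>)
    have "ennpowr (\<integral>\<^sup>+x. ennreal (\<bar>u x\<bar> powr p) * ?w x \<partial>lebesgue) (1 / p) \<le>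
      ennreal (E C2 * (1 - \<delta>) powr (1 / p) * (p / (n - \<delta> * p) powr (1 + 1 / p)) * 1 powr (1 / p))
      * ennpowr (gagliardo_energy \<delta> p u) (1 / p)"
      unfolding E_def n_def
      by (rule weak_type_hardy_inequality) (use p \<delta> lt C2 weak inf u in \<open>auto simp: n_def\<close>)
    then show "ennpowr (\<integral>\<^sup>+ x. ennreal (\<bar>u x\<bar> powr p * (1 / norm x powr (\<delta> * p))) \<partial>lebesgue) (1 / p)
      \<le> ennreal (E C2 * (1 - \<delta>) powr (1 / p) * (p / (n - \<delta> * p) powr (1 + 1 / p)))
        * ennpowr (gagliardo_energy \<delta> p u) (1 / p)"
      by (simp add: ennreal_mult' del: times_divide_eq_right)
  qed
qed

end
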